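(* Let $K$ be a simplicial complex and let $F$ be a cellular cosheaf on $K$, i.e. a functor $F\colon P(K)^{\mathrm{op}}\to\mathbf{Ab}$. Let $\mathcal{X}(P(K))$ be the associated $T_0$-Alexandroff space and $\widehat{F}$ the associated cosheaf on it. Then for every $n\ge 0$ there is an isomorphism $$H^{\mathrm{BM}}_n(K;F)\cong H_n(\mathcal{X}(P(K));\widehat{F}),$$ where the left side is the Borel-Moore homology of $F$ and the right side is the cosheaf homology of $\widehat{F}$.
   Context: Face poset and space: $P(K)$ is the poset of (nonempty) simplices of $K$ ordered by the face relation $\tau\le\sigma$. $\mathcal{X}(P(K))$ is the set $P(K)$ with the topology having as basis the sets $U_\sigma=\{\tau\in P(K)\mid \tau\ge\sigma\}$; it is a $T_0$-Alexandroff space (arbitrary intersections of open sets are open), and $U_\sigma$ is the smallest open set containing $\sigma$. Cosheaves: for a topological space $X$, $\mathrm{Open}(X)$ is the poset of open sets ordered by inclusion, viewed as a category. A precosheaf on $X$ is a functor $\mathrm{Open}(X)\to\mathbf{Ab}$; homomorphisms are natural transformations. For an open cover $\mathcal{U}$ of an open set $U$, the nerve $\mathtt{N}(\mathcal{U})$ is the poset of nonempty finite subsets $\{U_0,\ldots,U_n\}\subset\mathcal{U}$ with nonempty intersection, ordered by reverse inclusion; a precosheaf $G$ is a cosheaf if the natural map from $\operatorname{colim}_{\mathtt{N}(\mathcal{U})}G$ (the colimit of $\{U_0,\ldots,U_n\}\mapsto G(U_0\cap\cdots\cap U_n)$) to $G(U)$ is an isomorphism for each open $U$ and each open cover $\mathcal{U}$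 of $U$. Associated cosheaf: $\widehat{F}(U)=\operatorname{colim}_{\sigma\in U}F(\sigma)$ for $U$ open in $\mathcal{X}(P(K))$, where $U$ is regarded as a subposet of $P(K)^{\mathrm{op}}$; this is a cosheaf. Borel-Moore homology: fix orientations of the simplices. $C_n^{\mathrm{BM}}(K;F)=\bigoplus_{\dim\sigma=n}F(\sigma)$, and for $x\in F(\sigma)$ with $\dim\sigma=n$, $\partial(x)=\sum_{\dim\tau=n-1}[\sigma:\tau]\,F(\sigma>\tau)(x)$, where $[\sigma:\tau]$ is the incidence number ($\pm1$ if $\tau$ is a codimension-one face of $\sigma$, and $0$ otherwise) and $F(\sigma>\tau)\colon F(\sigma)\to F(\tau)$ is the structure map. $H^{\mathrm{BM}}_*(K;F)$ is the homology of this chain complex. Cosheaf homology: for a $T_0$-Alexandroff space $X$ with smallest open neighbourhoods $U_x$, the costalk of $G$ at $x$ is $G_x=G(U_x)$. A sequence of cosheaves is exact if it is exact on costalks at every point; $\alpha\colon G\to G'$ is surjective if $G\to G'\to 0$ is exact. A cosheaf $P$ is projective if every homomorphism $P\to G'$ of cosheaves lifts through every surjective homomorphism $G\to G'$ of cosheaves. A projective resolution of $G$ is an exact sequence of cosheaves $\cdots\to P_1\to P_0\to G\to0$ with every $P_n$ projective; it exists and is unique up to homotopy. $H_*(X;G)$ is the homology of the chain complex $\cdots\to P_1(X)\to P_0(X)\to 0$. *)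

theory Defs
  imports
    "HOL-Algebra.Free_Abelian_Groups"
    "HOL-Analysis.Abstract_Topology"
    "HOL-Combinatorics.Permutations"
begin

section \<open>Diagrams of abelian groups and their colimits\<close>

text \<open>
  Abelian groups are commutative groups of HOL-Algebra, written multiplicatively.
  A functor to Ab whose source is a poset \<open>I\<close>, seen as a category with one arrow
  \<open>i \<rightarrow> j\<close> whenever \<open>R i j\<close>, is given by its groups and its structure maps; the
  latter matter only on carriers.
\<close>

record ('i, 'a) diagram =
  grp :: "'i \<Rightarrow> 'a monoid"
  arr :: "'i \<Rightarrow> 'i \<Rightarrow> 'a \<Rightarrow> 'a"

definition ab_functor :: "'i set \<Rightarrow> ('i \<Rightarrow> 'i \<Rightarrow> bool) \<Rightarrow> ('i, 'a) diagram \<Rightarrow> bool" where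
  "ab_functor I R D \<longleftrightarrow>
     (\<forall>i\<in>I. comm_group (grp D i)) \<and>
     (\<forall>i\<in>I. \<forall>j\<in>I. R i j \<longrightarrow> arr D i j \<in> hom (grp D i) (grp D j)) \<and>
     (\<forall>i\<in>I. \<forall>x\<in>carrier (grp D i). arr D i i x = x) \<and>
     (\<forall>i\<in>I. \<forall>j\<in>I. \<forall>k\<in>I. R i j \<longrightarrow> R j k \<longrightarrow>
        (\<forall>x\<in>carrier (grp D i). arr D j k (arr D i j x) = arr D i k x))"

definition sum_inj :: "'i set \<Rightarrow> ('i \<Rightarrow> 'a monoid) \<Rightarrow> 'i \<Rightarrow> 'a \<Rightarrow> 'i \<Rightarrow> 'a" where
  "sum_inj I G i x = (\<lambda>k\<in>I. if k = i then x else \<one>\<^bsub>G k\<^esub>)"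

text \<open>
  The colimit is the quotient of the direct sum of all groups that identifies every
  \<open>x\<close> at \<open>i\<close> with its image under each structure map \<open>i \<rightarrow> j\<close>.
\<close>

definition colim_relations :: "'i set \<Rightarrow> ('i \<Rightarrow> 'i \<Rightarrow> bool) \<Rightarrow> ('i, 'a) diagram \<Rightarrow> ('i \<Rightarrow> 'a) set" where
  "colim_relations I R D =
     generate (sum_group I (grp D))
       {sum_inj I (grp D) j (arr D i j x)
          \<otimes>\<^bsub>sum_group I (grp D)\<^esub> inv\<^bsub>sum_group I (grp D)\<^esub> sum_inj I (grp D) i x | i j x.
        i \<in> I \<and> j \<in> I \<and> R i j \<and> x \<in> carrier (grp D i)}"

definition colim :: "'i set \<Rightarrow> ('i \<Rightarrow> 'i \<Rightarrow> bool) \<Rightarrow> ('i, 'a) diagram \<Rightarrow> ('i \<Rightarrow> 'a) set monoid" where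
  "colim I R D = sum_group I (grp D) Mod colim_relations I R D"

definition colim_inj ::
  "'i set \<Rightarrow> ('i \<Rightarrow> 'i \<Rightarrow> bool) \<Rightarrow> ('i, 'a) diagram \<Rightarrow> 'i \<Rightarrow> 'a \<Rightarrow> ('i \<Rightarrow> 'a) set" where
  "colim_inj I R D i x =
     colim_relations I R D #>\<^bsub>sum_group I (grp D)\<^esub> sum_inj I (grp D) i x"

text \<open>
  The map out of the colimit induced by a cocone \<open>f i : D i \<rightarrow> H\<close>. An element of the
  colimit is a coset; all its representatives \<open>c\<close> have the same image
  (in additive notation) \<open>\<Sum>i. f i (c i)\<close>, where almost all terms vanish.
\<close>

definition colim_desc :: "'i set \<Rightarrow> 'b monoid \<Rightarrow> ('i \<Rightarrow> 'a \<Rightarrow> 'b) \<Rightarrow> ('i \<Rightarrow> 'a) set \<Rightarrow> 'b" where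
  "colim_desc I H f A = the_elem ((\<lambda>c. gfinprod H (\<lambda>i. f i (c i)) I) ` A)"


section \<open>Homology of a chain complex\<close>

text \<open>The differential \<open>d n\<close> goes from degree \<open>n + 1\<close> to degree \<open>n\<close>; degree \<open>0\<close> maps to \<open>0\<close>.\<close>

definition cycles :: "(nat \<Rightarrow> 'a monoid) \<Rightarrow> (nat \<Rightarrow> 'a \<Rightarrow> 'a) \<Rightarrow> nat \<Rightarrow> 'a set" where
  "cycles C d n =
     (case n of 0 \<Rightarrow> carrier (C 0) | Suc m \<Rightarrow> kernel (C (Suc m)) (C m) (d m))"

definition chain_homology :: "(nat \<Rightarrow> 'a monoid) \<Rightarrow> (nat \<Rightarrow> 'a \<Rightarrow> 'a) \<Rightarrow> nat \<Rightarrow> 'a set monoid" where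
  "chain_homology C d n =
     subgroup_generated (C n) (cycles C d n) Mod (d n ` carrier (C (Suc n)))"


section \<open>Simplicial complexes and Borel-Moore homology\<close>

definition abstract_simplicial_complex :: "'v set set \<Rightarrow> bool" where
  "abstract_simplicial_complex K \<longleftrightarrow>
     (\<forall>\<sigma>\<in>K. finite \<sigma> \<and> \<sigma> \<noteq> {} \<and> (\<forall>\<tau>. \<tau> \<subseteq> \<sigma> \<and> \<tau> \<noteq> {} \<longrightarrow> \<tau> \<in> K))"

text \<open>\<open>K\<close> with inclusion is its own face poset; \<open>arr F \<sigma> \<tau>\<close> is the map for \<open>\<tau> \<subseteq> \<sigma>\<close>.\<close>

definition cellular_cosheaf :: "'v set set \<Rightarrow> ('v set, 'a) diagram \<Rightarrow> bool" where
  "cellular_cosheaf K F \<longleftrightarrow> ab_functor K (\<supseteq>) F"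

text \<open>
  An orientation of a simplex is represented by an ordering of its vertices, chosen
  independently for each simplex.
\<close>

definition orientation :: "'v set set \<Rightarrow> ('v set \<Rightarrow> 'v list) \<Rightarrow> bool" where
  "orientation K \<omega> \<longleftrightarrow> (\<forall>\<sigma>\<in>K. distinct (\<omega> \<sigma>) \<and> set (\<omega> \<sigma>) = \<sigma>)"

definition rearrangement_sign :: "'v list \<Rightarrow> 'v list \<Rightarrow> int" where
  "rearrangement_sign xs ys =
     sign (THE p. p permutes {..<length xs} \<and> permute_list p xs = ys)"

text \<open>
  If \<open>\<sigma>\<close> is oriented as \<open>[v\<^sub>0, \<dots>, v\<^sub>n]\<close> and \<open>\<tau>\<close> omits \<open>v\<^sub>i\<close>, then
  \<open>i\<close> is the length of the longest prefix with all vertices in \<open>\<tau>\<close>, and the orientation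
  induced on \<open>\<tau>\<close> is \<open>(-1)\<^sup>i\<close> times that of \<open>[v\<^sub>0, \<dots>, v\<^sub>n]\<close> with \<open>v\<^sub>i\<close> deleted.
\<close>

definition incidence :: "('v set \<Rightarrow> 'v list) \<Rightarrow> 'v set \<Rightarrow> 'v set \<Rightarrow> int" where
  "incidence \<omega> \<sigma> \<tau> =
     (if \<tau> \<subseteq> \<sigma> \<and> card \<sigma> = Suc (card \<tau>)
      then (-1) ^ length (takeWhile (\<lambda>v. v \<in> \<tau>) (\<omega> \<sigma>))
             * rearrangement_sign (filter (\<lambda>v. v \<in> \<tau>) (\<omega> \<sigma>)) (\<omega> \<tau>)
      else 0)"

definition simplices :: "'v set set \<Rightarrow> nat \<Rightarrow> 'v set set" where
  "simplices K n = {\<sigma>\<in>K. card \<sigma> = Suc n}"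

definition bm_chains :: "'v set set \<Rightarrow> ('v set, 'a) diagram \<Rightarrow> nat \<Rightarrow> ('v set \<Rightarrow> 'a) monoid" where
  "bm_chains K F n = sum_group (simplices K n) (grp F)"

text \<open>
  The boundary of a chain \<open>c\<close>, given by its components: in additive notation, the value
  at \<open>\<tau>\<close> is \<open>\<Sum>\<sigma>. [\<sigma>:\<tau>] F(\<sigma> > \<tau>)(c \<sigma>)\<close>. There can be infinitely many cofaces \<open>\<sigma>\<close>
  of \<open>\<tau>\<close>, but only finitely many nonzero terms; non-faces contribute \<open>0\<close>.
\<close>

definition bm_boundary ::
  "'v set set \<Rightarrow> ('v set \<Rightarrow> 'v list) \<Rightarrow> ('v set, 'a) diagram \<Rightarrow> nat \<Rightarrow> ('v set \<Rightarrow> 'a) \<Rightarrow> 'v set \<Rightarrow> 'a" where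
  "bm_boundary K \<omega> F n c =
     (\<lambda>\<tau>\<in>simplices K n.
        gfinprod (grp F \<tau>) (\<lambda>\<sigma>. arr F \<sigma> \<tau> (c \<sigma>) [^]\<^bsub>grp F \<tau>\<^esub> incidence \<omega> \<sigma> \<tau>)
          {\<sigma> \<in> simplices K (Suc n). \<tau> \<subseteq> \<sigma>})"

definition borel_moore_homology ::
  "'v set set \<Rightarrow> ('v set \<Rightarrow> 'v list) \<Rightarrow> ('v set, 'a) diagram \<Rightarrow> nat \<Rightarrow> ('v set \<Rightarrow> 'a) set monoid" where
  "borel_moore_homology K \<omega> F n = chain_homology (bm_chains K F) (bm_boundary K \<omega> F) n"


section \<open>Cosheaves\<close>

type_synonym ('x, 'a) precosheaf = "('x set, 'a) diagram"

definition precosheaf :: "'x topology \<Rightarrow> ('x, 'a) precosheaf \<Rightarrow> bool" where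
  "precosheaf X G \<longleftrightarrow> ab_functor {U. openin X U} (\<subseteq>) G"

definition nerve :: "'x set set \<Rightarrow> 'x set set set" where
  "nerve \<U> = {S. S \<subseteq> \<U> \<and> finite S \<and> S \<noteq> {} \<and> \<Inter>S \<noteq> {}}"

definition nerve_diagram :: "('x, 'a) precosheaf \<Rightarrow> ('x set set, 'a) diagram" where
  "nerve_diagram G = \<lparr>grp = (\<lambda>S. grp G (\<Inter>S)), arr = (\<lambda>S T. arr G (\<Inter>S) (\<Inter>T))\<rparr>"

definition cosheaf :: "'x topology \<Rightarrow> ('x, 'a) precosheaf \<Rightarrow> bool" where
  "cosheaf X G \<longleftrightarrow> precosheaf X G \<and>
     (\<forall>U \<U>. openin X U \<and> (\<forall>V\<in>\<U>. openin X V) \<and> \<Union>\<U> = U \<longrightarrow>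
        colim_desc (nerve \<U>) (grp G U) (\<lambda>S. arr G (\<Inter>S) U)
          \<in> iso (colim (nerve \<U>) (\<supseteq>) (nerve_diagram G)) (grp G U))"

definition precosheaf_hom ::
  "'x topology \<Rightarrow> ('x, 'a) precosheaf \<Rightarrow> ('x, 'b) precosheaf \<Rightarrow> ('x set \<Rightarrow> 'a \<Rightarrow> 'b) set" where
  "precosheaf_hom X G G' =
     {\<alpha>. (\<forall>U. openin X U \<longrightarrow> \<alpha> U \<in> hom (grp G U) (grp G' U)) \<and>
         (\<forall>U V. openin X U \<and> openin X V \<and> U \<subseteq> V \<longrightarrow>
            (\<forall>x\<in>carrier (grp G U). \<alpha> V (arr G U V x) = arr G' U V (\<alpha> U x)))}"

text \<open>In an Alexandroff space this is the smallest open neighbourhood of \<open>x\<close>.\<close>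

definition min_nhd :: "'x topology \<Rightarrow> 'x \<Rightarrow> 'x set" where
  "min_nhd X x = \<Inter>{U. openin X U \<and> x \<in> U}"

definition costalk :: "'x topology \<Rightarrow> ('x, 'a) precosheaf \<Rightarrow> 'x \<Rightarrow> 'a monoid" where
  "costalk X G x = grp G (min_nhd X x)"

definition cosheaf_surj ::
  "'x topology \<Rightarrow> ('x, 'a) precosheaf \<Rightarrow> ('x, 'b) precosheaf \<Rightarrow> ('x set \<Rightarrow> 'a \<Rightarrow> 'b) \<Rightarrow> bool" where
  "cosheaf_surj X G G' \<alpha> \<longleftrightarrow>
     (\<forall>x\<in>topspace X. \<alpha> (min_nhd X x) ` carrier (costalk X G x) = carrier (costalk X G' x))"

definition cosheaf_exact ::
  "'x topology \<Rightarrow> ('x, 'a) precosheaf \<Rightarrow> ('x, 'b) precosheaf \<Rightarrow> ('x, 'c) precosheaf \<Rightarrow>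
   ('x set \<Rightarrow> 'a \<Rightarrow> 'b) \<Rightarrow> ('x set \<Rightarrow> 'b \<Rightarrow> 'c) \<Rightarrow> bool" where
  "cosheaf_exact X G G' G'' \<alpha> \<beta> \<longleftrightarrow>
     (\<forall>x\<in>topspace X. \<alpha> (min_nhd X x) ` carrier (costalk X G x)
        = kernel (costalk X G' x) (costalk X G'' x) (\<beta> (min_nhd X x)))"

text \<open>
  HOL cannot quantify over the types in which the test cosheaves take their values, so one
  type must be fixed that is large enough not to weaken projectivity. The type
  \<open>('x \<times> 'a) \<Rightarrow>\<^sub>0 int\<close> of formal integer combinations contains copies of all
  groups of an \<open>'a\<close>-valued cosheaf \<open>P\<close> and all groups of the free cosheaf
  \<open>U \<mapsto> \<Oplus>x\<in>U. \<int>[P\<^sub>x]\<close>, which is projective and surjects onto \<open>P\<close>. Lifting the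
  identity of \<open>P\<close> along that surjection exhibits \<open>P\<close> as a retract of it, so that
  homomorphisms from \<open>P\<close> lift through surjections of cosheaves valued in any types.
\<close>

type_synonym ('x, 'a) free_type = "('x \<times> 'a) \<Rightarrow>\<^sub>0 int"

definition projective_cosheaf :: "'x topology \<Rightarrow> ('x, 'a) precosheaf \<Rightarrow> bool" where
  "projective_cosheaf X P \<longleftrightarrow> cosheaf X P \<and>
     (\<forall>(G :: ('x, ('x, 'a) free_type) precosheaf) (G' :: ('x, ('x, 'a) free_type) precosheaf) \<alpha> \<beta>.
        cosheaf X G \<and> cosheaf X G' \<and>
        \<alpha> \<in> precosheaf_hom X G G' \<and> cosheaf_surj X G G' \<alpha> \<and> \<beta> \<in> precosheaf_hom X P G' \<longrightarrow>
        (\<exists>\<gamma> \<in> precosheaf_hom X P G.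
           \<forall>U. openin X U \<longrightarrow> (\<forall>x\<in>carrier (grp P U). \<alpha> U (\<gamma> U x) = \<beta> U x)))"

definition projective_resolution ::
  "'x topology \<Rightarrow> ('x, 'b) precosheaf \<Rightarrow> (nat \<Rightarrow> ('x, 'a) precosheaf) \<Rightarrow>
   (nat \<Rightarrow> 'x set \<Rightarrow> 'a \<Rightarrow> 'a) \<Rightarrow> ('x set \<Rightarrow> 'a \<Rightarrow> 'b) \<Rightarrow> bool" where
  "projective_resolution X G P d \<epsilon> \<longleftrightarrow>
     cosheaf X G \<and>
     (\<forall>n. projective_cosheaf X (P n)) \<and>
     (\<forall>n. d n \<in> precosheaf_hom X (P (Suc n)) (P n)) \<and>
     \<epsilon> \<in> precosheaf_hom X (P 0) G \<and>
     cosheaf_surj X (P 0) G \<epsilon> \<and>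
     cosheaf_exact X (P 1) (P 0) G (d 0) \<epsilon> \<and>
     (\<forall>n. cosheaf_exact X (P (Suc (Suc n))) (P (Suc n)) (P n) (d (Suc n)) (d n))"

text \<open>The homology of the complex of global cosections of \<open>P\<close>.\<close>

definition cosheaf_homology ::
  "'x topology \<Rightarrow> (nat \<Rightarrow> ('x, 'a) precosheaf) \<Rightarrow> (nat \<Rightarrow> 'x set \<Rightarrow> 'a \<Rightarrow> 'a) \<Rightarrow> nat \<Rightarrow> 'a set monoid" where
  "cosheaf_homology X P d n =
     chain_homology (\<lambda>k. grp (P k) (topspace X)) (\<lambda>k. d k (topspace X)) n"


section \<open>The space of a face poset and the associated cosheaf\<close>

definition face_space :: "'v set set \<Rightarrow> 'v set topology" where
  "face_space K = topology (arbitrary union_of (\<lambda>U. \<exists>\<sigma>\<in>K. U = {\<tau>\<in>K. \<sigma> \<subseteq> \<tau>}))"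

definition associated_cosheaf ::
  "('v set, 'a) diagram \<Rightarrow> ('v set, ('v set \<Rightarrow> 'a) set) precosheaf" where
  "associated_cosheaf F =
     \<lparr>grp = (\<lambda>U. colim U (\<supseteq>) F),
      arr = (\<lambda>U V. colim_desc U (colim V (\<supseteq>) F) (colim_inj V (\<supseteq>) F))\<rparr>"

end

theory Submission
  imports Defs
begin

text \<open>
  Adjoin the empty simplex to \<open>K\<close>, with star \<open>K\<close> itself. A cosheaf \<open>G\<close> on the face space then gives a
  complex \<open>C(G)\<close> of chains with coefficients \<open>\<sigma> \<mapsto> G(star \<sigma>)\<close>, indexed by the number of vertices, which is
  the Borel-Moore complex augmented by the global cosections of \<open>G\<close>. For a free cosheaf it is a sum of
  augmented chain complexes of full simplices, hence contractible; a projective cosheaf is a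
  retract of the free cosheaf on its costalks, so \<open>C(P)\<close> is acyclic for every projective \<open>P\<close>. For a projective
  resolution \<open>P\<close> of the associated cosheaf, the short exact sequences
  \<open>0 \<rightarrow> N\<^bsub>q\<^esub> \<rightarrow> P\<^bsub>q\<^esub> \<rightarrow> N\<^bsub>q-1\<^esub> \<rightarrow> 0\<close> of costalks, where \<open>N\<^bsub>-1\<^esub> = F\<close>, give connecting isomorphisms
  \<open>H\<^bsub>n+1\<^esub>(C(F)) \<cong> H\<^bsub>n\<^esub>(C(N\<^bsub>0\<^esub>)) \<cong> \<dots> \<cong> H\<^bsub>0\<^esub>(C(N\<^bsub>n\<^esub>))\<close>. The first of these groups is the Borel-Moore
  homology of \<open>F\<close>, the last one is the homology of the global cosections of \<open>P\<close>.
\<close>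

section \<open>Direct sums and quotients\<close>

text \<open>Exactness of a resolution is known on costalks only, that is at nonempty simplices. At
  the empty simplex it may fail, and this failure is the homology to be computed. Two facts make the
  argument work nevertheless. Chains of positive degree never involve the empty simplex, so lifting
  chains along \<open>P_q -> N_(q-1)\<close> needs surjectivity on costalks only. And acyclicity of
  \<open>C(P)\<close> in degree 0 says that the global cosections of \<open>P\<close> are generated
  by the costalks at the vertices: this carries \<open>d d = 0\<close> from costalks to global
  cosections, and identifies the boundaries in degree 0 of \<open>C(N_n)\<close> with the image of
  \<open>P_(n+1)(K)\<close>. The free case rests on one observation: a generator
  \<open>(x, g)\<close> occurs in the value at \<open>\<sigma>\<close> exactly when
  \<open>\<sigma>\<close> is a subset of \<open>x\<close>, so its coefficients form the augmented
  complex of the full simplex \<open>x\<close>, which is nonempty. Isomorphisms of homology groups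
  come from spans: both groups are quotients of one group of lifts by the same subgroup, so no
  choice of lifts has to be shown irrelevant.\<close>

lemma group_homI: "group G \<Longrightarrow> group H \<Longrightarrow> h \<in> hom G H \<Longrightarrow> group_hom G H h"
  by (simp add: group_hom_def group_hom_axioms_def)

declare mult_sum_group [simp del] one_sum_group [simp del] inv_sum_group [simp del]

lemma sum_group_mult_at:
  "i \<in> I \<Longrightarrow> (x \<otimes>\<^bsub>sum_group I G\<^esub> y) i = x i \<otimes>\<^bsub>G i\<^esub> y i"
  by (simp add: mult_sum_group)

lemma comm_group_sum_group:
  assumes "\<And>i. i \<in> I \<Longrightarrow> comm_group (G i)"
  shows "comm_group (sum_group I G)"
proof (rule group.group_comm_groupI)
  have grp: "\<And>i. i \<in> I \<Longrightarrow> group (G i)"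
    using assms comm_group.axioms(2) by blast
  then show "group (sum_group I G)" by simp
  fix x y assume "x \<in> carrier (sum_group I G)" "y \<in> carrier (sum_group I G)"
  then show "x \<otimes>\<^bsub>sum_group I G\<^esub> y = y \<otimes>\<^bsub>sum_group I G\<^esub> x"
    using assms by (auto simp: mult_sum_group carrier_sum_group grp PiE_iff comm_group_def
        intro!: restrict_ext comm_monoid.m_comm)
qed

lemma sum_inj_hom:
  assumes "i \<in> I" and grp: "\<And>i. i \<in> I \<Longrightarrow> group (G i)"
  shows "sum_inj I G i \<in> hom (G i) (sum_group I G)"
proof (rule homI)
  fix x assume "x \<in> carrier (G i)"
  moreover have "finite {k \<in> I. (if k = i then x else \<one>\<^bsub>G k\<^esub>) \<noteq> \<one>\<^bsub>G k\<^esub>}"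
    by (rule finite_subset[of _ "{i}"]) auto
  ultimately show "sum_inj I G i x \<in> carrier (sum_group I G)"
    using grp by (auto simp: sum_inj_def carrier_sum_group group.is_monoid cong: conj_cong)
next
  fix x y assume "x \<in> carrier (G i)" "y \<in> carrier (G i)"
  then show "sum_inj I G i (x \<otimes>\<^bsub>G i\<^esub> y)
      = sum_inj I G i x \<otimes>\<^bsub>sum_group I G\<^esub> sum_inj I G i y"
    using grp by (auto simp: mult_sum_group sum_inj_def fun_eq_iff group.is_monoid)
qed

lemma sum_inj_closed:
  assumes "i \<in> I" "\<And>i. i \<in> I \<Longrightarrow> group (G i)" "x \<in> carrier (G i)"
  shows "sum_inj I G i x \<in> carrier (sum_group I G)"
  using sum_inj_hom[of i I G] assms by (blast intro: hom_in_carrier)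

text \<open>Supports are finite, so coordinates can be split off one at a time. The induction runs
  over a finite set \<open>S\<close> that contains the support, because erasing the coordinate
  \<open>i\<close> then lands in the case of the smaller set even if \<open>c i\<close> was already
  trivial.\<close>

lemma sum_group_induct:
  assumes grp: "\<And>i. i \<in> I \<Longrightarrow> group (G i)" and c: "c \<in> carrier (sum_group I G)"
    and one: "P \<one>\<^bsub>sum_group I G\<^esub>"
    and step: "\<And>i x c. i \<in> I \<Longrightarrow> x \<in> carrier (G i) \<Longrightarrow> c \<in> carrier (sum_group I G) \<Longrightarrow> P c
      \<Longrightarrow> P (sum_inj I G i x \<otimes>\<^bsub>sum_group I G\<^esub> c)"
  shows "P c"
proof -
  have "P c" if "finite S" "c \<in> carrier (sum_group I G)" "{i \<in> I. c i \<noteq> \<one>\<^bsub>G i\<^esub>} \<subseteq> S" for S c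
    using that
  proof (induction S arbitrary: c rule: finite_induct)
    case empty
    then have "c = \<one>\<^bsub>sum_group I G\<^esub>"
      by (auto simp: one_sum_group carrier_sum_group grp PiE_iff extensional_def fun_eq_iff)
    with one show ?case by (simp only:)
  next
    case (insert i S)
    show ?case
    proof (cases "i \<in> I")
      case False
      with insert show ?thesis by auto
    next
      case True
      define c' where "c' = (\<lambda>k\<in>I. if k = i then \<one>\<^bsub>G k\<^esub> else c k)"
      have "{k \<in> I. c' k \<noteq> \<one>\<^bsub>G k\<^esub>} \<subseteq> {k \<in> I. c k \<noteq> \<one>\<^bsub>G k\<^esub>}"
        by (auto simp: c'_def split: if_splits)
      moreover have "finite {k \<in> I. c k \<noteq> \<one>\<^bsub>G k\<^esub>}"
        using insert.prems by (simp add: carrier_sum_group grp)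
      ultimately have "finite {k \<in> I. c' k \<noteq> \<one>\<^bsub>G k\<^esub>}"
        using finite_subset by blast
      then have c': "c' \<in> carrier (sum_group I G)"
        using insert.prems(1) by (auto simp: carrier_sum_group grp c'_def PiE_iff group.is_monoid)
      have "{k \<in> I. c' k \<noteq> \<one>\<^bsub>G k\<^esub>} \<subseteq> S"
        using insert.prems(2) by (auto simp: c'_def split: if_splits)
      then have "P c'"
        using insert.IH c' by blast
      moreover have "c i \<in> carrier (G i)"
        using insert.prems(1) True by (auto simp: carrier_sum_group grp)
      ultimately have "P (sum_inj I G i (c i) \<otimes>\<^bsub>sum_group I G\<^esub> c')"
        using step True c' by blast
      moreover have "sum_inj I G i (c i) \<otimes>\<^bsub>sum_group I G\<^esub> c' = c"
        using insert.prems(1)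
        by (auto simp: mult_sum_group carrier_sum_group grp sum_inj_def c'_def fun_eq_iff PiE_iff group.is_monoid
            extensional_def)
      ultimately show ?thesis by simp
    qed
  qed
  from this[of "{i \<in> I. c i \<noteq> \<one>\<^bsub>G i\<^esub>}"] c show ?thesis
    by (simp add: carrier_sum_group grp)
qed

text \<open>Identities between maps of chain groups, such as \<open>bd_bd\<close> and
  \<open>bd_natural\<close>, are reduced by this to chains carried by a single simplex.\<close>

lemma sum_group_hom_ext:
  assumes grp: "\<And>i. i \<in> I \<Longrightarrow> group (G i)" and H: "group H"
    and \<phi>: "\<phi> \<in> hom (sum_group I G) H" and \<psi>: "\<psi> \<in> hom (sum_group I G) H"
    and eq: "\<And>i x. i \<in> I \<Longrightarrow> x \<in> carrier (G i) \<Longrightarrow> \<phi> (sum_inj I G i x) = \<psi> (sum_inj I G i x)"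
    and c: "c \<in> carrier (sum_group I G)"
  shows "\<phi> c = \<psi> c"
proof (rule sum_group_induct[OF grp c])
  interpret S: group "sum_group I G" using grp by simp
  show "\<phi> \<one>\<^bsub>sum_group I G\<^esub> = \<psi> \<one>\<^bsub>sum_group I G\<^esub>"
    using hom_one[OF \<phi> S.is_group H] hom_one[OF \<psi> S.is_group H] by simp
  fix i x c assume *: "i \<in> I" "x \<in> carrier (G i)" "c \<in> carrier (sum_group I G)" "\<phi> c = \<psi> c"
  then have "sum_inj I G i x \<in> carrier (sum_group I G)"
    by (intro sum_inj_closed grp)
  with * show "\<phi> (sum_inj I G i x \<otimes>\<^bsub>sum_group I G\<^esub> c) = \<psi> (sum_inj I G i x \<otimes>\<^bsub>sum_group I G\<^esub> c)"
    by (simp add: hom_mult[OF \<phi>] hom_mult[OF \<psi>] eq)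
qed auto

lemma (in comm_group) gfinprod_single:
  assumes "i \<in> I" "f i \<in> carrier G" "\<And>k. k \<in> I \<Longrightarrow> k \<noteq> i \<Longrightarrow> f k = \<one>"
  shows "gfinprod G f I = f i"
proof -
  have "gfinprod G f I = gfinprod G f {i}"
    by (rule gfinprod_mono_neutral_cong_right) (use assms in \<open>auto simp: Pi_iff\<close>, metis one_closed)
  also have "\<dots> = f i" using assms by (simp add: finprod_singleton)
  finally show ?thesis .
qed

lemma (in comm_group) gfinprod_sum_inj:
  assumes "i \<in> I" and grp: "\<And>i. i \<in> I \<Longrightarrow> group (A i)"
    and hom: "\<And>i. i \<in> I \<Longrightarrow> f i \<in> hom (A i) G" and "x \<in> carrier (A i)"
  shows "gfinprod G (\<lambda>k. f k (sum_inj I A i x k)) I = f i x"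
  using assms hom_one[OF hom grp is_group] hom_in_carrier[OF hom]
  by (subst gfinprod_single[of i]) (auto simp: sum_inj_def)

definition sum_map :: "'i set \<Rightarrow> ('i \<Rightarrow> 'a \<Rightarrow> 'b) \<Rightarrow> ('i \<Rightarrow> 'a) \<Rightarrow> 'i \<Rightarrow> 'b" where
  "sum_map I f c = (\<lambda>i\<in>I. f i (c i))"

lemma sum_map_hom:
  assumes G: "\<And>i. i \<in> I \<Longrightarrow> group (G i)" and H: "\<And>i. i \<in> I \<Longrightarrow> group (H i)"
    and f: "\<And>i. i \<in> I \<Longrightarrow> f i \<in> hom (G i) (H i)"
  shows "sum_map I f \<in> hom (sum_group I G) (sum_group I H)"
proof (rule homI)
  fix c assume c: "c \<in> carrier (sum_group I G)"
  have "finite {i \<in> I. f i (c i) \<noteq> \<one>\<^bsub>H i\<^esub>}"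
    by (rule finite_subset[of _ "{i \<in> I. c i \<noteq> \<one>\<^bsub>G i\<^esub>}"])
      (use c hom_one[OF f G H] in \<open>auto simp: carrier_sum_group G\<close>)
  with c show "sum_map I f c \<in> carrier (sum_group I H)"
    using hom_in_carrier[OF f] by (auto simp: carrier_sum_group G H sum_map_def cong: conj_cong)
next
  fix c c' assume "c \<in> carrier (sum_group I G)" "c' \<in> carrier (sum_group I G)"
  then show "sum_map I f (c \<otimes>\<^bsub>sum_group I G\<^esub> c')
      = sum_map I f c \<otimes>\<^bsub>sum_group I H\<^esub> sum_map I f c'"
    using hom_mult[OF f] by (auto simp: carrier_sum_group G mult_sum_group sum_map_def fun_eq_iff PiE_iff)
qed

lemma sum_map_surj:
  assumes G: "\<And>i. i \<in> I \<Longrightarrow> group (G i)" and H: "\<And>i. i \<in> I \<Longrightarrow> group (H i)"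
    and f: "\<And>i. i \<in> I \<Longrightarrow> f i \<in> hom (G i) (H i)"
    and surj: "\<And>i. i \<in> I \<Longrightarrow> f i ` carrier (G i) = carrier (H i)"
    and c: "c \<in> carrier (sum_group I H)"
  obtains b where "b \<in> carrier (sum_group I G)" "sum_map I f b = c"
proof -
  \<comment> \<open>The unit must be lifted to the unit: otherwise the family of preimages could
    have infinite support.\<close>
  have "\<exists>x. x \<in> carrier (G i) \<and> f i x = c i \<and> (c i = \<one>\<^bsub>H i\<^esub> \<longrightarrow> x = \<one>\<^bsub>G i\<^esub>)" if "i \<in> I" for i
  proof (cases "c i = \<one>\<^bsub>H i\<^esub>")
    case True
    then show ?thesis
      using hom_one[OF f G H] that G[OF that] by (metis group.is_monoid monoid.one_closed)
  next
    case False
    have "c i \<in> f i ` carrier (G i)"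
      using surj[OF that] c that by (auto simp: carrier_sum_group H)
    then show ?thesis using False by auto
  qed
  then obtain b where b: "\<And>i. i \<in> I \<Longrightarrow> b i \<in> carrier (G i)" "\<And>i. i \<in> I \<Longrightarrow> f i (b i) = c i"
    "\<And>i. i \<in> I \<Longrightarrow> c i = \<one>\<^bsub>H i\<^esub> \<Longrightarrow> b i = \<one>\<^bsub>G i\<^esub>"
    by metis
  have "finite {i \<in> I. b i \<noteq> \<one>\<^bsub>G i\<^esub>}"
    by (rule finite_subset[of _ "{i \<in> I. c i \<noteq> \<one>\<^bsub>H i\<^esub>}"])
      (use b c in \<open>auto simp: carrier_sum_group H\<close>)
  then have "restrict b I \<in> carrier (sum_group I G)"
    using b by (auto simp: carrier_sum_group G cong: conj_cong)
  moreover have "sum_map I f (restrict b I) = c"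
    using b c by (auto simp: carrier_sum_group H sum_map_def fun_eq_iff PiE_iff extensional_def)
  ultimately show thesis by (rule that)
qed

section \<open>Homomorphisms of direct sums given by matrices\<close>

definition sum_matrix ::
  "'i set \<Rightarrow> 'j set \<Rightarrow> ('j \<Rightarrow> 'b monoid) \<Rightarrow> ('i \<Rightarrow> 'j \<Rightarrow> 'a \<Rightarrow> 'b) \<Rightarrow> ('i \<Rightarrow> 'a) \<Rightarrow> 'j \<Rightarrow> 'b" where
  "sum_matrix I J H f c = (\<lambda>j\<in>J. gfinprod (H j) (\<lambda>i. f i j (c i)) I)"

text \<open>Finiteness is demanded for each source index only. A target index may receive from
  infinitely many sources, as a simplex may have infinitely many cofaces; the finite support of the
  argument takes care of that direction.\<close>

lemma sum_matrix_hom: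
  assumes G: "\<And>i. i \<in> I \<Longrightarrow> group (G i)" and H: "\<And>j. j \<in> J \<Longrightarrow> comm_group (H j)"
    and f: "\<And>i j. i \<in> I \<Longrightarrow> j \<in> J \<Longrightarrow> f i j \<in> hom (G i) (H j)"
    and fin: "\<And>i. i \<in> I \<Longrightarrow> finite {j \<in> J. \<exists>x\<in>carrier (G i). f i j x \<noteq> \<one>\<^bsub>H j\<^esub>}"
  shows "sum_matrix I J H f \<in> hom (sum_group I G) (sum_group J H)"
proof -
  have Hg: "\<And>j. j \<in> J \<Longrightarrow> group (H j)" using H comm_group.axioms(2) by blast
  have hom: "(\<lambda>c. gfinprod (H j) (\<lambda>i. f i j (c i)) I) \<in> hom (sum_group I G) (H j)"
    if "j \<in> J" for j
    using comm_group.hom_group_sum[OF H[OF that], of I "\<lambda>i. f i j" G] f G that by blast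
  show ?thesis
  proof (rule homI)
    fix c assume c: "c \<in> carrier (sum_group I G)"
    let ?S = "{i \<in> I. c i \<noteq> \<one>\<^bsub>G i\<^esub>}"
    have cG: "\<And>i. i \<in> I \<Longrightarrow> c i \<in> carrier (G i)" and finS: "finite ?S"
      using c by (auto simp: carrier_sum_group G)
    \<comment> \<open>A nontrivial component at \<open>j\<close> needs some index in the support of
      \<open>c\<close> whose entry at \<open>j\<close> is nontrivial.\<close>
    have "{j \<in> J. gfinprod (H j) (\<lambda>i. f i j (c i)) I \<noteq> \<one>\<^bsub>H j\<^esub>}
        \<subseteq> (\<Union>i\<in>?S. {j \<in> J. \<exists>x\<in>carrier (G i). f i j x \<noteq> \<one>\<^bsub>H j\<^esub>})"
    proof (clarsimp, rule ccontr)
      fix j assume j: "j \<in> J" "gfinprod (H j) (\<lambda>i. f i j (c i)) I \<noteq> \<one>\<^bsub>H j\<^esub>"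
        and no: "\<not> (\<exists>i. i \<in> I \<and> c i \<noteq> \<one>\<^bsub>G i\<^esub> \<and> (\<exists>x\<in>carrier (G i). f i j x \<noteq> \<one>\<^bsub>H j\<^esub>))"
      have "f i j (c i) = \<one>\<^bsub>H j\<^esub>" if "i \<in> I" for i
        using no that cG hom_one[OF f G Hg] j by metis
      then have "{i \<in> I. f i j (c i) \<noteq> \<one>\<^bsub>H j\<^esub>} = {}" by auto
      then have "gfinprod (H j) (\<lambda>i. f i j (c i)) I = \<one>\<^bsub>H j\<^esub>"
        using H[OF j(1)]
        by (simp only: gfinprod_def finite.emptyI if_True comm_monoid.finprod_empty comm_group_def)
      with j show False by simp
    qed
    moreover have "finite (\<Union>i\<in>?S. {j \<in> J. \<exists>x\<in>carrier (G i). f i j x \<noteq> \<one>\<^bsub>H j\<^esub>})"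
      using finS fin by blast
    ultimately have "finite {j \<in> J. gfinprod (H j) (\<lambda>i. f i j (c i)) I \<noteq> \<one>\<^bsub>H j\<^esub>}"
      using finite_subset by blast
    then show "sum_matrix I J H f c \<in> carrier (sum_group J H)"
      using hom_in_carrier[OF hom c] by (auto simp: carrier_sum_group Hg sum_matrix_def cong: conj_cong)
  next
    fix c c' assume "c \<in> carrier (sum_group I G)" "c' \<in> carrier (sum_group I G)"
    then show "sum_matrix I J H f (c \<otimes>\<^bsub>sum_group I G\<^esub> c')
        = sum_matrix I J H f c \<otimes>\<^bsub>sum_group J H\<^esub> sum_matrix I J H f c'"
      using hom_mult[OF hom] unfolding sum_matrix_def by (auto simp: mult_sum_group fun_eq_iff)
  qed
qed

lemma sum_matrix_inj:
  assumes "i \<in> I" and G: "\<And>i. i \<in> I \<Longrightarrow> group (G i)" and H: "\<And>j. j \<in> J \<Longrightarrow> comm_group (H j)"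
    and f: "\<And>i j. i \<in> I \<Longrightarrow> j \<in> J \<Longrightarrow> f i j \<in> hom (G i) (H j)" and "x \<in> carrier (G i)"
  shows "sum_matrix I J H f (sum_inj I G i x) = (\<lambda>j\<in>J. f i j x)"
  unfolding sum_matrix_def using assms
  by (intro restrict_ext comm_group.gfinprod_sum_inj[OF H]) auto

section \<open>Quotients of a common group\<close>

lemma FactGroup_iso_of_surj:
  assumes Z: "comm_group Z" and A: "comm_group A" and f: "f \<in> hom Z A"
    and surj: "f ` carrier Z = carrier A" and N: "subgroup N A"
  shows "Z Mod {z \<in> carrier Z. f z \<in> N} \<cong> A Mod N"
proof -
  interpret Z: comm_group Z by fact
  interpret A: comm_group A by fact
  have "N \<lhd> A" using N by (simp add: A.normal_iff_subgroup)
  interpret N: normal N A by fact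
  interpret Q: group "A Mod N" by (rule N.factorgroup_is_group)
  let ?q = "\<lambda>z. N #>\<^bsub>A\<^esub> f z"
  have q: "?q \<in> hom Z (A Mod N)"
    using hom_compose[OF f N.r_coset_hom_Mod] by (simp add: o_def)
  interpret q: group_hom Z "A Mod N" ?q
    by (rule group_homI) (use q Z.is_group Q.is_group in auto)
  have "?q ` carrier Z = (\<lambda>a. N #>\<^bsub>A\<^esub> a) ` (f ` carrier Z)" by auto
  then have "?q ` carrier Z = carrier (A Mod N)"
    by (simp add: surj carrier_FactGroup)
  from q.FactGroup_iso[OF this] have "Z Mod (kernel Z (A Mod N) ?q) \<cong> A Mod N" .
  moreover have "kernel Z (A Mod N) ?q = {z \<in> carrier Z. f z \<in> N}"
    unfolding kernel_def
    using hom_in_carrier[OF f] A.coset_join1[OF _ _ N] A.coset_join2[OF _ N] N.subset by auto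
  ultimately show ?thesis by simp
qed

text \<open>Both quotients are \<open>Z\<close> modulo one and the same subgroup. This replaces a
  connecting homomorphism: \<open>Z\<close> is the group of all possible lifts, so nothing has to be
  chosen and well-definedness turns into the equivalence \<open>eq\<close>.\<close>

lemma FactGroup_iso_of_span:
  assumes Z: "comm_group Z" and A: "comm_group A" and B: "comm_group B"
    and f: "f \<in> hom Z A" "f ` carrier Z = carrier A" and N: "subgroup N A"
    and g: "g \<in> hom Z B" "g ` carrier Z = carrier B" and L: "subgroup L B"
    and eq: "\<And>z. z \<in> carrier Z \<Longrightarrow> f z \<in> N \<longleftrightarrow> g z \<in> L"
  shows "A Mod N \<cong> B Mod L"
proof -
  let ?M = "{z \<in> carrier Z. f z \<in> N}"
  have 1: "Z Mod ?M \<cong> A Mod N" by (rule FactGroup_iso_of_surj[OF Z A f N])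
  have "{z \<in> carrier Z. g z \<in> L} = ?M" using eq by auto
  with FactGroup_iso_of_surj[OF Z B g L] have 2: "Z Mod ?M \<cong> B Mod L" by simp
  interpret fh: group_hom Z A f
    using Z A f by (intro group_homI) (auto simp: comm_group_def)
  have "subgroup ?M Z"
    using subgroup.m_closed[OF N] subgroup.one_closed[OF N] subgroup.m_inv_closed[OF N]
    by (intro fh.G.subgroupI) auto
  then have "group (Z Mod ?M)"
    using comm_group.abelian_FactGroup[OF Z] comm_group.axioms(2) by blast
  then show ?thesis using 1 2 group.iso_sym iso_trans by blast
qed

section \<open>Colimits\<close>

locale ab_diagram =
  fixes I :: "'i set" and R :: "'i \<Rightarrow> 'i \<Rightarrow> bool" and D :: "('i, 'a) diagram"
  assumes is_functor: "ab_functor I R D"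
begin

lemma comm_group_grp: "i \<in> I \<Longrightarrow> comm_group (grp D i)"
  using is_functor by (simp add: ab_functor_def)

lemma group_grp: "i \<in> I \<Longrightarrow> group (grp D i)"
  using comm_group_grp comm_group.axioms(2) by blast

lemma arr_hom: "i \<in> I \<Longrightarrow> j \<in> I \<Longrightarrow> R i j \<Longrightarrow> arr D i j \<in> hom (grp D i) (grp D j)"
  using is_functor by (simp add: ab_functor_def)

lemma arr_closed:
  "i \<in> I \<Longrightarrow> j \<in> I \<Longrightarrow> R i j \<Longrightarrow> x \<in> carrier (grp D i) \<Longrightarrow> arr D i j x \<in> carrier (grp D j)"
  using arr_hom hom_in_carrier by fast

lemma arr_id: "i \<in> I \<Longrightarrow> x \<in> carrier (grp D i) \<Longrightarrow> arr D i i x = x"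
  using is_functor by (simp add: ab_functor_def)

lemma arr_comp:
  "i \<in> I \<Longrightarrow> j \<in> I \<Longrightarrow> k \<in> I \<Longrightarrow> R i j \<Longrightarrow> R j k \<Longrightarrow> x \<in> carrier (grp D i) \<Longrightarrow>
    arr D j k (arr D i j x) = arr D i k x"
  using is_functor by (simp add: ab_functor_def)

sublocale S: comm_group "sum_group I (grp D)"
  by (rule comm_group_sum_group) (rule comm_group_grp)

lemma sinj_closed:
  "i \<in> I \<Longrightarrow> x \<in> carrier (grp D i) \<Longrightarrow>
    sum_inj I (grp D) i x \<in> carrier (sum_group I (grp D))"
  by (rule sum_inj_closed) (auto intro: group_grp)

lemma subgroup_colim_relations: "subgroup (colim_relations I R D) (sum_group I (grp D))"
  unfolding colim_relations_def
  by (rule S.generate_is_subgroup) (auto intro!: S.m_closed S.inv_closed sinj_closed arr_closed)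

sublocale rel: normal "colim_relations I R D" "sum_group I (grp D)"
  using subgroup_colim_relations by (simp add: S.normal_iff_subgroup)

lemma comm_group_colim: "comm_group (colim I R D)"
  unfolding colim_def by (rule S.abelian_FactGroup[OF subgroup_colim_relations])

sublocale colim: comm_group "colim I R D"
  by (rule comm_group_colim)

lemma colim_inj_hom: "i \<in> I \<Longrightarrow> colim_inj I R D i \<in> hom (grp D i) (colim I R D)"
  using hom_compose[OF sum_inj_hom[of i I "grp D", OF _ group_grp] rel.r_coset_hom_Mod]
  by (simp add: o_def colim_def colim_inj_def[abs_def])

lemma colim_inj_closed:
  "i \<in> I \<Longrightarrow> x \<in> carrier (grp D i) \<Longrightarrow> colim_inj I R D i x \<in> carrier (colim I R D)"
  using colim_inj_hom hom_in_carrier by fast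

lemma colim_inj_arr:
  assumes "i \<in> I" "j \<in> I" "R i j" "x \<in> carrier (grp D i)"
  shows "colim_inj I R D j (arr D i j x) = colim_inj I R D i x"
proof -
  have "sum_inj I (grp D) j (arr D i j x)
      \<otimes>\<^bsub>sum_group I (grp D)\<^esub> inv\<^bsub>sum_group I (grp D)\<^esub> sum_inj I (grp D) i x \<in> colim_relations I R D"
    unfolding colim_relations_def by (rule generate.incl) (use assms in blast)
  then have "sum_inj I (grp D) j (arr D i j x)
      \<in> colim_relations I R D #>\<^bsub>sum_group I (grp D)\<^esub> sum_inj I (grp D) i x"
    by (rule subgroup.rcos_module_rev[OF subgroup_colim_relations S.is_group, rotated 2])
      (use assms in \<open>auto intro!: sinj_closed arr_closed\<close>)
  then show ?thesis
    unfolding colim_inj_def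
    using S.repr_independence[OF _ sinj_closed subgroup_colim_relations] assms by metis
qed

lemma colim_hom_ext:
  assumes H: "group H" and \<phi>: "\<phi> \<in> hom (colim I R D) H" and \<psi>: "\<psi> \<in> hom (colim I R D) H"
    and eq: "\<And>i x. i \<in> I \<Longrightarrow> x \<in> carrier (grp D i) \<Longrightarrow>
      \<phi> (colim_inj I R D i x) = \<psi> (colim_inj I R D i x)"
    and a: "a \<in> carrier (colim I R D)"
  shows "\<phi> a = \<psi> a"
proof -
  let ?q = "\<lambda>c. colim_relations I R D #>\<^bsub>sum_group I (grp D)\<^esub> c"
  obtain c where c: "c \<in> carrier (sum_group I (grp D))" "a = ?q c"
    using a by (auto simp: colim_def carrier_FactGroup)
  have q: "?q \<in> hom (sum_group I (grp D)) (colim I R D)"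
    unfolding colim_def by (rule rel.r_coset_hom_Mod)
  have "(\<phi> \<circ> ?q) c = (\<psi> \<circ> ?q) c"
  proof (rule sum_group_hom_ext[OF group_grp H hom_compose[OF q \<phi>] hom_compose[OF q \<psi>] _ c(1)])
    fix i x assume "i \<in> I" "x \<in> carrier (grp D i)"
    then show "(\<phi> \<circ> ?q) (sum_inj I (grp D) i x) = (\<psi> \<circ> ?q) (sum_inj I (grp D) i x)"
      using eq by (simp add: colim_inj_def)
  qed
  with c show ?thesis by simp
qed

context
  fixes H :: "'b monoid" and f :: "'i \<Rightarrow> 'a \<Rightarrow> 'b"
  assumes H: "comm_group H"
    and f_hom: "\<And>i. i \<in> I \<Longrightarrow> f i \<in> hom (grp D i) H"
    and f_arr: "\<And>i j x. i \<in> I \<Longrightarrow> j \<in> I \<Longrightarrow> R i j \<Longrightarrow> x \<in> carrier (grp D i) \<Longrightarrow> f j (arr D i j x) = f i x"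
begin

private definition "\<phi> c = gfinprod H (\<lambda>i. f i (c i)) I"

private lemma \<phi>_hom: "\<phi> \<in> hom (sum_group I (grp D)) H"
  unfolding \<phi>_def[abs_def] by (rule comm_group.hom_group_sum[OF H f_hom group_grp])

private lemma \<phi>_inj: "i \<in> I \<Longrightarrow> x \<in> carrier (grp D i) \<Longrightarrow> \<phi> (sum_inj I (grp D) i x) = f i x"
  unfolding \<phi>_def by (rule comm_group.gfinprod_sum_inj[OF H _ group_grp f_hom])

text \<open>The cocone condition \<open>f_arr\<close> sends every generating relation to the unit,
  and a kernel, being a subgroup, contains all that its elements generate.\<close>

private lemma \<phi>_relations: "colim_relations I R D \<subseteq> kernel (sum_group I (grp D)) H \<phi>"
proof -
  interpret \<phi>: group_hom "sum_group I (grp D)" H \<phi>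
    using H \<phi>_hom S.is_group by (intro group_homI) (auto simp: comm_group_def)
  show ?thesis
    unfolding colim_relations_def
  proof (rule S.generate_subgroup_incl[OF _ \<phi>.subgroup_kernel], clarify)
    fix i j x assume *: "i \<in> I" "j \<in> I" "R i j" "x \<in> carrier (grp D i)"
    then show "sum_inj I (grp D) j (arr D i j x)
        \<otimes>\<^bsub>sum_group I (grp D)\<^esub> inv\<^bsub>sum_group I (grp D)\<^esub> sum_inj I (grp D) i x
        \<in> kernel (sum_group I (grp D)) H \<phi>"
      using f_hom[of i, THEN hom_in_carrier]
      by (simp add: kernel_def sinj_closed arr_closed \<phi>_inj f_arr)
  qed
qed

text \<open>\<open>colim_desc\<close> picks the only element of the image of a coset. There is just
  one, because representatives differ by relations, on which \<open>\<phi>\<close> is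
  trivial.\<close>

private lemma colim_desc_coset:
  assumes "c \<in> carrier (sum_group I (grp D))"
  shows "colim_desc I H f (colim_relations I R D #>\<^bsub>sum_group I (grp D)\<^esub> c) = \<phi> c"
proof -
  interpret \<phi>: group_hom "sum_group I (grp D)" H \<phi>
    using H \<phi>_hom S.is_group by (intro group_homI) (auto simp: comm_group_def)
  have "\<phi> ` (colim_relations I R D #>\<^bsub>sum_group I (grp D)\<^esub> c) = {\<phi> c}"
  proof (intro equalityI subsetI)
    fix y assume "y \<in> \<phi> ` (colim_relations I R D #>\<^bsub>sum_group I (grp D)\<^esub> c)"
    then obtain r where r: "r \<in> colim_relations I R D" "y = \<phi> (r \<otimes>\<^bsub>sum_group I (grp D)\<^esub> c)"
      by (auto simp: r_coset_def)
    then have "r \<in> carrier (sum_group I (grp D))" "\<phi> r = \<one>\<^bsub>H\<^esub>"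
      using \<phi>_relations by (auto simp: kernel_def)
    then show "y \<in> {\<phi> c}" using r assms by simp
  next
    fix y assume "y \<in> {\<phi> c}"
    then show "y \<in> \<phi> ` (colim_relations I R D #>\<^bsub>sum_group I (grp D)\<^esub> c)"
      using S.rcos_self[OF assms subgroup_colim_relations] by auto
  qed
  then show ?thesis by (simp add: colim_desc_def \<phi>_def[abs_def])
qed

lemma colim_desc_hom: "colim_desc I H f \<in> hom (colim I R D) H"
proof -
  interpret \<phi>: group_hom "sum_group I (grp D)" H \<phi>
    using H \<phi>_hom S.is_group by (intro group_homI) (auto simp: comm_group_def)
  obtain g where g: "g \<in> hom (colim I R D) H"
    "\<And>c. c \<in> carrier (sum_group I (grp D)) \<Longrightarrow>
      g (colim_relations I R D #>\<^bsub>sum_group I (grp D)\<^esub> c) = \<phi> c"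
    using \<phi>.FactGroup_universal_kernel[OF rel.normal_axioms \<phi>_relations]
    unfolding colim_def by metis
  have "colim_desc I H f a = g a" if "a \<in> carrier (colim I R D)" for a
    using that by (auto simp: g colim_def carrier_FactGroup colim_desc_coset)
  then show ?thesis
    using g(1) colim.m_closed by (simp add: hom_def Pi_iff)
qed

lemma colim_desc_inj:
  "i \<in> I \<Longrightarrow> x \<in> carrier (grp D i) \<Longrightarrow> colim_desc I H f (colim_inj I R D i x) = f i x"
  by (simp add: colim_inj_def colim_desc_coset sinj_closed \<phi>_inj)

end

end

section \<open>Recognising cosheaves\<close>

lemma hom_eq_on_generate:
  assumes G: "group G" and H: "group H" and S: "S \<subseteq> carrier G"
    and \<phi>: "\<phi> \<in> hom G H" and \<psi>: "\<psi> \<in> hom G H" and eq: "\<And>x. x \<in> S \<Longrightarrow> \<phi> x = \<psi> x"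
    and a: "a \<in> generate G S"
  shows "\<phi> a = \<psi> a"
proof -
  interpret \<phi>: group_hom G H \<phi> using G H \<phi> by (rule group_homI)
  interpret \<psi>: group_hom G H \<psi> using G H \<psi> by (rule group_homI)
  have "a \<in> carrier G \<and> \<phi> a = \<psi> a"
    using a by (induction rule: generate.induct) (use S eq in auto)
  then show ?thesis ..
qed

lemma hom_eq_on_frag:
  assumes H: "group H"
    and \<phi>: "\<phi> \<in> hom (free_Abelian_group S) H" and \<psi>: "\<psi> \<in> hom (free_Abelian_group S) H"
    and eq: "\<And>s. s \<in> S \<Longrightarrow> \<phi> (frag_of s) = \<psi> (frag_of s)"
    and a: "a \<in> carrier (free_Abelian_group S)"
  shows "\<phi> a = \<psi> a"
proof -
  interpret \<phi>: group_hom "free_Abelian_group S" H \<phi> by (rule group_homI) (use H \<phi> in auto)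
  interpret \<psi>: group_hom "free_Abelian_group S" H \<psi> by (rule group_homI) (use H \<psi> in auto)
  show ?thesis
  proof (rule free_Abelian_group_induct[where P = "\<lambda>a. \<phi> a = \<psi> a"])
    show "Poly_Mapping.keys a \<subseteq> S" using a by simp
    show "\<phi> 0 = \<psi> 0" using \<phi>.hom_one \<psi>.hom_one by simp
  next
    fix x y assume *: "Poly_Mapping.keys x \<subseteq> S" "Poly_Mapping.keys y \<subseteq> S" "\<phi> x = \<psi> x" "\<phi> y = \<psi> y"
    have "x - y = x \<otimes>\<^bsub>free_Abelian_group S\<^esub> inv\<^bsub>free_Abelian_group S\<^esub> y"
      using * by simp
    then show "\<phi> (x - y) = \<psi> (x - y)"
      using * \<phi>.hom_mult \<phi>.hom_inv \<psi>.hom_mult \<psi>.hom_inv \<phi>.G.inv_closed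
      by (metis carrier_free_Abelian_group_iff)
  qed (use eq in auto)
qed

locale precosheaf_on =
  fixes X :: "'x topology" and G :: "('x, 'a) precosheaf"
  assumes is_precosheaf: "precosheaf X G"
begin

sublocale ab_diagram "{U. openin X U}" "(\<subseteq>)" G
  using is_precosheaf by unfold_locales (simp add: precosheaf_def)

lemma openin_Inter_nerve: "\<forall>V\<in>\<U>. openin X V \<Longrightarrow> S \<in> nerve \<U> \<Longrightarrow> openin X (\<Inter>S)"
  unfolding nerve_def by (blast intro: openin_Inter)

lemma nerve_diagram_functor:
  assumes "\<forall>V\<in>\<U>. openin X V"
  shows "ab_functor (nerve \<U>) (\<supseteq>) (nerve_diagram G)"
  unfolding ab_functor_def nerve_diagram_def
  using openin_Inter_nerve[OF assms]
  by (auto intro!: comm_group_grp arr_hom arr_id arr_comp Inter_anti_mono)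

lemma nerve_cocone:
  assumes "\<forall>V\<in>\<U>. openin X V" and "\<Union>\<U> = U"
  shows "S \<in> nerve \<U> \<Longrightarrow> arr G (\<Inter>S) U \<in> hom (grp (nerve_diagram G) S) (grp G U)"
    and "S \<in> nerve \<U> \<Longrightarrow> T \<in> nerve \<U> \<Longrightarrow> S \<supseteq> T \<Longrightarrow> x \<in> carrier (grp (nerve_diagram G) S) \<Longrightarrow>
      arr G (\<Inter>T) U (arr (nerve_diagram G) S T x) = arr G (\<Inter>S) U x"
proof -
  have sub: "\<Inter>S \<subseteq> U" "openin X (\<Inter>S)" if "S \<in> nerve \<U>" for S
    using that assms openin_Inter_nerve[OF assms(1)] by (auto simp: nerve_def)
  have "openin X U" using assms by blast
  then show "S \<in> nerve \<U> \<Longrightarrow> arr G (\<Inter>S) U \<in> hom (grp (nerve_diagram G) S) (grp G U)"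
    using sub by (auto simp: nerve_diagram_def intro!: arr_hom)
  show "S \<in> nerve \<U> \<Longrightarrow> T \<in> nerve \<U> \<Longrightarrow> S \<supseteq> T \<Longrightarrow> x \<in> carrier (grp (nerve_diagram G) S) \<Longrightarrow>
      arr G (\<Inter>T) U (arr (nerve_diagram G) S T x) = arr G (\<Inter>S) U x"
    using sub \<open>openin X U\<close> by (auto simp: nerve_diagram_def intro!: arr_comp Inter_anti_mono)
qed

lemma nerve_desc:
  assumes "openin X U" "\<forall>V\<in>\<U>. openin X V" and "\<Union>\<U> = U"
  shows "colim_desc (nerve \<U>) (grp G U) (\<lambda>S. arr G (\<Inter>S) U)
      \<in> hom (colim (nerve \<U>) (\<supseteq>) (nerve_diagram G)) (grp G U)" (is "?A")
    and "S \<in> nerve \<U> \<Longrightarrow> x \<in> carrier (grp G (\<Inter>S)) \<Longrightarrow>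
      colim_desc (nerve \<U>) (grp G U) (\<lambda>S. arr G (\<Inter>S) U)
        (colim_inj (nerve \<U>) (\<supseteq>) (nerve_diagram G) S x) = arr G (\<Inter>S) U x"
proof -
  interpret N: ab_diagram "nerve \<U>" "(\<supseteq>)" "nerve_diagram G"
    by unfold_locales (rule nerve_diagram_functor[OF assms(2)])
  have "comm_group (grp G U)" using assms(1) comm_group_grp by simp
  note * = this nerve_cocone[OF assms(2,3)]
  show ?A by (rule N.colim_desc_hom[OF *])
  show "S \<in> nerve \<U> \<Longrightarrow> x \<in> carrier (grp G (\<Inter>S)) \<Longrightarrow>
      colim_desc (nerve \<U>) (grp G U) (\<lambda>S. arr G (\<Inter>S) U)
        (colim_inj (nerve \<U>) (\<supseteq>) (nerve_diagram G) S x) = arr G (\<Inter>S) U x"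
    by (rule N.colim_desc_inj[OF *]) (auto simp: nerve_diagram_def)
qed

text \<open>A two-sided inverse of the comparison map from the colimit yields bijectivity. One
  composite lives on the colimit and is the identity as soon as it is so on the pieces
  \<open>G(\<Inter>S)\<close>; this is why \<open>\<psi>\<close> is prescribed only on their images.
  The other composite is asked for directly.\<close>

lemma cosheafI_inverse:
  assumes inv: "\<And>U \<U>. openin X U \<Longrightarrow> \<forall>V\<in>\<U>. openin X V \<Longrightarrow> \<Union>\<U> = U \<Longrightarrow>
    \<exists>\<psi>\<in>hom (grp G U) (colim (nerve \<U>) (\<supseteq>) (nerve_diagram G)).
      (\<forall>S\<in>nerve \<U>. \<forall>x\<in>carrier (grp G (\<Inter>S)).
        \<psi> (arr G (\<Inter>S) U x) = colim_inj (nerve \<U>) (\<supseteq>) (nerve_diagram G) S x) \<and>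
      (\<forall>y\<in>carrier (grp G U). colim_desc (nerve \<U>) (grp G U) (\<lambda>S. arr G (\<Inter>S) U) (\<psi> y) = y)"
  shows "cosheaf X G"
  unfolding cosheaf_def
proof (intro conjI allI impI is_precosheaf)
  fix U \<U> assume "openin X U \<and> (\<forall>V\<in>\<U>. openin X V) \<and> \<Union>\<U> = U"
  then have U: "openin X U" "\<forall>V\<in>\<U>. openin X V" "\<Union>\<U> = U" by auto
  let ?\<Phi> = "colim_desc (nerve \<U>) (grp G U) (\<lambda>S. arr G (\<Inter>S) U)"
  let ?C = "colim (nerve \<U>) (\<supseteq>) (nerve_diagram G)"
  interpret N: ab_diagram "nerve \<U>" "(\<supseteq>)" "nerve_diagram G"
    by unfold_locales (rule nerve_diagram_functor[OF U(2)])
  note \<Phi> = nerve_desc[OF U]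
  obtain \<psi> where \<psi>: "\<psi> \<in> hom (grp G U) ?C"
    "\<And>S x. S \<in> nerve \<U> \<Longrightarrow> x \<in> carrier (grp G (\<Inter>S)) \<Longrightarrow>
      \<psi> (arr G (\<Inter>S) U x) = colim_inj (nerve \<U>) (\<supseteq>) (nerve_diagram G) S x"
    "\<And>y. y \<in> carrier (grp G U) \<Longrightarrow> ?\<Phi> (\<psi> y) = y"
    using inv[OF U] by blast
  have "(\<psi> \<circ> ?\<Phi>) a = id a" if "a \<in> carrier ?C" for a
  proof (rule N.colim_hom_ext[OF N.colim.is_group hom_compose[OF \<Phi>(1) \<psi>(1)] _ _ that])
    show "id \<in> hom ?C ?C" by (simp add: hom_def)
    fix S x assume "S \<in> nerve \<U>" "x \<in> carrier (grp (nerve_diagram G) S)"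
    then show "(\<psi> \<circ> ?\<Phi>) (colim_inj (nerve \<U>) (\<supseteq>) (nerve_diagram G) S x)
        = id (colim_inj (nerve \<U>) (\<supseteq>) (nerve_diagram G) S x)"
      using \<Phi>(2) \<psi>(2) by (simp add: nerve_diagram_def)
  qed
  then have "bij_betw ?\<Phi> (carrier ?C) (carrier (grp G U))"
    using \<psi>(1,3) \<Phi>(1) by (intro bij_betwI[where g = \<psi>]) (auto simp: hom_def)
  with \<Phi>(1) show "?\<Phi> \<in> iso ?C (grp G U)" by (simp add: iso_def)
qed

end

lemma precosheaf_homD:
  assumes "\<alpha> \<in> precosheaf_hom X G G'"
  shows "openin X U \<Longrightarrow> \<alpha> U \<in> hom (grp G U) (grp G' U)"
    and "openin X U \<Longrightarrow> openin X V \<Longrightarrow> U \<subseteq> V \<Longrightarrow> x \<in> carrier (grp G U) \<Longrightarrow>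
      \<alpha> V (arr G U V x) = arr G' U V (\<alpha> U x)"
    and "openin X U \<Longrightarrow> x \<in> carrier (grp G U) \<Longrightarrow> \<alpha> U x \<in> carrier (grp G' U)"
  using assms by (auto simp: precosheaf_hom_def hom_def)

text \<open>\<open>\<theta>\<close> and \<open>\<theta>'\<close> exhibit \<open>G'\<close> as a
  retract of \<open>G\<close>, so the comparison map of \<open>G'\<close> is a retract of that of
  \<open>G\<close>, and a retract of an isomorphism is an isomorphism. The inverse goes to
  \<open>G\<close> along \<open>\<theta>'\<close>, back through the inverse \<open>k\<close> of the
  comparison map there, and returns along the map \<open>e\<close> that \<open>\<theta>\<close>
  induces on colimits.\<close>

lemma cosheaf_transport:
  assumes G: "cosheaf X G" and G': "precosheaf X G'"
    and \<theta>: "\<theta> \<in> precosheaf_hom X G G'" and \<theta>': "\<theta>' \<in> precosheaf_hom X G' G"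
    and \<theta>\<theta>': "\<And>U y. openin X U \<Longrightarrow> y \<in> carrier (grp G' U) \<Longrightarrow> \<theta> U (\<theta>' U y) = y"
  shows "cosheaf X G'"
proof -
  interpret G: precosheaf_on X G using G by unfold_locales (simp add: cosheaf_def)
  interpret G': precosheaf_on X G' using G' by unfold_locales
  show ?thesis
  proof (rule G'.cosheafI_inverse)
    fix U \<U> assume U: "openin X U" "\<forall>V\<in>\<U>. openin X V" "\<Union>\<U> = U"
    let ?\<Phi> = "colim_desc (nerve \<U>) (grp G U) (\<lambda>S. arr G (\<Inter>S) U)"
    let ?\<Phi>' = "colim_desc (nerve \<U>) (grp G' U) (\<lambda>S. arr G' (\<Inter>S) U)"
    let ?C = "colim (nerve \<U>) (\<supseteq>) (nerve_diagram G)"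
    let ?C' = "colim (nerve \<U>) (\<supseteq>) (nerve_diagram G')"
    let ?i = "colim_inj (nerve \<U>) (\<supseteq>) (nerve_diagram G)"
    let ?i' = "colim_inj (nerve \<U>) (\<supseteq>) (nerve_diagram G')"
    interpret N: ab_diagram "nerve \<U>" "(\<supseteq>)" "nerve_diagram G"
      by unfold_locales (rule G.nerve_diagram_functor[OF U(2)])
    interpret N': ab_diagram "nerve \<U>" "(\<supseteq>)" "nerve_diagram G'"
      by unfold_locales (rule G'.nerve_diagram_functor[OF U(2)])
    note \<Phi> = G.nerve_desc[OF U] and \<Phi>' = G'.nerve_desc[OF U]
    have op: "openin X (\<Inter>S)" "\<Inter>S \<subseteq> U" if "S \<in> nerve \<U>" for S
      using G.openin_Inter_nerve[OF U(2) that] that U(3) by (auto simp: nerve_def)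
    have iso: "?\<Phi> \<in> iso ?C (grp G U)" using G U unfolding cosheaf_def by blast
    define k where "k = inv_into (carrier ?C) ?\<Phi>"
    have k: "k \<in> iso (grp G U) ?C"
      unfolding k_def by (rule N.colim.iso_set_sym[OF iso])
    have kl: "k (?\<Phi> a) = a" if "a \<in> carrier ?C" for a
      using iso that unfolding k_def iso_def bij_betw_def by (simp add: inv_into_f_f)
    have kr: "?\<Phi> (k y) = y" if "y \<in> carrier (grp G U)" for y
      using iso that unfolding k_def iso_def bij_betw_def by (simp add: f_inv_into_f)
    define e where "e = colim_desc (nerve \<U>) ?C' (\<lambda>S x. ?i' S (\<theta> (\<Inter>S) x))"
    have e1: "(\<lambda>x. ?i' S (\<theta> (\<Inter>S) x)) \<in> hom (grp (nerve_diagram G) S) ?C'" if "S \<in> nerve \<U>" for S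
      using hom_compose[OF precosheaf_homD(1)[OF \<theta>] N'.colim_inj_hom[OF that, unfolded nerve_diagram_def, simplified]]
        op[OF that] by (simp add: o_def nerve_diagram_def)
    have e2: "?i' T (\<theta> (\<Inter>T) (arr (nerve_diagram G) S T x)) = ?i' S (\<theta> (\<Inter>S) x)"
      if "S \<in> nerve \<U>" "T \<in> nerve \<U>" "S \<supseteq> T" "x \<in> carrier (grp (nerve_diagram G) S)" for S T x
    proof -
      have "\<theta> (\<Inter>T) (arr (nerve_diagram G) S T x) = arr (nerve_diagram G') S T (\<theta> (\<Inter>S) x)"
        using precosheaf_homD(2)[OF \<theta> op(1)[OF that(1)] op(1)[OF that(2)] Inter_anti_mono[OF that(3)]] that(4)
        by (simp add: nerve_diagram_def)
      moreover have "\<theta> (\<Inter>S) x \<in> carrier (grp (nerve_diagram G') S)"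
        using that op precosheaf_homD(3)[OF \<theta>] by (simp add: nerve_diagram_def)
      ultimately show ?thesis
        using N'.colim_inj_arr[OF that(1,2,3)] by simp
    qed
    have e: "e \<in> hom ?C ?C'"
      unfolding e_def by (rule N.colim_desc_hom[OF N'.comm_group_colim e1 e2])
    have ei: "e (?i S x) = ?i' S (\<theta> (\<Inter>S) x)" if "S \<in> nerve \<U>" "x \<in> carrier (grp G (\<Inter>S))" for S x
      unfolding e_def
      by (rule N.colim_desc_inj[OF N'.comm_group_colim e1 e2]) (use that in \<open>auto simp: nerve_diagram_def\<close>)
    define \<psi> where "\<psi> = e \<circ> (k \<circ> \<theta>' U)"
    have "k \<in> hom (grp G U) ?C" using k by (simp add: iso_def)
    with precosheaf_homD(1)[OF \<theta>' U(1)] have "k \<circ> \<theta>' U \<in> hom (grp G' U) ?C"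
      by (rule hom_compose)
    then have "\<psi> \<in> hom (grp G' U) ?C'"
      unfolding \<psi>_def using e by (rule hom_compose)
    moreover have "\<psi> (arr G' (\<Inter>S) U y) = ?i' S y"
      if S: "S \<in> nerve \<U>" "y \<in> carrier (grp G' (\<Inter>S))" for S y
    proof -
      have y: "\<theta>' (\<Inter>S) y \<in> carrier (grp G (\<Inter>S))"
        using precosheaf_homD(3)[OF \<theta>'] op S by blast
      have "\<theta>' U (arr G' (\<Inter>S) U y) = ?\<Phi> (?i S (\<theta>' (\<Inter>S) y))"
        using \<Phi>(2)[OF S(1) y] precosheaf_homD(2)[OF \<theta>'] op[OF S(1)] U(1) S(2) by simp
      moreover have "?i S (\<theta>' (\<Inter>S) y) \<in> carrier ?C"
        using N.colim_inj_closed[OF S(1)] y by (simp add: nerve_diagram_def)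
      ultimately show ?thesis
        using kl ei[OF S(1) y] \<theta>\<theta>' op S by (simp add: \<psi>_def)
    qed
    moreover have "?\<Phi>' (\<psi> y) = y" if y: "y \<in> carrier (grp G' U)" for y
    proof -
      have "(?\<Phi>' \<circ> e) a = (\<theta> U \<circ> ?\<Phi>) a" if "a \<in> carrier ?C" for a
      proof (rule N.colim_hom_ext[OF _ hom_compose[OF e \<Phi>'(1)] hom_compose[OF \<Phi>(1) precosheaf_homD(1)[OF \<theta> U(1)]] _ that])
        show "group (grp G' U)" using U(1) G'.group_grp by simp
        fix S x assume "S \<in> nerve \<U>" "x \<in> carrier (grp (nerve_diagram G) S)"
        then show "(?\<Phi>' \<circ> e) (?i S x) = (\<theta> U \<circ> ?\<Phi>) (?i S x)"
          using ei \<Phi>(2) \<Phi>'(2) op precosheaf_homD(2,3)[OF \<theta>] U(1) by (simp add: nerve_diagram_def)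
      qed
      moreover have "k (\<theta>' U y) \<in> carrier ?C"
        using k y precosheaf_homD(3)[OF \<theta>' U(1)] by (auto simp: iso_def hom_def)
      ultimately show ?thesis
        using kr \<theta>\<theta>' U(1) y precosheaf_homD(3)[OF \<theta>' U(1)] by (simp add: \<psi>_def)
    qed
    ultimately show "\<exists>\<psi>\<in>hom (grp G' U) ?C'.
        (\<forall>S\<in>nerve \<U>. \<forall>x\<in>carrier (grp G' (\<Inter>S)). \<psi> (arr G' (\<Inter>S) U x) = ?i' S x) \<and>
        (\<forall>y\<in>carrier (grp G' U). ?\<Phi>' (\<psi> y) = y)"
      by blast
  qed
qed

section \<open>Cosheaves on Alexandroff spaces\<close>

locale alexandroff_space =
  fixes X :: "'x topology"
  assumes openin_min_nhd: "\<And>x. x \<in> topspace X \<Longrightarrow> openin X (min_nhd X x)"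
begin

lemma openin_min_nhd': "openin X U \<Longrightarrow> x \<in> U \<Longrightarrow> openin X (min_nhd X x)"
  using openin_min_nhd openin_subset by blast

lemma min_nhd_subset: "openin X U \<Longrightarrow> x \<in> U \<Longrightarrow> min_nhd X x \<subseteq> U"
  unfolding min_nhd_def by blast

lemma in_min_nhd: "x \<in> min_nhd X x"
  unfolding min_nhd_def by blast

text \<open>
  Given a compatible family on the costalks, the class of \<open>g \<in> G\<^sub>x\<close> in \<open>colim\<^bsub>N(\<U>)\<^esub> G\<close> is computed
  at any finite intersection containing \<open>x\<close>; this gives the inverse of the map to \<open>G(U)\<close>.
\<close>

lemma cosheafI_costalks:
  fixes G :: "('x, 'a) precosheaf"
  assumes G: "precosheaf X G"
    and gen: "\<And>U. openin X U \<Longrightarrow> carrier (grp G U) \<subseteq>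
      generate (grp G U) (\<Union>x\<in>U. arr G (min_nhd X x) U ` carrier (costalk X G x))"
    and univ: "\<And>U (H :: ('x set set \<Rightarrow> 'a) set monoid) h. openin X U \<Longrightarrow> comm_group H \<Longrightarrow>
      (\<And>x. x \<in> U \<Longrightarrow> h x \<in> hom (costalk X G x) H) \<Longrightarrow>
      (\<And>x y g. x \<in> U \<Longrightarrow> y \<in> U \<Longrightarrow> min_nhd X x \<subseteq> min_nhd X y \<Longrightarrow> g \<in> carrier (costalk X G x) \<Longrightarrow>
        h y (arr G (min_nhd X x) (min_nhd X y) g) = h x g) \<Longrightarrow>
      \<exists>\<psi>\<in>hom (grp G U) H. \<forall>x\<in>U. \<forall>g\<in>carrier (costalk X G x). \<psi> (arr G (min_nhd X x) U g) = h x g"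
  shows "cosheaf X G"
proof -
  interpret precosheaf_on X G using G by unfold_locales
  show ?thesis
  proof (rule cosheafI_inverse)
    fix U \<U> assume U: "openin X U" "\<forall>V\<in>\<U>. openin X V" "\<Union>\<U> = U"
    let ?\<Phi> = "colim_desc (nerve \<U>) (grp G U) (\<lambda>S. arr G (\<Inter>S) U)"
    let ?C = "colim (nerve \<U>) (\<supseteq>) (nerve_diagram G)"
    let ?i = "colim_inj (nerve \<U>) (\<supseteq>) (nerve_diagram G)"
    interpret N: ab_diagram "nerve \<U>" "(\<supseteq>)" "nerve_diagram G"
      by unfold_locales (rule nerve_diagram_functor[OF U(2)])
    note \<Phi> = nerve_desc[OF U]
    have op: "openin X (\<Inter>S)" "\<Inter>S \<subseteq> U" if "S \<in> nerve \<U>" for S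
      using openin_Inter_nerve[OF U(2) that] that U(3) by (auto simp: nerve_def)
    note mn = openin_min_nhd' min_nhd_subset
    have "\<exists>V. V \<in> \<U> \<and> x \<in> V" if "x \<in> U" for x using that U(3) by blast
    then obtain V where V: "\<And>x. x \<in> U \<Longrightarrow> V x \<in> \<U>" "\<And>x. x \<in> U \<Longrightarrow> x \<in> V x" by metis
    define h where "h x g = ?i {V x} (arr G (min_nhd X x) (V x) g)" for x g
    have V1: "{V x} \<in> nerve \<U>" if "x \<in> U" for x
      using V that by (auto simp: nerve_def)
    have V2: "openin X (V x)" "min_nhd X x \<subseteq> V x" "openin X (min_nhd X x)" if "x \<in> U" for x
      using V U(1,2) that mn by blast+
    have hh: "h x \<in> hom (costalk X G x) ?C" if "x \<in> U" for x
      using hom_compose[of "arr G (min_nhd X x) (V x)" "costalk X G x" "grp G (V x)" "?i {V x}" ?C]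
        arr_hom V2[OF that] N.colim_inj_hom[OF V1[OF that]]
      by (simp add: h_def[abs_def] o_def costalk_def nerve_diagram_def)
    \<comment> \<open>Both classes come from the common refinement \<open>S \<union> T\<close>,
      which belongs to the nerve because the nonempty set \<open>W\<close> lies in its
      intersection.\<close>
    have shrink: "?i S (arr G W (\<Inter>S) g) = ?i T (arr G W (\<Inter>T) g)"
      if "S \<in> nerve \<U>" "T \<in> nerve \<U>" "openin X W" "W \<subseteq> \<Inter>S" "W \<subseteq> \<Inter>T" "W \<noteq> {}" "g \<in> carrier (grp G W)"
      for S T W g
    proof -
      have ST: "S \<union> T \<in> nerve \<U>" "W \<subseteq> \<Inter>(S \<union> T)"
        using that unfolding nerve_def by blast+
      have "?i S' (arr G W (\<Inter>S') g) = ?i (S \<union> T) (arr G W (\<Inter>(S \<union> T)) g)"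
        if S': "S' \<in> nerve \<U>" "S' \<subseteq> S \<union> T" "W \<subseteq> \<Inter>S'" for S'
      proof -
        have *: "arr (nerve_diagram G) (S \<union> T) S' (arr G W (\<Inter>(S \<union> T)) g) = arr G W (\<Inter>S') g"
          unfolding nerve_diagram_def diagram.simps using ST S' op \<open>openin X W\<close> \<open>g \<in> _\<close> by (intro arr_comp) (auto intro: Inter_anti_mono)
        have "arr G W (\<Inter>(S \<union> T)) g \<in> carrier (grp (nerve_diagram G) (S \<union> T))"
          using ST op \<open>openin X W\<close> \<open>g \<in> _\<close> by (auto simp: nerve_diagram_def intro!: arr_closed)
        from N.colim_inj_arr[OF ST(1) S'(1,2) this] show ?thesis
          unfolding * .
      qed
      from this[of S] this[of T] that show ?thesis by auto
    qed
    have h_arr: "h x g = ?i S (arr G (min_nhd X x) (\<Inter>S) g)"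
      if "x \<in> U" "S \<in> nerve \<U>" "x \<in> \<Inter>S" "g \<in> carrier (costalk X G x)" for x S g
      using shrink[OF V1[OF that(1)] that(2) V2(3)[OF that(1)] _ min_nhd_subset[OF op(1)[OF that(2)] that(3)]]
        V2[OF that(1)] in_min_nhd that(4) unfolding h_def costalk_def by fastforce
    \<comment> \<open>The test group is the colimit over the nerve itself; it determines the type of
      \<open>H\<close> in the hypothesis \<open>univ\<close>.\<close>
    have "\<exists>\<psi>\<in>hom (grp G U) ?C. \<forall>x\<in>U. \<forall>g\<in>carrier (costalk X G x). \<psi> (arr G (min_nhd X x) U g) = h x g"
    proof (rule univ[OF U(1) N.comm_group_colim hh])
      fix x y g assume xy: "x \<in> U" "y \<in> U" "min_nhd X x \<subseteq> min_nhd X y" "g \<in> carrier (costalk X G x)"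
      have "arr G (min_nhd X y) (V y) (arr G (min_nhd X x) (min_nhd X y) g) = arr G (min_nhd X x) (V y) g"
        using xy V2 by (intro arr_comp) (auto simp: costalk_def)
      moreover have "x \<in> V y" using xy V2 in_min_nhd by blast
      ultimately show "h y (arr G (min_nhd X x) (min_nhd X y) g) = h x g"
        using h_arr[OF xy(1) V1[OF xy(2)] _ xy(4)] by (simp add: h_def)
    qed
    then obtain \<psi> where \<psi>: "\<psi> \<in> hom (grp G U) ?C"
      and \<psi>h: "\<And>x g. x \<in> U \<Longrightarrow> g \<in> carrier (costalk X G x) \<Longrightarrow> \<psi> (arr G (min_nhd X x) U g) = h x g"
      by blast
    have gen_in: "(\<Union>x\<in>W. arr G (min_nhd X x) W ` carrier (costalk X G x)) \<subseteq> carrier (grp G W)"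
      if "openin X W" for W
    proof clarify
      fix x g assume "x \<in> W" "g \<in> carrier (costalk X G x)"
      then show "arr G (min_nhd X x) W g \<in> carrier (grp G W)"
        using that mn[OF that] by (intro arr_closed) (auto simp: costalk_def)
    qed
    \<comment> \<open>By \<open>gen\<close> applied to the open set \<open>\<Inter>S\<close>, only
      elements coming from costalks have to be compared, and on these both sides are given by
      \<open>h\<close>.\<close>
    have "\<psi> (arr G (\<Inter>S) U y) = ?i S y" if S: "S \<in> nerve \<U>" and y: "y \<in> carrier (grp G (\<Inter>S))" for S y
    proof -
      have "(\<psi> \<circ> arr G (\<Inter>S) U) y = ?i S y"
      proof (rule hom_eq_on_generate[where G = "grp G (\<Inter>S)" and H = ?C and \<psi> = "?i S"
            and \<phi> = "\<psi> \<circ> arr G (\<Inter>S) U" and a = y])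
        show "group (grp G (\<Inter>S))" "group ?C" using group_grp op[OF S] N.colim.is_group by auto
        show "y \<in> generate (grp G (\<Inter>S)) (\<Union>x\<in>\<Inter>S. arr G (min_nhd X x) (\<Inter>S) ` carrier (costalk X G x))"
          using gen[OF op(1)[OF S]] y by blast
        show "\<psi> \<circ> arr G (\<Inter>S) U \<in> hom (grp G (\<Inter>S)) ?C"
          using hom_compose[OF arr_hom \<psi>] op[OF S] U(1) by blast
        show "?i S \<in> hom (grp G (\<Inter>S)) ?C"
          using N.colim_inj_hom[OF S] by (simp add: nerve_diagram_def)
        fix z assume "z \<in> (\<Union>x\<in>\<Inter>S. arr G (min_nhd X x) (\<Inter>S) ` carrier (costalk X G x))"
        then obtain x g where z: "x \<in> \<Inter>S" "g \<in> carrier (costalk X G x)" "z = arr G (min_nhd X x) (\<Inter>S) g"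
          by blast
        have "x \<in> U" using z(1) op(2)[OF S] by blast
        have "arr G (\<Inter>S) U z = arr G (min_nhd X x) U g"
          unfolding z(3) using z op[OF S] mn[OF op(1)[OF S] z(1)] U(1) by (intro arr_comp) (auto simp: costalk_def)
        then show "(\<psi> \<circ> arr G (\<Inter>S) U) z = ?i S z"
          using \<psi>h[OF \<open>x \<in> U\<close> z(2)] h_arr[OF \<open>x \<in> U\<close> S z(1,2)] z(3) by simp
      qed (use gen_in op[OF S] in blast)
      then show ?thesis by simp
    qed
    moreover have "?\<Phi> (\<psi> y) = y" if "y \<in> carrier (grp G U)" for y
    proof -
      have "(?\<Phi> \<circ> \<psi>) y = id y"
      proof (rule hom_eq_on_generate[OF _ _ gen_in[OF U(1)] hom_compose[OF \<psi> \<Phi>(1)]])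
        show "y \<in> generate (grp G U) (\<Union>x\<in>U. arr G (min_nhd X x) U ` carrier (costalk X G x))"
          using that gen[OF U(1)] by blast
        show "group (grp G U)" "group (grp G U)" using group_grp U(1) by auto
        show "id \<in> hom (grp G U) (grp G U)" by (simp add: hom_def)
        fix z assume "z \<in> (\<Union>x\<in>U. arr G (min_nhd X x) U ` carrier (costalk X G x))"
        then obtain x g where z: "x \<in> U" "g \<in> carrier (costalk X G x)" "z = arr G (min_nhd X x) U g"
          by blast
        have "arr G (min_nhd X x) (V x) g \<in> carrier (grp G (V x))"
          using z V2[OF z(1)] by (intro arr_closed) (auto simp: costalk_def)
        then have "?\<Phi> (h x g) = arr G (V x) U (arr G (min_nhd X x) (V x) g)"
          using \<Phi>(2)[OF V1[OF z(1)]] by (simp add: h_def)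
        also have "\<dots> = arr G (min_nhd X x) U g"
          using z V2[OF z(1)] V(1)[OF z(1)] U by (intro arr_comp) (auto simp: costalk_def)
        finally show "(?\<Phi> \<circ> \<psi>) z = id z"
          using \<psi>h z by simp
      qed
      then show ?thesis by simp
    qed
    ultimately show "\<exists>\<psi>\<in>hom (grp G U) ?C.
        (\<forall>S\<in>nerve \<U>. \<forall>x\<in>carrier (grp G (\<Inter>S)). \<psi> (arr G (\<Inter>S) U x) = ?i S x) \<and>
        (\<forall>y\<in>carrier (grp G U). ?\<Phi> (\<psi> y) = y)"
      using \<psi> by blast
  qed
qed

end

section \<open>Free cosheaves and projective resolutions\<close>

lemma (in ab_diagram) colim_generate:
  assumes "a \<in> carrier (colim I R D)"
  shows "a \<in> generate (colim I R D) (\<Union>i\<in>I. colim_inj I R D i ` carrier (grp D i))"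
proof -
  let ?q = "\<lambda>c. colim_relations I R D #>\<^bsub>sum_group I (grp D)\<^esub> c"
  let ?B = "\<Union>i\<in>I. colim_inj I R D i ` carrier (grp D i)"
  interpret q: group_hom "sum_group I (grp D)" "colim I R D" ?q
    using rel.r_coset_hom_Mod S.is_group colim.is_group by (intro group_homI) (auto simp: colim_def)
  obtain c where c: "c \<in> carrier (sum_group I (grp D))" "a = ?q c"
    using assms by (auto simp: colim_def carrier_FactGroup)
  have "?q c \<in> generate (colim I R D) ?B"
  proof (rule sum_group_induct[OF group_grp c(1)])
    show "?q \<one>\<^bsub>sum_group I (grp D)\<^esub> \<in> generate (colim I R D) ?B"
      unfolding q.hom_one by (rule generate.one)
  next
    fix i x c assume *: "i \<in> I" "x \<in> carrier (grp D i)" "c \<in> carrier (sum_group I (grp D))"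
      "?q c \<in> generate (colim I R D) ?B"
    have "?q (sum_inj I (grp D) i x) \<in> generate (colim I R D) ?B"
      using * by (intro generate.incl) (auto simp: colim_inj_def)
    with * show "?q (sum_inj I (grp D) i x \<otimes>\<^bsub>sum_group I (grp D)\<^esub> c) \<in> generate (colim I R D) ?B"
      unfolding q.hom_mult[OF sinj_closed[OF *(1,2)] *(3)] by (intro generate.eng)
  qed
  then show ?thesis using c by simp
qed

lemma precosheaf_hom_compose:
  assumes \<alpha>: "\<alpha> \<in> precosheaf_hom X G G'" and \<beta>: "\<beta> \<in> precosheaf_hom X G' G''"
  shows "(\<lambda>U. \<beta> U \<circ> \<alpha> U) \<in> precosheaf_hom X G G''"
  using hom_compose[OF precosheaf_homD(1)[OF \<alpha>] precosheaf_homD(1)[OF \<beta>]]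
    precosheaf_homD(2,3)[OF \<alpha>] precosheaf_homD(2)[OF \<beta>]
  by (simp add: precosheaf_hom_def)

text \<open>A larger open set only adds generators, so the structure maps are inclusions between
  subgroups of one group of formal combinations, hence \<open>id\<close>.\<close>

definition free_cosheaf :: "('x \<Rightarrow> 'g set) \<Rightarrow> ('x, ('x, 'g) free_type) precosheaf" where
  "free_cosheaf S = \<lparr>grp = (\<lambda>U. free_Abelian_group (Sigma U S)), arr = (\<lambda>U V. id)\<rparr>"

lemma grp_free_cosheaf [simp]: "grp (free_cosheaf S) U = free_Abelian_group (Sigma U S)"
  and arr_free_cosheaf [simp]: "arr (free_cosheaf S) U V = id"
  by (simp_all add: free_cosheaf_def)

lemma precosheaf_free_cosheaf: "precosheaf X (free_cosheaf S)"
proof -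
  have "Sigma U S \<subseteq> Sigma V S" if "U \<subseteq> V" for U V using that by blast
  then show ?thesis
    by (auto simp: precosheaf_def ab_functor_def abelian_free_Abelian_group
        group_hom_free_Abelian_groups_id)
qed

text \<open>Transport of structure along an injection \<open>e\<close>. It serves to bring cosheaves
  into a prescribed value type: that of the test objects in \<open>projective_cosheaf\<close>, and
  the single type shared by all terms of a resolution.\<close>

definition copy_diagram :: "('a \<Rightarrow> 'b) \<Rightarrow> ('i, 'a) diagram \<Rightarrow> ('i, 'b) diagram" where
  "copy_diagram e D =
     \<lparr>grp = (\<lambda>i. \<lparr>carrier = e ` carrier (grp D i),
                   monoid.mult = (\<lambda>x y. e (inv_into UNIV e x \<otimes>\<^bsub>grp D i\<^esub> inv_into UNIV e y)), one = e \<one>\<^bsub>grp D i\<^esub>\<rparr>),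
      arr = (\<lambda>i j x. e (arr D i j (inv_into UNIV e x)))\<rparr>"

context
  fixes e :: "'a \<Rightarrow> 'b"
  assumes e: "inj e"
begin

lemma copy_diagram_functor:
  assumes "ab_functor I R D"
  shows "ab_functor I R (copy_diagram e D)"
proof -
  interpret ab_diagram I R D using assms by unfold_locales
  have "comm_group (grp (copy_diagram e D) i)" if "i \<in> I" for i
  proof -
    interpret comm_group "grp D i" using comm_group_grp that .
    show ?thesis
    proof (rule comm_groupI)
      fix x assume "x \<in> carrier (grp (copy_diagram e D) i)"
      then show "\<exists>y\<in>carrier (grp (copy_diagram e D) i).
          y \<otimes>\<^bsub>grp (copy_diagram e D) i\<^esub> x = \<one>\<^bsub>grp (copy_diagram e D) i\<^esub>"
        by (auto simp: copy_diagram_def inv_f_f[OF e] intro!: bexI[where P = "\<lambda>y. e (y \<otimes>\<^bsub>_\<^esub> _) = _", OF _ inv_closed])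
    qed (auto simp: copy_diagram_def inv_f_f[OF e] m_assoc m_comm m_lcomm)
  qed
  moreover have "arr (copy_diagram e D) i j \<in> hom (grp (copy_diagram e D) i) (grp (copy_diagram e D) j)"
    if "i \<in> I" "j \<in> I" "R i j" for i j
    using hom_mult[OF arr_hom[OF that]] arr_closed[OF that]
    by (auto simp: hom_def copy_diagram_def inv_f_f[OF e])
  ultimately show ?thesis
    by (auto simp: ab_functor_def) (auto simp: copy_diagram_def inv_f_f[OF e] arr_id arr_comp)
qed

lemma copy_diagram_homs:
  assumes "precosheaf X G"
  shows "(\<lambda>U. e) \<in> precosheaf_hom X G (copy_diagram e G)"
    and "(\<lambda>U. inv_into UNIV e) \<in> precosheaf_hom X (copy_diagram e G) G"
    and "x \<in> carrier (grp G U) \<Longrightarrow> inv_into UNIV e (e x) = x"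
    and "y \<in> carrier (grp (copy_diagram e G) U) \<Longrightarrow> e (inv_into UNIV e y) = y"
proof -
  interpret precosheaf_on X G using assms by unfold_locales
  have "group (grp G U)" if "openin X U" for U using group_grp that by simp
  then show "(\<lambda>U. e) \<in> precosheaf_hom X G (copy_diagram e G)"
    and "(\<lambda>U. inv_into UNIV e) \<in> precosheaf_hom X (copy_diagram e G) G"
    by (auto simp: precosheaf_hom_def hom_def copy_diagram_def inv_f_f[OF e] group.is_monoid
        monoid.m_closed)
qed (auto simp: copy_diagram_def inv_f_f[OF e])

lemma cosheaf_copy_diagram:
  assumes "cosheaf X G" shows "cosheaf X (copy_diagram e G)"
proof (rule cosheaf_transport[OF assms])
  have G: "precosheaf X G" using assms by (simp add: cosheaf_def)
  show "precosheaf X (copy_diagram e G)"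
    using G copy_diagram_functor unfolding precosheaf_def by blast
  show "(\<lambda>U. e) \<in> precosheaf_hom X G (copy_diagram e G)"
    "(\<lambda>U. inv_into UNIV e) \<in> precosheaf_hom X (copy_diagram e G) G"
    "y \<in> carrier (grp (copy_diagram e G) U) \<Longrightarrow> e (inv_into UNIV e y) = y" for U y
    using copy_diagram_homs[OF G] by blast+
qed

end

section \<open>Free cosheaves on an Alexandroff space and their lifting property\<close>

context alexandroff_space
begin

lemma costalk_free_cosheaf: "costalk X (free_cosheaf S) x = free_Abelian_group (Sigma (min_nhd X x) S)"
  by (simp add: costalk_def)

text \<open>Every generator \<open>(x, g)\<close> lies in the costalk at its own point
  \<open>x\<close>. Hence costalks generate, and a compatible family \<open>h\<close> extends by
  sending \<open>(x, g)\<close> to its value under \<open>h x\<close>. A generator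
  \<open>(y, g)\<close> of the costalk at another point \<open>x\<close> has
  \<open>min_nhd X y\<close> inside \<open>min_nhd X x\<close>, so compatibility gives it the right
  value.\<close>

lemma cosheaf_free_cosheaf: "cosheaf X (free_cosheaf S)"
proof (rule cosheafI_costalks[OF precosheaf_free_cosheaf])
  fix U assume U: "openin X U"
  let ?B = "\<Union>x\<in>U. arr (free_cosheaf S) (min_nhd X x) U ` carrier (costalk X (free_cosheaf S) x)"
  have "Sigma (min_nhd X x) S \<subseteq> Sigma U S" if "x \<in> U" for x
    using min_nhd_subset[OF U that] by blast
  then have B: "?B \<subseteq> carrier (free_Abelian_group (Sigma U S))"
    by (fastforce simp: costalk_free_cosheaf)
  interpret B: subgroup "generate (free_Abelian_group (Sigma U S)) ?B" "free_Abelian_group (Sigma U S)"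
    by (rule group.generate_is_subgroup[OF group_free_Abelian_group B])
  show "carrier (grp (free_cosheaf S) U) \<subseteq> generate (grp (free_cosheaf S) U) ?B"
  proof
    fix a assume "a \<in> carrier (grp (free_cosheaf S) U)"
    then have "Poly_Mapping.keys a \<subseteq> Sigma U S" by simp
    then have "a \<in> generate (free_Abelian_group (Sigma U S)) ?B"
    proof (rule free_Abelian_group_induct)
      show "0 \<in> generate (free_Abelian_group (Sigma U S)) ?B" using B.one_closed by simp
    next
      fix x y assume *: "Poly_Mapping.keys x \<subseteq> Sigma U S" "Poly_Mapping.keys y \<subseteq> Sigma U S"
        "x \<in> generate (free_Abelian_group (Sigma U S)) ?B"
        "y \<in> generate (free_Abelian_group (Sigma U S)) ?B"
      then show "x - y \<in> generate (free_Abelian_group (Sigma U S)) ?B"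
        using B.m_closed[OF *(3) B.m_inv_closed[OF *(4)]] by simp
    next
      fix s assume "s \<in> Sigma U S"
      then show "frag_of s \<in> generate (free_Abelian_group (Sigma U S)) ?B"
        using in_min_nhd by (intro generate.incl) (force simp: costalk_free_cosheaf)
    qed
    then show "a \<in> generate (grp (free_cosheaf S) U) ?B" by simp
  qed
next
  fix U and H :: "('x set set \<Rightarrow> ('x, 'b) free_type) set monoid" and h
  assume U: "openin X U" and H: "comm_group H"
    and h: "\<And>x. x \<in> U \<Longrightarrow> h x \<in> hom (costalk X (free_cosheaf S) x) H"
    and comp: "\<And>x y g. x \<in> U \<Longrightarrow> y \<in> U \<Longrightarrow> min_nhd X x \<subseteq> min_nhd X y \<Longrightarrow>
      g \<in> carrier (costalk X (free_cosheaf S) x) \<Longrightarrow>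
      h y (arr (free_cosheaf S) (min_nhd X x) (min_nhd X y) g) = h x g"
  interpret H: comm_group H by fact
  have mem: "frag_of (x, g) \<in> carrier (costalk X (free_cosheaf S) x)" if "g \<in> S x" for x g
    using that in_min_nhd by (simp add: costalk_free_cosheaf)
  have "(\<lambda>(x, g). h x (frag_of (x, g))) ` Sigma U S \<subseteq> carrier H"
    using hom_in_carrier[OF h mem] by auto
  from H.free_Abelian_group_universal[OF this] obtain \<psi>
    where \<psi>: "\<psi> \<in> hom (free_Abelian_group (Sigma U S)) H"
      "\<And>x g. x \<in> U \<Longrightarrow> g \<in> S x \<Longrightarrow> \<psi> (frag_of (x, g)) = h x (frag_of (x, g))"
    by (metis (no_types, lifting) SigmaI case_prod_conv)
  have "\<psi> a = h x a" if x: "x \<in> U" and a: "a \<in> carrier (costalk X (free_cosheaf S) x)" for x a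
  proof (rule hom_eq_on_frag[OF H.is_group _ _ _ a[unfolded costalk_free_cosheaf]])
    have sub: "Sigma (min_nhd X x) S \<subseteq> Sigma U S" using min_nhd_subset[OF U x] by blast
    then show "\<psi> \<in> hom (free_Abelian_group (Sigma (min_nhd X x) S)) H"
      using hom_compose[OF group_hom_free_Abelian_groups_id[THEN iffD2] \<psi>(1)] by simp
    show "h x \<in> hom (free_Abelian_group (Sigma (min_nhd X x) S)) H"
      using h[OF x] by (simp add: costalk_free_cosheaf)
    fix s assume "s \<in> Sigma (min_nhd X x) S"
    then obtain y g where s: "s = (y, g)" "y \<in> min_nhd X x" "g \<in> S y" by blast
    have "y \<in> U" using s(2) min_nhd_subset[OF U x] by blast
    moreover have "min_nhd X y \<subseteq> min_nhd X x"
      using min_nhd_subset[OF openin_min_nhd'[OF U x] s(2)] .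
    ultimately show "\<psi> (frag_of s) = h x (frag_of s)"
      using \<psi>(2) comp[OF _ x _ mem] s by simp
  qed
  with \<psi>(1) show "\<exists>\<psi>\<in>hom (grp (free_cosheaf S) U) H. \<forall>x\<in>U. \<forall>g\<in>carrier (costalk X (free_cosheaf S) x).
      \<psi> (arr (free_cosheaf S) (min_nhd X x) U g) = h x g"
    by (intro bexI[of _ \<psi>]) auto
qed

text \<open>The generator \<open>(x, g)\<close> already exists over \<open>min_nhd X x\<close>, the
  smallest open set where it can, and naturality forces its value on all larger ones. So a
  homomorphism out of a free cosheaf amounts to a free choice of costalk elements.\<close>

lemma free_cosheaf_hom:
  assumes G: "precosheaf X G" and f: "\<And>x g. x \<in> topspace X \<Longrightarrow> g \<in> S x \<Longrightarrow> f x g \<in> carrier (costalk X G x)"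
  shows "\<exists>\<gamma>\<in>precosheaf_hom X (free_cosheaf S) G. \<forall>U x g. openin X U \<longrightarrow> x \<in> U \<longrightarrow> g \<in> S x \<longrightarrow>
    \<gamma> U (frag_of (x, g)) = arr G (min_nhd X x) U (f x g)"
proof -
  interpret precosheaf_on X G using G by unfold_locales
  have "\<exists>c. c \<in> hom (free_Abelian_group (Sigma U S)) (grp G U) \<and>
      (\<forall>x g. x \<in> U \<longrightarrow> g \<in> S x \<longrightarrow> c (frag_of (x, g)) = arr G (min_nhd X x) U (f x g))" if U: "openin X U" for U
  proof -
    interpret GU: comm_group "grp G U" using comm_group_grp U by simp
    have "(\<lambda>(x, g). arr G (min_nhd X x) U (f x g)) ` Sigma U S \<subseteq> carrier (grp G U)"
    proof clarify
      fix x g assume "x \<in> U" "g \<in> S x"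
      then show "arr G (min_nhd X x) U (f x g) \<in> carrier (grp G U)"
        using U f openin_subset[OF U] min_nhd_subset[OF U] openin_min_nhd'[OF U]
        by (intro arr_closed) (auto simp: costalk_def)
    qed
    from GU.free_Abelian_group_universal[OF this] show ?thesis
      by (metis (no_types, lifting) SigmaI case_prod_conv)
  qed
  then obtain c where c: "\<And>U. openin X U \<Longrightarrow> c U \<in> hom (free_Abelian_group (Sigma U S)) (grp G U)"
    "\<And>U x g. openin X U \<Longrightarrow> x \<in> U \<Longrightarrow> g \<in> S x \<Longrightarrow> c U (frag_of (x, g)) = arr G (min_nhd X x) U (f x g)"
    by metis
  have "c V a = arr G U V (c U a)"
    if UV: "openin X U" "openin X V" "U \<subseteq> V" and a: "a \<in> carrier (free_Abelian_group (Sigma U S))" for U V a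
  proof -
    have "c V a = (arr G U V \<circ> c U) a"
    proof (rule hom_eq_on_frag[OF _ _ hom_compose[OF c(1)[OF UV(1)] arr_hom] _ a])
      have "Sigma U S \<subseteq> Sigma V S" using UV(3) by blast
      then show "c V \<in> hom (free_Abelian_group (Sigma U S)) (grp G V)"
        using hom_compose[OF group_hom_free_Abelian_groups_id[THEN iffD2] c(1)[OF UV(2)]] by simp
      fix s assume "s \<in> Sigma U S"
      then obtain x g where s: "s = (x, g)" "x \<in> U" "g \<in> S x" by blast
      have "arr G U V (arr G (min_nhd X x) U (f x g)) = arr G (min_nhd X x) V (f x g)"
        using UV s f[of x g] openin_subset[OF UV(1)] min_nhd_subset[OF UV(1) s(2)] openin_min_nhd'[OF UV(1) s(2)]
        by (intro arr_comp) (auto simp: costalk_def)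
      then show "c V (frag_of s) = (arr G U V \<circ> c U) (frag_of s)"
        using c(2) UV s by auto
    qed (use UV group_grp in auto)
    then show ?thesis by simp
  qed
  then have "c \<in> precosheaf_hom X (free_cosheaf S) G"
    using c(1) by (simp add: precosheaf_hom_def)
  with c(2) show ?thesis by blast
qed

text \<open>Lifting the value of each generator within the costalk at its own point suffices, and
  there \<open>\<alpha>\<close> is surjective by hypothesis. The value types of \<open>G\<close> and
  \<open>G'\<close> are arbitrary, which allows the result to be used for copies as well.\<close>

lemma free_cosheaf_lift:
  assumes G: "precosheaf X G" and G': "precosheaf X G'" and \<alpha>: "\<alpha> \<in> precosheaf_hom X G G'"
    and surj: "cosheaf_surj X G G' \<alpha>" and \<beta>: "\<beta> \<in> precosheaf_hom X (free_cosheaf S) G'"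
  shows "\<exists>\<gamma>\<in>precosheaf_hom X (free_cosheaf S) G.
    \<forall>U a. openin X U \<longrightarrow> a \<in> carrier (grp (free_cosheaf S) U) \<longrightarrow> \<alpha> U (\<gamma> U a) = \<beta> U a"
proof -
  interpret G: precosheaf_on X G using G by unfold_locales
  interpret G': precosheaf_on X G' using G' by unfold_locales
  have mem: "frag_of (x, g) \<in> carrier (grp (free_cosheaf S) (min_nhd X x))" if "g \<in> S x" for x g
    using that in_min_nhd by simp
  have "\<exists>y. y \<in> carrier (costalk X G x) \<and> \<alpha> (min_nhd X x) y = \<beta> (min_nhd X x) (frag_of (x, g))"
    if "x \<in> topspace X" "g \<in> S x" for x g
  proof -
    have "\<beta> (min_nhd X x) (frag_of (x, g)) \<in> carrier (costalk X G' x)"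
      using precosheaf_homD(3)[OF \<beta> openin_min_nhd[OF that(1)] mem[OF that(2)]] by (simp add: costalk_def)
    then have "\<beta> (min_nhd X x) (frag_of (x, g)) \<in> \<alpha> (min_nhd X x) ` carrier (costalk X G x)"
      using surj that by (simp add: cosheaf_surj_def)
    then show ?thesis by force
  qed
  then obtain f where f: "\<And>x g. x \<in> topspace X \<Longrightarrow> g \<in> S x \<Longrightarrow> f x g \<in> carrier (costalk X G x)"
    "\<And>x g. x \<in> topspace X \<Longrightarrow> g \<in> S x \<Longrightarrow> \<alpha> (min_nhd X x) (f x g) = \<beta> (min_nhd X x) (frag_of (x, g))"
    by metis
  have "\<exists>\<gamma>\<in>precosheaf_hom X (free_cosheaf S) G. \<forall>U x g. openin X U \<longrightarrow> x \<in> U \<longrightarrow> g \<in> S x \<longrightarrow>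
      \<gamma> U (frag_of (x, g)) = arr G (min_nhd X x) U (f x g)"
    by (rule free_cosheaf_hom[OF G]) (rule f(1))
  then obtain \<gamma> where \<gamma>: "\<gamma> \<in> precosheaf_hom X (free_cosheaf S) G"
    "\<And>U x g. openin X U \<Longrightarrow> x \<in> U \<Longrightarrow> g \<in> S x \<Longrightarrow> \<gamma> U (frag_of (x, g)) = arr G (min_nhd X x) U (f x g)"
    by (elim bexE) simp
  have "\<alpha> U (\<gamma> U a) = \<beta> U a" if U: "openin X U" and a: "a \<in> carrier (grp (free_cosheaf S) U)" for U a
  proof -
    have "(\<alpha> U \<circ> \<gamma> U) a = \<beta> U a"
    proof (rule hom_eq_on_frag[OF _ hom_compose[OF precosheaf_homD(1)[OF \<gamma>(1) U, unfolded grp_free_cosheaf]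
            precosheaf_homD(1)[OF \<alpha> U]] precosheaf_homD(1)[OF \<beta> U, unfolded grp_free_cosheaf]])
      show "a \<in> carrier (free_Abelian_group (Sigma U S))" using a by simp
      show "group (grp G' U)" using G'.group_grp U by simp
      fix s assume "s \<in> Sigma U S"
      then obtain x g where s: "s = (x, g)" "x \<in> U" "g \<in> S x" by blast
      have x: "x \<in> topspace X" using openin_subset[OF U] s by blast
      note mn = openin_min_nhd[OF x] min_nhd_subset[OF U s(2)]
      have "\<alpha> U (arr G (min_nhd X x) U (f x g)) = arr G' (min_nhd X x) U (\<alpha> (min_nhd X x) (f x g))"
        using f(1)[OF x s(3)] by (intro precosheaf_homD(2)[OF \<alpha> mn(1) U mn(2)]) (simp add: costalk_def)
      also have "\<dots> = \<beta> U (arr (free_cosheaf S) (min_nhd X x) U (frag_of (x, g)))"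
        using precosheaf_homD(2)[OF \<beta> mn(1) U mn(2) mem[OF s(3)]] f(2)[OF x s(3)] by simp
      finally show "(\<alpha> U \<circ> \<gamma> U) (frag_of s) = \<beta> U (frag_of s)"
        using \<gamma>(2) U s by simp
    qed
    then show ?thesis by simp
  qed
  with \<gamma>(1) show ?thesis by blast
qed

text \<open>A lifting problem for the copy becomes one for the free cosheaf by composing with
  \<open>e\<close>, and its solution is carried back by the inverse of \<open>e\<close>.\<close>

lemma projective_cosheaf_copy_free:
  assumes e: "inj (e :: ('x, 'g) free_type \<Rightarrow> 'b)"
  shows "projective_cosheaf X (copy_diagram e (free_cosheaf S))"
  unfolding projective_cosheaf_def
proof (intro conjI allI impI)
  let ?Q = "free_cosheaf S" and ?P = "copy_diagram e (free_cosheaf S)"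
  show "cosheaf X ?P" by (rule cosheaf_copy_diagram[OF e cosheaf_free_cosheaf])
  fix G G' :: "('x, ('x, 'b) free_type) precosheaf" and \<alpha> \<beta>
  assume *: "cosheaf X G \<and> cosheaf X G' \<and> \<alpha> \<in> precosheaf_hom X G G' \<and> cosheaf_surj X G G' \<alpha> \<and>
    \<beta> \<in> precosheaf_hom X ?P G'"
  note copy = copy_diagram_homs[OF e precosheaf_free_cosheaf[of X S]]
  from * have G: "precosheaf X G" "precosheaf X G'" by (auto simp: cosheaf_def)
  obtain \<gamma> where \<gamma>: "\<gamma> \<in> precosheaf_hom X ?Q G"
    "\<And>U a. openin X U \<Longrightarrow> a \<in> carrier (grp ?Q U) \<Longrightarrow> \<alpha> U (\<gamma> U a) = (\<beta> U \<circ> e) a"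
  proof -
    have "\<alpha> \<in> precosheaf_hom X G G'" "cosheaf_surj X G G' \<alpha>"
      "(\<lambda>U. \<beta> U \<circ> e) \<in> precosheaf_hom X ?Q G'"
      using * by (auto intro!: precosheaf_hom_compose[OF copy(1)])
    from free_cosheaf_lift[OF G this] that show thesis by blast
  qed
  have "(\<lambda>U. \<gamma> U \<circ> inv_into UNIV e) \<in> precosheaf_hom X ?P G"
    by (rule precosheaf_hom_compose[OF copy(2) \<gamma>(1)])
  moreover have "\<alpha> U ((\<gamma> U \<circ> inv_into UNIV e) x) = \<beta> U x" if "openin X U" "x \<in> carrier (grp ?P U)" for U x
    using \<gamma>(2) copy(4) precosheaf_homD(3)[OF copy(2)] that by simp
  ultimately show "\<exists>\<gamma>\<in>precosheaf_hom X ?P G. \<forall>U. openin X U \<longrightarrow>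
      (\<forall>x\<in>carrier (grp ?P U). \<alpha> U (\<gamma> U x) = \<beta> U x)"
    by (intro bexI[of _ "\<lambda>U. \<gamma> U \<circ> inv_into UNIV e"]) auto
qed

text \<open>The costalk at \<open>x\<close> of the free cosheaf also contains the generators of all
  points of \<open>min_nhd X x\<close>; the closure condition \<open>N_arr\<close> keeps their
  images inside \<open>N x\<close>. With \<open>N\<close> the full costalks this yields the start of
  a resolution, with \<open>N\<close> the kernels of a differential the next term.\<close>

lemma free_cosheaf_cover:
  assumes G: "precosheaf X G"
    and N: "\<And>x. x \<in> topspace X \<Longrightarrow> subgroup (N x) (costalk X G x)"
    and N_arr: "\<And>x y g. y \<in> topspace X \<Longrightarrow> x \<in> min_nhd X y \<Longrightarrow> g \<in> N x \<Longrightarrow>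
      arr G (min_nhd X x) (min_nhd X y) g \<in> N y"
  shows "\<exists>\<epsilon>\<in>precosheaf_hom X (free_cosheaf N) G.
    \<forall>x\<in>topspace X. \<epsilon> (min_nhd X x) ` carrier (costalk X (free_cosheaf N) x) = N x"
proof -
  interpret precosheaf_on X G using G by unfold_locales
  have mem: "g \<in> carrier (costalk X G x)" if "x \<in> topspace X" "g \<in> N x" for x g
    using subgroup.subset[OF N[OF that(1)]] that by blast
  have "\<exists>\<gamma>\<in>precosheaf_hom X (free_cosheaf N) G. \<forall>U x g. openin X U \<longrightarrow> x \<in> U \<longrightarrow> g \<in> N x \<longrightarrow>
      \<gamma> U (frag_of (x, g)) = arr G (min_nhd X x) U g"
    by (rule free_cosheaf_hom[OF G]) (rule mem)
  then obtain \<epsilon> where \<epsilon>: "\<epsilon> \<in> precosheaf_hom X (free_cosheaf N) G"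
    "\<And>U x g. openin X U \<Longrightarrow> x \<in> U \<Longrightarrow> g \<in> N x \<Longrightarrow> \<epsilon> U (frag_of (x, g)) = arr G (min_nhd X x) U g"
    by (elim bexE) simp
  have "\<epsilon> (min_nhd X x) ` carrier (costalk X (free_cosheaf N) x) = N x" if x: "x \<in> topspace X" for x
  proof (intro equalityI subsetI)
    interpret Nx: subgroup "N x" "costalk X G x" by (rule N[OF x])
    note U = openin_min_nhd[OF x]
    interpret \<epsilon>: group_hom "free_Abelian_group (Sigma (min_nhd X x) N)" "costalk X G x" "\<epsilon> (min_nhd X x)"
      using precosheaf_homD(1)[OF \<epsilon>(1) U] group_grp[of "min_nhd X x"] U
      by (intro group_homI) (auto simp: costalk_def)
    fix z assume "z \<in> \<epsilon> (min_nhd X x) ` carrier (costalk X (free_cosheaf N) x)"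
    then obtain a where a: "Poly_Mapping.keys a \<subseteq> Sigma (min_nhd X x) N" "z = \<epsilon> (min_nhd X x) a"
      by (auto simp: costalk_free_cosheaf)
    from a(1) have "\<epsilon> (min_nhd X x) a \<in> N x"
    proof (rule free_Abelian_group_induct)
      show "\<epsilon> (min_nhd X x) 0 \<in> N x" using \<epsilon>.hom_one Nx.one_closed by simp
    next
      fix a b assume *: "Poly_Mapping.keys a \<subseteq> Sigma (min_nhd X x) N"
        "Poly_Mapping.keys b \<subseteq> Sigma (min_nhd X x) N" "\<epsilon> (min_nhd X x) a \<in> N x" "\<epsilon> (min_nhd X x) b \<in> N x"
      have "\<epsilon> (min_nhd X x) (a \<otimes>\<^bsub>free_Abelian_group (Sigma (min_nhd X x) N)\<^esub>
          inv\<^bsub>free_Abelian_group (Sigma (min_nhd X x) N)\<^esub> b) \<in> N x"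
        unfolding \<epsilon>.hom_mult[OF _ \<epsilon>.G.inv_closed, unfolded carrier_free_Abelian_group_iff, OF *(1,2)]
          \<epsilon>.hom_inv[unfolded carrier_free_Abelian_group_iff, OF *(2)]
        by (rule Nx.m_closed[OF *(3) Nx.m_inv_closed[OF *(4)]])
      then show "\<epsilon> (min_nhd X x) (a - b) \<in> N x" using * by simp
    next
      fix s assume "s \<in> Sigma (min_nhd X x) N"
      then show "\<epsilon> (min_nhd X x) (frag_of s) \<in> N x"
        using \<epsilon>(2)[OF U] N_arr[OF x] by auto
    qed
    with a show "z \<in> N x" by simp
  next
    fix g assume g: "g \<in> N x"
    have "arr G (min_nhd X x) (min_nhd X x) g = g"
      using mem[OF x g] openin_min_nhd[OF x] by (intro arr_id) (auto simp: costalk_def)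
    then have "g = \<epsilon> (min_nhd X x) (frag_of (x, g))"
      using \<epsilon>(2)[OF openin_min_nhd[OF x] in_min_nhd g] by simp
    then show "g \<in> \<epsilon> (min_nhd X x) ` carrier (costalk X (free_cosheaf N) x)"
      using g in_min_nhd by (intro image_eqI) (auto simp: costalk_free_cosheaf)
  qed
  with \<epsilon>(1) show ?thesis by blast
qed

lemma free_cosheaf_cover_costalks:
  assumes G: "precosheaf X G"
  shows "\<exists>\<epsilon>\<in>precosheaf_hom X (free_cosheaf (\<lambda>x. carrier (costalk X G x))) G. \<forall>x\<in>topspace X.
    \<epsilon> (min_nhd X x) ` carrier (costalk X (free_cosheaf (\<lambda>x. carrier (costalk X G x))) x)
      = carrier (costalk X G x)"
proof (rule free_cosheaf_cover[OF G])
  interpret precosheaf_on X G using G by unfold_locales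
  show "subgroup (carrier (costalk X G x)) (costalk X G x)" if "x \<in> topspace X" for x
    unfolding costalk_def by (rule group.subgroup_self[OF group_grp]) (simp add: openin_min_nhd[OF that])
  show "arr G (min_nhd X x) (min_nhd X y) g \<in> carrier (costalk X G y)"
    if "y \<in> topspace X" "x \<in> min_nhd X y" "g \<in> carrier (costalk X G x)" for x y g
    using that openin_min_nhd[OF that(1)] openin_min_nhd'[OF _ that(2)] min_nhd_subset[OF _ that(2)]
    by (simp add: costalk_def arr_closed)
qed

text \<open>Provides the hypotheses of \<open>free_cosheaf_cover\<close> for kernels; naturality of
  \<open>\<alpha>\<close> gives the closure under structure maps.\<close>

lemma kernel_family:
  assumes G: "precosheaf X G" and G': "precosheaf X G'" and \<alpha>: "\<alpha> \<in> precosheaf_hom X G G'"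
  defines "N \<equiv> \<lambda>x. kernel (costalk X G x) (costalk X G' x) (\<alpha> (min_nhd X x))"
  shows "x \<in> topspace X \<Longrightarrow> subgroup (N x) (costalk X G x)"
    and "y \<in> topspace X \<Longrightarrow> x \<in> min_nhd X y \<Longrightarrow> g \<in> N x \<Longrightarrow> arr G (min_nhd X x) (min_nhd X y) g \<in> N y"
proof -
  interpret G: precosheaf_on X G using G by unfold_locales
  interpret G': precosheaf_on X G' using G' by unfold_locales
  show "subgroup (N x) (costalk X G x)" if x: "x \<in> topspace X"
  proof -
    interpret group_hom "costalk X G x" "costalk X G' x" "\<alpha> (min_nhd X x)"
      using precosheaf_homD(1)[OF \<alpha> openin_min_nhd[OF x]] G.group_grp G'.group_grp openin_min_nhd[OF x]
      by (intro group_homI) (auto simp: costalk_def)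
    show ?thesis unfolding N_def by (rule subgroup_kernel)
  qed
  show "arr G (min_nhd X x) (min_nhd X y) g \<in> N y"
    if y: "y \<in> topspace X" and x: "x \<in> min_nhd X y" and g: "g \<in> N x"
  proof -
    note oy = openin_min_nhd[OF y]
    note ox = openin_min_nhd'[OF oy x] and xy = min_nhd_subset[OF oy x]
    from g have g: "g \<in> carrier (grp G (min_nhd X x))" "\<alpha> (min_nhd X x) g = \<one>\<^bsub>grp G' (min_nhd X x)\<^esub>"
      by (auto simp: N_def kernel_def costalk_def)
    have "arr G' (min_nhd X x) (min_nhd X y) \<one>\<^bsub>grp G' (min_nhd X x)\<^esub> = \<one>\<^bsub>grp G' (min_nhd X y)\<^esub>"
      using G'.group_grp ox oy xy G'.arr_hom by (intro hom_one) auto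
    then show ?thesis
      using precosheaf_homD(2)[OF \<alpha> ox oy xy g(1)] G.arr_closed[OF _ _ xy g(1)] ox oy g
      by (simp add: N_def kernel_def costalk_def)
  qed
qed

end

text \<open>
  The costalks of a free resolution only ever grow up to the cardinality of the infinite type
  \<open>('x, 'b) free_type\<close>, so that all its terms can be copied into that type.
\<close>

lemma inj_free_type_collapse:
  "\<exists>e :: ('x, ('x, 'b) free_type) free_type \<Rightarrow> ('x, 'b) free_type. inj e"
proof -
  let ?T = "UNIV :: ('x, 'b) free_type set"
  \<comment> \<open>The integer multiples of one generator already make the type infinite.\<close>
  have "inj (\<lambda>n :: int. frag_cmul n (frag_of (undefined :: 'x \<times> 'b)))"
    by (rule injI) (metis lookup_frag_cmul lookup_frag_of mult.right_neutral)
  then have inf: "infinite ?T"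
    using finite_subset[OF subset_UNIV] finite_imageD infinite_UNIV_int by blast
  \<comment> \<open>Since \<open>'x\<close> embeds in the infinite type, the product with
    \<open>'x\<close> does not raise the cardinality, and neither does passing to the free abelian
    group on an infinite set.\<close>
  have "inj (\<lambda>x :: 'x. frag_of (x, undefined :: 'b))"
    by (rule injI) (simp add: frag_of_eq)
  then have "|UNIV :: 'x set| \<le>o |?T|"
    using card_of_ordLeq[of UNIV ?T] by blast
  then have "|(UNIV :: 'x set) \<times> ?T| \<le>o |?T|"
    using inf by (intro card_of_Times_ordLeq_infinite) auto
  then have 1: "(UNIV :: ('x \<times> ('x, 'b) free_type) set) \<lesssim> ?T"
    by (simp only: lepoll_def card_of_ordLeq UNIV_Times_UNIV)
  have "infinite (UNIV :: ('x \<times> ('x, 'b) free_type) set)"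
    using inf finite_prod by blast
  then have "carrier (free_Abelian_group (UNIV :: ('x \<times> ('x, 'b) free_type) set)) \<lesssim> ?T"
    using 1 eqpoll_free_Abelian_group_infinite eqpoll_imp_lepoll lepoll_trans by blast
  moreover have "carrier (free_Abelian_group (UNIV :: ('x \<times> ('x, 'b) free_type) set)) = UNIV"
    by (auto simp: set_eq_iff)
  ultimately show ?thesis by (auto simp: lepoll_def)
qed

context alexandroff_space
begin

text \<open>Each kernel is covered by the free cosheaf on its costalks. A cover of a term naturally
  takes values in an iterated free type; the injection \<open>e\<close> brings it back, so that the
  sequence stays in one type.\<close>

lemma projective_resolution_exists:
  fixes G :: "('x, 'b) precosheaf"
  assumes G: "cosheaf X G"
  shows "\<exists>(P :: nat \<Rightarrow> ('x, ('x, 'b) free_type) precosheaf) d \<epsilon>. projective_resolution X G P d \<epsilon>"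
proof -
  have preG: "precosheaf X G" using G by (simp add: cosheaf_def)
  \<comment> \<open>The first term has the right type already; copying along \<open>id\<close> gives
    it the shape to which \<open>projective_cosheaf_copy_free\<close> applies.\<close>
  let ?P0 = "copy_diagram id (free_cosheaf (\<lambda>x. carrier (costalk X G x)))
    :: ('x, ('x, 'b) free_type) precosheaf"
  have P0: "projective_cosheaf X ?P0"
    by (rule projective_cosheaf_copy_free) simp
  from free_cosheaf_cover_costalks[OF preG]
  obtain \<epsilon>0 where \<epsilon>0: "\<epsilon>0 \<in> precosheaf_hom X (free_cosheaf (\<lambda>x. carrier (costalk X G x))) G"
    "\<And>x. x \<in> topspace X \<Longrightarrow> \<epsilon>0 (min_nhd X x) ` carrier (costalk X (free_cosheaf (\<lambda>x. carrier (costalk X G x))) x)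
        = carrier (costalk X G x)"
    by (elim bexE) simp
  obtain e :: "('x, ('x, 'b) free_type) free_type \<Rightarrow> ('x, 'b) free_type" where e: "inj e"
    using inj_free_type_collapse by blast
  have cover: "\<exists>(Q :: ('x, ('x, 'b) free_type) precosheaf) \<delta>. projective_cosheaf X Q \<and>
      \<delta> \<in> precosheaf_hom X Q P \<and> cosheaf_exact X Q P H \<delta> \<alpha>"
    if P: "projective_cosheaf X P" and H: "precosheaf X H" and \<alpha>: "\<alpha> \<in> precosheaf_hom X P H"
    for P :: "('x, ('x, 'b) free_type) precosheaf" and H :: "('x, 'c) precosheaf" and \<alpha>
  proof -
    have P: "precosheaf X P" using P by (simp add: projective_cosheaf_def cosheaf_def)
    let ?N = "\<lambda>x. kernel (costalk X P x) (costalk X H x) (\<alpha> (min_nhd X x))"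
    let ?Q = "copy_diagram e (free_cosheaf ?N)"
    have "\<exists>\<delta>\<in>precosheaf_hom X (free_cosheaf ?N) P.
        \<forall>x\<in>topspace X. \<delta> (min_nhd X x) ` carrier (costalk X (free_cosheaf ?N) x) = ?N x"
      by (rule free_cosheaf_cover[OF P kernel_family[OF P H \<alpha>]])
    then obtain \<delta> where \<delta>: "\<delta> \<in> precosheaf_hom X (free_cosheaf ?N) P"
      "\<And>x. x \<in> topspace X \<Longrightarrow> \<delta> (min_nhd X x) ` carrier (costalk X (free_cosheaf ?N) x) = ?N x"
      by (elim bexE) simp
    note copy = copy_diagram_homs[OF e precosheaf_free_cosheaf[of X ?N]]
    have "(\<delta> (min_nhd X x) \<circ> inv_into UNIV e) ` carrier (costalk X ?Q x) = ?N x" if "x \<in> topspace X" for x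
      unfolding \<delta>(2)[OF that, symmetric]
      by (simp add: costalk_def copy_diagram_def image_comp o_def inv_f_f[OF e])
    then have "cosheaf_exact X ?Q P H (\<lambda>U. \<delta> U \<circ> inv_into UNIV e) \<alpha>"
      by (simp add: cosheaf_exact_def)
    then show ?thesis
      using projective_cosheaf_copy_free[OF e] precosheaf_hom_compose[OF copy(2) \<delta>(1)] by blast
  qed
  define \<epsilon> where "\<epsilon> = (\<lambda>U. \<epsilon>0 U \<circ> inv_into UNIV id)"
  note copy0 = copy_diagram_homs[OF inj_on_id precosheaf_free_cosheaf]
  have \<epsilon>: "\<epsilon> \<in> precosheaf_hom X ?P0 G"
    unfolding \<epsilon>_def by (rule precosheaf_hom_compose[OF copy0(2) \<epsilon>0(1)])
  have surj: "cosheaf_surj X ?P0 G \<epsilon>"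
    unfolding cosheaf_surj_def
  proof
    fix x assume "x \<in> topspace X"
    from \<epsilon>0(2)[OF this] show "\<epsilon> (min_nhd X x) ` carrier (costalk X ?P0 x) = carrier (costalk X G x)"
      by (simp add: \<epsilon>_def costalk_def copy_diagram_def)
  qed
  \<comment> \<open>The state is a pair of consecutive terms with the map \<open>f\<close> between
    them, because the next term covers the kernel of \<open>f\<close>. The overlap condition
    \<open>A' = B\<close> glues the states into one sequence, and the clause for
    \<open>n = 0\<close> fixes its beginning.\<close>
  have "\<exists>s :: nat \<Rightarrow> ('x, ('x, 'b) free_type) precosheaf \<times> ('x, ('x, 'b) free_type) precosheaf
      \<times> ('x set \<Rightarrow> ('x, 'b) free_type \<Rightarrow> ('x, 'b) free_type).
      \<forall>n. (case s n of (A, B, f) \<Rightarrow> projective_cosheaf X A \<and> projective_cosheaf X B \<and>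
          f \<in> precosheaf_hom X B A \<and> (n = 0 \<longrightarrow> A = ?P0 \<and> cosheaf_exact X B A G f \<epsilon>)) \<and>
        (case s n of (A, B, f) \<Rightarrow> case s (Suc n) of (A', B', f') \<Rightarrow>
          A' = B \<and> cosheaf_exact X B' B A f' f)"
  proof (rule dependent_nat_choice)
    obtain B :: "('x, ('x, 'b) free_type) precosheaf" and f where "projective_cosheaf X B" "f \<in> precosheaf_hom X B ?P0" "cosheaf_exact X B ?P0 G f \<epsilon>"
      using cover[OF P0 preG \<epsilon>] by blast
    with P0 show "\<exists>s :: ('x, ('x, 'b) free_type) precosheaf \<times> ('x, ('x, 'b) free_type) precosheaf
      \<times> ('x set \<Rightarrow> ('x, 'b) free_type \<Rightarrow> ('x, 'b) free_type).
      case s of (A, B, f) \<Rightarrow> projective_cosheaf X A \<and> projective_cosheaf X B \<and>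
          f \<in> precosheaf_hom X B A \<and> (0 = (0::nat) \<longrightarrow> A = ?P0 \<and> cosheaf_exact X B A G f \<epsilon>)"
      by (intro exI[of _ "(?P0, B, f)"]) auto
  next
    fix s :: "('x, ('x, 'b) free_type) precosheaf \<times> ('x, ('x, 'b) free_type) precosheaf
      \<times> ('x set \<Rightarrow> ('x, 'b) free_type \<Rightarrow> ('x, 'b) free_type)" and n :: nat
    obtain A B f where s: "s = (A, B, f)" by (cases s)
    assume "case s of (A, B, f) \<Rightarrow> projective_cosheaf X A \<and> projective_cosheaf X B \<and>
          f \<in> precosheaf_hom X B A \<and> (n = 0 \<longrightarrow> A = ?P0 \<and> cosheaf_exact X B A G f \<epsilon>)"
    then have AB: "projective_cosheaf X A" "projective_cosheaf X B" "f \<in> precosheaf_hom X B A"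
      by (auto simp: s)
    then have "precosheaf X A" by (simp add: projective_cosheaf_def cosheaf_def)
    from cover[OF AB(2) this AB(3)]
    obtain B' :: "('x, ('x, 'b) free_type) precosheaf" and f' where
      "projective_cosheaf X B'" "f' \<in> precosheaf_hom X B' B" "cosheaf_exact X B' B A f' f"
      by blast
    with AB show "\<exists>t :: ('x, ('x, 'b) free_type) precosheaf \<times> ('x, ('x, 'b) free_type) precosheaf
      \<times> ('x set \<Rightarrow> ('x, 'b) free_type \<Rightarrow> ('x, 'b) free_type).
      (case t of (A, B, f) \<Rightarrow> projective_cosheaf X A \<and> projective_cosheaf X B \<and>
          f \<in> precosheaf_hom X B A \<and> (Suc n = 0 \<longrightarrow> A = ?P0 \<and> cosheaf_exact X B A G f \<epsilon>)) \<and>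
        (case s of (A, B, f) \<Rightarrow> case t of (A', B', f') \<Rightarrow> A' = B \<and> cosheaf_exact X B' B A f' f)"
      by (intro exI[of _ "(B, B', f')"]) (auto simp: s)
  qed
  then obtain s where s: "\<forall>n. (case s n of (A, B, f) \<Rightarrow> projective_cosheaf X A \<and> projective_cosheaf X B \<and>
          f \<in> precosheaf_hom X B A \<and> (n = 0 \<longrightarrow> A = ?P0 \<and> cosheaf_exact X B A G f \<epsilon>)) \<and>
        (case s n of (A, B, f) \<Rightarrow> case s (Suc n) of (A', B', f') \<Rightarrow>
          A' = B \<and> cosheaf_exact X B' B A f' f)"
    by (rule exE)
  note s1 = s[THEN spec, THEN conjunct1] and s2 = s[THEN spec, THEN conjunct2]
  define P where "P n = fst (s n)" for n
  define d where "d n = snd (snd (s n))" for n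
  have sn: "s n = (P n, P (Suc n), d n)" for n
    using s2[of n] by (auto simp: P_def d_def split: prod.splits)
  have P: "projective_cosheaf X (P n)" "d n \<in> precosheaf_hom X (P (Suc n)) (P n)"
    "P 0 = ?P0" "cosheaf_exact X (P (Suc 0)) (P 0) G (d 0) \<epsilon>" for n
    using s1[of n] s1[of 0] by (auto simp: sn)
  have "cosheaf_exact X (P (Suc (Suc n))) (P (Suc n)) (P n) (d (Suc n)) (d n)" for n
    using s2[of n] by (simp add: sn)
  then have "projective_resolution X G P d \<epsilon>"
    using P G \<epsilon> surj by (simp add: projective_resolution_def)
  then show ?thesis by blast
qed

end

section \<open>The associated cosheaf\<close>

text \<open>Unions of principal up-sets are up-closed, and an up-closed set is the union of the
  principal up-sets of its elements.\<close>

lemma openin_face_space: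
  "openin (face_space K) U \<longleftrightarrow> U \<subseteq> K \<and> (\<forall>\<sigma>\<in>U. \<forall>\<tau>\<in>K. \<sigma> \<subseteq> \<tau> \<longrightarrow> \<tau> \<in> U)"
proof -
  let ?P = "\<lambda>U. \<exists>\<sigma>\<in>K. U = {\<tau>\<in>K. \<sigma> \<subseteq> \<tau>}"
  have eq: "(arbitrary union_of ?P) U \<longleftrightarrow> U \<subseteq> K \<and> (\<forall>\<sigma>\<in>U. \<forall>\<tau>\<in>K. \<sigma> \<subseteq> \<tau> \<longrightarrow> \<tau> \<in> U)" for U
  proof
    assume "(arbitrary union_of ?P) U"
    then show "U \<subseteq> K \<and> (\<forall>\<sigma>\<in>U. \<forall>\<tau>\<in>K. \<sigma> \<subseteq> \<tau> \<longrightarrow> \<tau> \<in> U)"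
      unfolding arbitrary_union_of_alt by fastforce
  next
    assume "U \<subseteq> K \<and> (\<forall>\<sigma>\<in>U. \<forall>\<tau>\<in>K. \<sigma> \<subseteq> \<tau> \<longrightarrow> \<tau> \<in> U)"
    then have "?P {\<tau>\<in>K. \<sigma> \<subseteq> \<tau>} \<and> \<sigma> \<in> {\<tau>\<in>K. \<sigma> \<subseteq> \<tau>} \<and> {\<tau>\<in>K. \<sigma> \<subseteq> \<tau>} \<subseteq> U" if "\<sigma> \<in> U" for \<sigma>
      using that by blast
    then show "(arbitrary union_of ?P) U"
      unfolding arbitrary_union_of_alt by (intro ballI) (rule exI)
  qed
  have "istopology (arbitrary union_of ?P)"
    unfolding istopology_base_alt eq by auto
  then show ?thesis
    by (simp add: face_space_def topology_inverse' eq)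
qed

lemma topspace_face_space [simp]: "topspace (face_space K) = K"
proof -
  have "openin (face_space K) K" by (simp add: openin_face_space)
  then have "K \<subseteq> topspace (face_space K)" by (rule openin_subset)
  moreover have "topspace (face_space K) \<subseteq> K"
    using openin_topspace[of "face_space K"] unfolding openin_face_space by blast
  ultimately show ?thesis by blast
qed

text \<open>At a simplex of \<open>K\<close> this is the minimal open neighbourhood, but unlike
  \<open>min_nhd\<close> it is also meaningful at the empty set.\<close>

definition star :: "'v set set \<Rightarrow> 'v set \<Rightarrow> 'v set set" where
  "star K \<sigma> = {\<tau>\<in>K. \<sigma> \<subseteq> \<tau>}"

lemma openin_star: "openin (face_space K) (star K \<sigma>)"
  by (auto simp: openin_face_space star_def)

lemma star_antimono: "\<tau> \<subseteq> \<sigma> \<Longrightarrow> star K \<sigma> \<subseteq> star K \<tau>"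
  by (auto simp: star_def)

lemma star_empty: "star K {} = K"
  by (simp add: star_def)

lemma min_nhd_face_space: "\<sigma> \<in> K \<Longrightarrow> min_nhd (face_space K) \<sigma> = star K \<sigma>"
  unfolding min_nhd_def openin_face_space star_def by (intro equalityI Inter_lower Inter_greatest) auto

interpretation face_space: alexandroff_space "face_space K"
  by unfold_locales (simp add: min_nhd_face_space openin_star)

locale cellular =
  fixes K :: "'v set set" and F :: "('v set, 'a) diagram"
  assumes cellular: "cellular_cosheaf K F"
begin

sublocale F: ab_diagram K "(\<supseteq>)" F
  using cellular by unfold_locales (simp add: cellular_cosheaf_def)

lemma restrict_diagram: "U \<subseteq> K \<Longrightarrow> ab_diagram U (\<supseteq>) F"
  using F.is_functor by (simp add: ab_diagram_def ab_functor_def subset_iff)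

abbreviation "FF \<equiv> associated_cosheaf F"
abbreviation "cinj U \<equiv> colim_inj U (\<supseteq>) F"

lemma grp_FF: "grp FF U = colim U (\<supseteq>) F"
  by (simp add: associated_cosheaf_def)

lemma cinj_hom: "U \<subseteq> K \<Longrightarrow> \<sigma> \<in> U \<Longrightarrow> cinj U \<sigma> \<in> hom (grp F \<sigma>) (grp FF U)"
  unfolding grp_FF by (rule ab_diagram.colim_inj_hom[OF restrict_diagram])

lemma cinj_closed: "U \<subseteq> K \<Longrightarrow> \<sigma> \<in> U \<Longrightarrow> x \<in> carrier (grp F \<sigma>) \<Longrightarrow> cinj U \<sigma> x \<in> carrier (grp FF U)"
  unfolding grp_FF by (rule ab_diagram.colim_inj_closed[OF restrict_diagram])

lemma cinj_arr:
  "U \<subseteq> K \<Longrightarrow> \<sigma> \<in> U \<Longrightarrow> \<tau> \<in> U \<Longrightarrow> \<tau> \<subseteq> \<sigma> \<Longrightarrow> x \<in> carrier (grp F \<sigma>) \<Longrightarrow> cinj U \<tau> (arr F \<sigma> \<tau> x) = cinj U \<sigma> x"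
  by (rule ab_diagram.colim_inj_arr[OF restrict_diagram])

lemma
  assumes "U \<subseteq> V" "V \<subseteq> K"
  shows arr_FF_hom: "arr FF U V \<in> hom (grp FF U) (grp FF V)"
    and arr_FF_inj: "\<sigma> \<in> U \<Longrightarrow> x \<in> carrier (grp F \<sigma>) \<Longrightarrow> arr FF U V (cinj U \<sigma> x) = cinj V \<sigma> x"
proof -
  interpret U: ab_diagram U "(\<supseteq>)" F using assms by (intro restrict_diagram) auto
  interpret V: ab_diagram V "(\<supseteq>)" F using assms by (intro restrict_diagram) auto
  have arr: "arr FF U V = colim_desc U (colim V (\<supseteq>) F) (cinj V)"
    by (simp add: associated_cosheaf_def)
  have 1: "cinj V \<sigma> \<in> hom (grp F \<sigma>) (colim V (\<supseteq>) F)" if "\<sigma> \<in> U" for \<sigma>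
    using that assms V.colim_inj_hom by blast
  have 2: "cinj V \<tau> (arr F \<sigma> \<tau> x) = cinj V \<sigma> x"
    if "\<sigma> \<in> U" "\<tau> \<in> U" "\<sigma> \<supseteq> \<tau>" "x \<in> carrier (grp F \<sigma>)" for \<sigma> \<tau> x
    using that assms V.colim_inj_arr by blast
  show "arr FF U V \<in> hom (grp FF U) (grp FF V)"
    unfolding arr grp_FF by (rule U.colim_desc_hom[OF V.comm_group_colim 1 2])
  show "\<sigma> \<in> U \<Longrightarrow> x \<in> carrier (grp F \<sigma>) \<Longrightarrow> arr FF U V (cinj U \<sigma> x) = cinj V \<sigma> x"
    unfolding arr by (rule U.colim_desc_inj[OF V.comm_group_colim 1 2])
qed

lemma FF_hom_ext:
  assumes "U \<subseteq> K" "group H" "\<phi> \<in> hom (grp FF U) H" "\<psi> \<in> hom (grp FF U) H"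
    and "\<And>\<sigma> x. \<sigma> \<in> U \<Longrightarrow> x \<in> carrier (grp F \<sigma>) \<Longrightarrow> \<phi> (cinj U \<sigma> x) = \<psi> (cinj U \<sigma> x)"
    and "a \<in> carrier (grp FF U)"
  shows "\<phi> a = \<psi> a"
  using ab_diagram.colim_hom_ext[OF restrict_diagram[OF assms(1)]] assms(2-) unfolding grp_FF by blast

lemma precosheaf_FF: "precosheaf (face_space K) FF"
  unfolding precosheaf_def ab_functor_def
proof (intro conjI ballI impI)
  fix U assume U: "U \<in> {U. openin (face_space K) U}"
  then have UK: "U \<subseteq> K" by (simp add: openin_face_space)
  then show "comm_group (grp FF U)"
    unfolding grp_FF by (intro ab_diagram.comm_group_colim restrict_diagram)
  then have gU: "group (grp FF U)" by (rule comm_group.axioms(2))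
  show "arr FF U U x = x" if "x \<in> carrier (grp FF U)" for x
  proof -
    have "arr FF U U x = id x"
      by (rule FF_hom_ext[OF UK gU arr_FF_hom[OF order_refl UK] _ _ that])
        (simp_all add: arr_FF_inj[OF order_refl UK] hom_def)
    then show ?thesis by simp
  qed
  fix V assume "V \<in> {U. openin (face_space K) U}"
  then have VK: "V \<subseteq> K" by (simp add: openin_face_space)
  show "arr FF U V \<in> hom (grp FF U) (grp FF V)" if "U \<subseteq> V"
    by (rule arr_FF_hom[OF that VK])
  fix W assume W: "W \<in> {U. openin (face_space K) U}"
  then have WK: "W \<subseteq> K" by (simp add: openin_face_space)
  have gW: "group (grp FF W)"
    unfolding grp_FF using ab_diagram.comm_group_colim[OF restrict_diagram[OF WK]] comm_group.axioms(2) by blast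
  fix a assume UV: "U \<subseteq> V" and VW: "V \<subseteq> W" and a: "a \<in> carrier (grp FF U)"
  then have UW: "U \<subseteq> W" by blast
  have "(arr FF V W \<circ> arr FF U V) a = arr FF U W a"
    using UV by (intro FF_hom_ext[OF UK gW hom_compose[OF arr_FF_hom[OF UV VK] arr_FF_hom[OF VW WK]] arr_FF_hom[OF UW WK] _ a])
      (auto simp: arr_FF_inj[OF UV VK] arr_FF_inj[OF VW WK] arr_FF_inj[OF UW WK])
  then show "arr FF V W (arr FF U V a) = arr FF U W a" by simp
qed

lemma star_subset: "star K \<sigma> \<subseteq> K" by (auto simp: star_def)

lemma self_in_star: "\<sigma> \<in> K \<Longrightarrow> \<sigma> \<in> star K \<sigma>" by (simp add: star_def)

text \<open>The group \<open>F(\<sigma>)\<close> enters the colimit over \<open>U\<close> through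
  the star of \<open>\<sigma>\<close>, so costalks generate. Conversely, a compatible family on
  costalks restricts to a cocone on \<open>F\<close> over \<open>U\<close>, and the universal
  property of the colimit extends it to \<open>U\<close>.\<close>

lemma cosheaf_FF: "cosheaf (face_space K) FF"
proof (rule face_space.cosheafI_costalks[OF precosheaf_FF])
  fix U assume "openin (face_space K) U"
  then have UK: "U \<subseteq> K" and up: "\<And>\<sigma>. \<sigma> \<in> U \<Longrightarrow> star K \<sigma> \<subseteq> U" by (auto simp: openin_face_space star_def)
  interpret U: ab_diagram U "(\<supseteq>)" F by (rule restrict_diagram[OF UK])
  let ?B = "\<Union>\<sigma>\<in>U. arr FF (min_nhd (face_space K) \<sigma>) U ` carrier (costalk (face_space K) FF \<sigma>)"
  have "(\<Union>\<sigma>\<in>U. cinj U \<sigma> ` carrier (grp F \<sigma>)) \<subseteq> ?B"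
  proof clarify
    fix \<sigma> x assume \<sigma>: "\<sigma> \<in> U" and x: "x \<in> carrier (grp F \<sigma>)"
    have \<sigma>K: "\<sigma> \<in> K" using \<sigma> UK by blast
    have "cinj U \<sigma> x = arr FF (star K \<sigma>) U (cinj (star K \<sigma>) \<sigma> x)"
      using arr_FF_inj[OF up[OF \<sigma>] UK self_in_star[OF \<sigma>K] x] by simp
    moreover have "cinj (star K \<sigma>) \<sigma> x \<in> carrier (grp FF (star K \<sigma>))"
      by (rule cinj_closed[OF star_subset self_in_star[OF \<sigma>K] x])
    ultimately show "cinj U \<sigma> x \<in> ?B"
      using \<sigma> by (intro UN_I[of \<sigma>]) (auto simp: costalk_def min_nhd_face_space[OF \<sigma>K])
  qed
  then show "carrier (grp FF U) \<subseteq> generate (grp FF U) ?B"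
    using U.colim_generate U.colim.mono_generate unfolding grp_FF by blast
next
  fix U and H :: "('v set set set \<Rightarrow> ('v set \<Rightarrow> 'a) set) set monoid" and h
  assume "openin (face_space K) U" and H: "comm_group H"
    and h: "\<And>\<sigma>. \<sigma> \<in> U \<Longrightarrow> h \<sigma> \<in> hom (costalk (face_space K) FF \<sigma>) H"
    and comp: "\<And>\<sigma> \<tau> g. \<sigma> \<in> U \<Longrightarrow> \<tau> \<in> U \<Longrightarrow> min_nhd (face_space K) \<sigma> \<subseteq> min_nhd (face_space K) \<tau> \<Longrightarrow>
      g \<in> carrier (costalk (face_space K) FF \<sigma>) \<Longrightarrow>
      h \<tau> (arr FF (min_nhd (face_space K) \<sigma>) (min_nhd (face_space K) \<tau>) g) = h \<sigma> g"
  then have UK: "U \<subseteq> K" and up: "\<And>\<sigma>. \<sigma> \<in> U \<Longrightarrow> star K \<sigma> \<subseteq> U" by (auto simp: openin_face_space star_def)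
  interpret U: ab_diagram U "(\<supseteq>)" F by (rule restrict_diagram[OF UK])
  interpret H: comm_group H by fact
  have mn: "min_nhd (face_space K) \<sigma> = star K \<sigma>" if "\<sigma> \<in> U" for \<sigma>
    using that UK by (intro min_nhd_face_space) blast
  have cs: "costalk (face_space K) FF \<sigma> = grp FF (star K \<sigma>)" if "\<sigma> \<in> U" for \<sigma>
    using mn[OF that] by (simp add: costalk_def)
  have self: "\<sigma> \<in> star K \<sigma>" if "\<sigma> \<in> U" for \<sigma> using that UK self_in_star by blast
  \<comment> \<open>Compatibility moves an element of \<open>F(\<sigma>)\<close> from the star of
    \<open>\<sigma>\<close> to the larger star of a face \<open>\<tau>\<close>.\<close>
  have h_arr: "h \<tau> (cinj (star K \<tau>) \<sigma> x) = h \<sigma> (cinj (star K \<sigma>) \<sigma> x)"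
    if "\<sigma> \<in> U" "\<tau> \<in> U" "\<tau> \<subseteq> \<sigma>" "x \<in> carrier (grp F \<sigma>)" for \<sigma> \<tau> x
    using comp[OF that(1,2), of "cinj (star K \<sigma>) \<sigma> x"] star_antimono[OF that(3), of K] cinj_closed[OF star_subset self[OF that(1)] that(4)]
      arr_FF_inj[OF star_antimono[OF that(3)] star_subset self[OF that(1)] that(4)]
    by (simp add: mn cs that)
  \<comment> \<open>The cocone on \<open>F\<close>: each \<open>h \<sigma>\<close> is evaluated on
    the summand that \<open>\<sigma>\<close> contributes to its own star.\<close>
  let ?f = "\<lambda>\<sigma> x. h \<sigma> (cinj (star K \<sigma>) \<sigma> x)"
  have 1: "?f \<sigma> \<in> hom (grp F \<sigma>) H" if "\<sigma> \<in> U" for \<sigma>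
    using hom_compose[OF cinj_hom[OF star_subset self[OF that]] h[OF that, unfolded cs[OF that]]]
    by (simp add: o_def)
  have 2: "?f \<tau> (arr F \<sigma> \<tau> x) = ?f \<sigma> x"
    if "\<sigma> \<in> U" "\<tau> \<in> U" "\<sigma> \<supseteq> \<tau>" "x \<in> carrier (grp F \<sigma>)" for \<sigma> \<tau> x
  proof -
    have "\<sigma> \<in> star K \<tau>" using that UK by (auto simp: star_def)
    from cinj_arr[OF star_subset this self[OF that(2)] that(3,4)] h_arr[OF that] show ?thesis by simp
  qed
  define \<psi> where "\<psi> = colim_desc U H ?f"
  have \<psi>: "\<psi> \<in> hom (grp FF U) H" "\<And>\<sigma> x. \<sigma> \<in> U \<Longrightarrow> x \<in> carrier (grp F \<sigma>) \<Longrightarrow> \<psi> (cinj U \<sigma> x) = ?f \<sigma> x"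
    unfolding \<psi>_def grp_FF by (rule U.colim_desc_hom[OF H 1 2] U.colim_desc_inj[OF H 1 2]; assumption)+
  have "\<psi> (arr FF (min_nhd (face_space K) \<sigma>) U g) = h \<sigma> g"
    if \<sigma>: "\<sigma> \<in> U" and g: "g \<in> carrier (costalk (face_space K) FF \<sigma>)" for \<sigma> g
  proof -
    have "(\<psi> \<circ> arr FF (star K \<sigma>) U) g = h \<sigma> g"
    proof (rule FF_hom_ext[OF star_subset H.is_group hom_compose[OF arr_FF_hom[OF up[OF \<sigma>] UK] \<psi>(1)]
          h[OF \<sigma>, unfolded cs[OF \<sigma>]] _ g[unfolded cs[OF \<sigma>]]])
      fix \<rho> x assume *: "\<rho> \<in> star K \<sigma>" "x \<in> carrier (grp F \<rho>)"
      then have "\<rho> \<in> U" "\<sigma> \<subseteq> \<rho>" using up[OF \<sigma>] by (auto simp: star_def)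
      then show "(\<psi> \<circ> arr FF (star K \<sigma>) U) (cinj (star K \<sigma>) \<rho> x) = h \<sigma> (cinj (star K \<sigma>) \<rho> x)"
        using arr_FF_inj[OF up[OF \<sigma>] UK *] \<psi>(2)[OF _ *(2)] h_arr[OF _ \<sigma> _ *(2)] by simp
    qed
    then show ?thesis by (simp add: mn[OF \<sigma>])
  qed
  with \<psi>(1) show "\<exists>\<psi>\<in>hom (grp FF U) H. \<forall>\<sigma>\<in>U. \<forall>g\<in>carrier (costalk (face_space K) FF \<sigma>).
      \<psi> (arr FF (min_nhd (face_space K) \<sigma>) U g) = h \<sigma> g"
    by (intro bexI[of _ \<psi>]) auto
qed

text \<open>A simplex is terminal in its own star (for the order opposite to inclusion), so the colimit
  defining the costalk at \<open>\<sigma>\<close> is \<open>F(\<sigma>)\<close>.\<close>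

definition costalk_value :: "'v set \<Rightarrow> ('v set \<Rightarrow> 'a) set \<Rightarrow> 'a" where
  "costalk_value \<sigma> = colim_desc (star K \<sigma>) (grp F \<sigma>) (\<lambda>\<tau>. arr F \<tau> \<sigma>)"

context
  fixes \<sigma> assumes \<sigma>: "\<sigma> \<in> K"
begin

lemma costalk_value_hom: "costalk_value \<sigma> \<in> hom (grp FF (star K \<sigma>)) (grp F \<sigma>)"
  and costalk_value_inj: "\<tau> \<in> star K \<sigma> \<Longrightarrow> x \<in> carrier (grp F \<tau>) \<Longrightarrow>
    costalk_value \<sigma> (cinj (star K \<sigma>) \<tau> x) = arr F \<tau> \<sigma> x"
proof -
  interpret S: ab_diagram "star K \<sigma>" "(\<supseteq>)" F by (rule restrict_diagram[OF star_subset])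
  have 1: "arr F \<tau> \<sigma> \<in> hom (grp F \<tau>) (grp F \<sigma>)" if "\<tau> \<in> star K \<sigma>" for \<tau>
    using that \<sigma> by (intro F.arr_hom) (auto simp: star_def)
  have 2: "arr F \<tau> \<sigma> (arr F \<rho> \<tau> x) = arr F \<rho> \<sigma> x"
    if "\<rho> \<in> star K \<sigma>" "\<tau> \<in> star K \<sigma>" "\<rho> \<supseteq> \<tau>" "x \<in> carrier (grp F \<rho>)" for \<rho> \<tau> x
    using that \<sigma> by (intro F.arr_comp) (auto simp: star_def)
  show "costalk_value \<sigma> \<in> hom (grp FF (star K \<sigma>)) (grp F \<sigma>)"
    unfolding costalk_value_def grp_FF by (rule S.colim_desc_hom[OF F.comm_group_grp[OF \<sigma>] 1 2])
  show "\<tau> \<in> star K \<sigma> \<Longrightarrow> x \<in> carrier (grp F \<tau>) \<Longrightarrow>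
      costalk_value \<sigma> (cinj (star K \<sigma>) \<tau> x) = arr F \<tau> \<sigma> x"
    unfolding costalk_value_def by (rule S.colim_desc_inj[OF F.comm_group_grp[OF \<sigma>] 1 2])
qed

lemma costalk_value_inverse:
  assumes a: "a \<in> carrier (grp FF (star K \<sigma>))"
  shows "cinj (star K \<sigma>) \<sigma> (costalk_value \<sigma> a) = a"
proof -
  interpret S: ab_diagram "star K \<sigma>" "(\<supseteq>)" F by (rule restrict_diagram[OF star_subset])
  note self = self_in_star[OF \<sigma>]
  have "(cinj (star K \<sigma>) \<sigma> \<circ> costalk_value \<sigma>) a = id a"
  proof (rule FF_hom_ext[OF star_subset _ hom_compose[OF costalk_value_hom cinj_hom[OF star_subset self]] _ _ a])
    show "group (grp FF (star K \<sigma>))" unfolding grp_FF by (rule S.colim.is_group)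
    show "id \<in> hom (grp FF (star K \<sigma>)) (grp FF (star K \<sigma>))" by (simp add: hom_def)
    fix \<tau> x assume *: "\<tau> \<in> star K \<sigma>" "x \<in> carrier (grp F \<tau>)"
    then have "\<sigma> \<subseteq> \<tau>" by (simp add: star_def)
    then show "(cinj (star K \<sigma>) \<sigma> \<circ> costalk_value \<sigma>) (cinj (star K \<sigma>) \<tau> x) = id (cinj (star K \<sigma>) \<tau> x)"
      using cinj_arr[OF star_subset *(1) self _ *(2)] costalk_value_inj[OF *] by simp
  qed
  then show ?thesis by simp
qed

lemma costalk_value_surj: "costalk_value \<sigma> ` carrier (grp FF (star K \<sigma>)) = carrier (grp F \<sigma>)"
proof (intro equalityI subsetI)
  fix x assume x: "x \<in> carrier (grp F \<sigma>)"
  have "x = costalk_value \<sigma> (cinj (star K \<sigma>) \<sigma> x)"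
    using costalk_value_inj[OF self_in_star[OF \<sigma>] x] F.arr_id[OF \<sigma> x] by simp
  then show "x \<in> costalk_value \<sigma> ` carrier (grp FF (star K \<sigma>))"
    using cinj_closed[OF star_subset self_in_star[OF \<sigma>] x] by blast
qed (use costalk_value_hom in \<open>auto simp: hom_def\<close>)

lemma costalk_value_eq_one:
  assumes a: "a \<in> carrier (grp FF (star K \<sigma>))"
  shows "costalk_value \<sigma> a = \<one>\<^bsub>grp F \<sigma>\<^esub> \<longleftrightarrow> a = \<one>\<^bsub>grp FF (star K \<sigma>)\<^esub>"
proof -
  interpret S: ab_diagram "star K \<sigma>" "(\<supseteq>)" F by (rule restrict_diagram[OF star_subset])
  have g: "group (grp FF (star K \<sigma>))" unfolding grp_FF by (rule S.colim.is_group)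
  show ?thesis
    using hom_one[OF costalk_value_hom g F.group_grp[OF \<sigma>]]
      hom_one[OF cinj_hom[OF star_subset self_in_star[OF \<sigma>]] F.group_grp[OF \<sigma>] g]
      costalk_value_inverse[OF a] by metis
qed

text \<open>Every element of the costalk at \<open>\<sigma>\<close> is the class of some
  \<open>x\<close> in \<open>F(\<sigma>)\<close>; pushed to the star of \<open>\<tau>\<close> it is
  still the class of \<open>x\<close> at \<open>\<sigma>\<close>, whose value at
  \<open>\<tau>\<close> is the structure map applied to \<open>x\<close>. The right side is
  \<open>costalk_value \<tau>\<close> written out.\<close>

lemma costalk_value_arr:
  assumes \<tau>: "\<tau> \<in> K" "\<tau> \<subseteq> \<sigma>" and a: "a \<in> carrier (grp FF (star K \<sigma>))"
  shows "arr F \<sigma> \<tau> (costalk_value \<sigma> a)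
    = colim_desc (star K \<tau>) (grp F \<tau>) (\<lambda>\<rho>. arr F \<rho> \<tau>) (arr FF (star K \<sigma>) (star K \<tau>) a)"
proof -
  interpret T: ab_diagram "star K \<tau>" "(\<supseteq>)" F by (rule restrict_diagram[OF star_subset])
  let ?x = "costalk_value \<sigma> a"
  have x: "?x \<in> carrier (grp F \<sigma>)" using costalk_value_hom a by (rule hom_in_carrier)
  have "arr FF (star K \<sigma>) (star K \<tau>) a = cinj (star K \<tau>) \<sigma> ?x"
    using arr_FF_inj[OF star_antimono[OF \<tau>(2)] star_subset self_in_star[OF \<sigma>] x]
      costalk_value_inverse[OF a] by simp
  moreover have "colim_desc (star K \<tau>) (grp F \<tau>) (\<lambda>\<rho>. arr F \<rho> \<tau>) (cinj (star K \<tau>) \<sigma> ?x) = arr F \<sigma> \<tau> ?x"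
  proof (rule T.colim_desc_inj[OF F.comm_group_grp[OF \<tau>(1)] _ _ _ x])
    show "arr F \<rho> \<tau> \<in> hom (grp F \<rho>) (grp F \<tau>)" if "\<rho> \<in> star K \<tau>" for \<rho>
      using that \<tau> by (intro F.arr_hom) (auto simp: star_def)
    show "arr F \<rho>' \<tau> (arr F \<rho> \<rho>' y) = arr F \<rho> \<tau> y"
      if "\<rho> \<in> star K \<tau>" "\<rho>' \<in> star K \<tau>" "\<rho>' \<subseteq> \<rho>" "y \<in> carrier (grp F \<rho>)" for \<rho> \<rho>' y
      using that \<tau> by (intro F.arr_comp) (auto simp: star_def)
    show "\<sigma> \<in> star K \<tau>" using \<sigma> \<tau> by (simp add: star_def)
  qed
  ultimately show ?thesis by simp
qed

end

lemma costalk_value_natural: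
  assumes "\<sigma> \<in> K" "\<tau> \<in> K" "\<tau> \<subseteq> \<sigma>" "a \<in> carrier (grp FF (star K \<sigma>))"
  shows "costalk_value \<tau> (arr FF (star K \<sigma>) (star K \<tau>) a) = arr F \<sigma> \<tau> (costalk_value \<sigma> a)"
  using costalk_value_arr[OF assms] by (simp add: costalk_value_def)

end

section \<open>Incidence numbers\<close>

text \<open>Distinct entries leave only one permutation that performs a given rearrangement, so the
  definite description in \<open>rearrangement_sign\<close> is met by any witness.\<close>

lemma rearrangement_sign_eqI:
  assumes xs: "distinct xs" and p: "p permutes {..<length xs}" "permute_list p xs = ys"
  shows "rearrangement_sign xs ys = sign p"
proof -
  have unique: "q = p" if q: "q permutes {..<length xs}" "permute_list q xs = ys" for q
  proof
    fix i show "q i = p i"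
    proof (cases "i < length xs")
      case True
      then have "xs ! q i = xs ! p i"
        using permute_list_nth[OF q(1) True] permute_list_nth[OF p(1) True] p q by simp
      moreover have "q i < length xs" "p i < length xs"
        using permutes_in_image[OF q(1), of i] permutes_in_image[OF p(1), of i] True by auto
      ultimately show ?thesis using xs nth_eq_iff_index_eq by blast
    next
      case False
      then show ?thesis using p q by (simp add: permutes_def)
    qed
  qed
  have "(THE p. p permutes {..<length xs} \<and> permute_list p xs = ys) = p"
    by (rule the_equality) (use p in simp, use unique in blast)
  then show ?thesis by (simp add: rearrangement_sign_def)
qed

lemma obtain_rearrangement:
  assumes "distinct xs" "distinct ys" "set xs = set ys"
  shows "\<exists>p. p permutes {..<length xs} \<and> permute_list p xs = ys \<and> rearrangement_sign xs ys = sign p"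
proof -
  have "mset ys = mset xs" using assms set_eq_iff_mset_eq_distinct by blast
  then obtain p where "p permutes {..<length xs}" "permute_list p xs = ys"
    by (rule mset_eq_permutation)
  then show ?thesis using rearrangement_sign_eqI[OF assms(1)] by (intro exI[of _ p]) simp
qed

lemma rearrangement_sign_trans:
  assumes "distinct xs" "distinct ys" "distinct zs" "set xs = set ys" "set ys = set zs"
  shows "rearrangement_sign xs zs = rearrangement_sign xs ys * rearrangement_sign ys zs"
proof -
  have len: "length ys = length xs"
    using assms by (metis distinct_card)
  obtain p where p: "p permutes {..<length xs}" "permute_list p xs = ys" "rearrangement_sign xs ys = sign p"
    using obtain_rearrangement[OF assms(1,2,4)] by (elim exE conjE)
  obtain q where q: "q permutes {..<length ys}" "permute_list q ys = zs" "rearrangement_sign ys zs = sign q"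
    using obtain_rearrangement[OF assms(2,3,5)] by (elim exE conjE)
  have "permute_list (p \<circ> q) xs = zs"
    using permute_list_compose[of q xs p] p q len by simp
  moreover have "p \<circ> q permutes {..<length xs}"
    using p q len permutes_compose by metis
  ultimately have "rearrangement_sign xs zs = sign (p \<circ> q)"
    using rearrangement_sign_eqI[OF assms(1)] by blast
  also have "\<dots> = sign p * sign q"
    using p(1) q(1) by (intro sign_compose) (auto intro: permutes_imp_permutation[rotated])
  finally show ?thesis using p q by simp
qed

lemma rearrangement_sign_self: "distinct xs \<Longrightarrow> rearrangement_sign xs xs = 1"
  using rearrangement_sign_eqI[of xs id xs] by (simp add: permutes_id)

lemma rearrangement_sign_cases:
  assumes "distinct xs" "distinct ys" "set xs = set ys"
  shows "rearrangement_sign xs ys = 1 \<or> rearrangement_sign xs ys = -1"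
proof -
  obtain p :: "nat \<Rightarrow> nat" where "rearrangement_sign xs ys = sign p"
    using obtain_rearrangement[OF assms] by blast
  then show ?thesis by (simp add: sign_def)
qed

lemma rearrangement_sign_commute:
  assumes "distinct xs" "distinct ys" "set xs = set ys"
  shows "rearrangement_sign ys xs = rearrangement_sign xs ys"
proof -
  have "rearrangement_sign xs ys * rearrangement_sign ys xs = 1"
    using rearrangement_sign_trans[OF assms(1,2,1,3) assms(3)[symmetric]]
      rearrangement_sign_self[OF assms(1)] by simp
  then show ?thesis using rearrangement_sign_cases[OF assms] by auto
qed

text \<open>The permutation that rearranges \<open>xs\<close> fixes the new last index, so it
  rearranges the longer list too.\<close>

lemma rearrangement_sign_snoc:
  assumes "distinct (xs @ [w])" "distinct ys" "set xs = set ys"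
  shows "rearrangement_sign (xs @ [w]) (ys @ [w]) = rearrangement_sign xs ys"
proof -
  obtain p where p: "p permutes {..<length xs}" "permute_list p xs = ys" "rearrangement_sign xs ys = sign p"
    using obtain_rearrangement[OF distinct_append[THEN iffD1, OF assms(1), THEN conjunct1] assms(2,3)]
    by (elim exE conjE)
  have p': "p permutes {..<length (xs @ [w])}"
    by (rule permutes_subset[OF p(1)]) auto
  have "permute_list p (xs @ [w]) = ys @ [w]"
  proof (rule nth_equalityI)
    have len: "length ys = length xs" using p(2) by auto
    then show "length (permute_list p (xs @ [w])) = length (ys @ [w])" by simp
    fix i assume "i < length (permute_list p (xs @ [w]))"
    then have i: "i < length (xs @ [w])" by simp
    show "permute_list p (xs @ [w]) ! i = (ys @ [w]) ! i"
    proof (cases "i < length xs")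
      case True
      then have "p i < length xs" using permutes_in_image[OF p(1), of i] by simp
      then show ?thesis
        using permute_list_nth[OF p' i] permute_list_nth[OF p(1) True] p(2) len True
        by (simp add: nth_append)
    next
      case False
      then have "p i = i" using permutes_not_in[OF p(1)] by simp
      then show ?thesis
        using permute_list_nth[OF p' i] len False i by (simp add: nth_append)
    qed
  qed
  from rearrangement_sign_eqI[OF assms(1) p' this] p show ?thesis by simp
qed

lemma rearrangement_sign_swap:
  assumes "distinct (xs @ a # b # ys)"
  shows "rearrangement_sign (xs @ a # b # ys) (xs @ b # a # ys) = -1"
proof -
  let ?n = "length xs" and ?L = "xs @ a # b # ys"
  let ?p = "transpose ?n (Suc ?n)"
  have p: "?p permutes {..<length ?L}" by (rule permutes_swap_id) auto
  have "permute_list ?p ?L = xs @ b # a # ys"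
  proof (rule nth_equalityI)
    fix i assume "i < length (permute_list ?p ?L)"
    then have i: "i < length ?L" by simp
    consider "i < ?n" | "i = ?n" | "i = Suc ?n" | k where "i = ?n + Suc (Suc k)"
      by (metis add.commute add_Suc_right less_imp_Suc_add linorder_neqE_nat not_less_eq)
    then show "permute_list ?p ?L ! i = (xs @ b # a # ys) ! i"
      unfolding permute_list_nth[OF p i]
      using i by cases (auto simp: nth_append transpose_def)
  qed simp
  with p have "rearrangement_sign ?L (xs @ b # a # ys) = sign ?p"
    using rearrangement_sign_eqI[OF assms] by blast
  then show ?thesis by (simp add: sign_swap_id)
qed

text \<open>Moving \<open>w\<close> past the entries of \<open>ys\<close> takes one adjacent
  transposition for each of them.\<close>

lemma rearrangement_sign_move_last:
  "distinct (xs @ w # ys) \<Longrightarrow> rearrangement_sign (xs @ w # ys) (xs @ ys @ [w]) = (-1) ^ length ys"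
proof (induction ys arbitrary: xs)
  case Nil
  then show ?case by (simp add: rearrangement_sign_self)
next
  case (Cons b ys)
  have "rearrangement_sign (xs @ w # b # ys) (xs @ (b # ys) @ [w])
      = rearrangement_sign (xs @ w # b # ys) (xs @ b # w # ys)
        * rearrangement_sign (xs @ b # w # ys) (xs @ (b # ys) @ [w])"
    using Cons.prems by (intro rearrangement_sign_trans) auto
  also have "rearrangement_sign (xs @ w # b # ys) (xs @ b # w # ys) = -1"
    using Cons.prems by (rule rearrangement_sign_swap)
  also have "rearrangement_sign (xs @ b # w # ys) (xs @ (b # ys) @ [w]) = (-1) ^ length ys"
    using Cons.IH[of "xs @ [b]"] Cons.prems by auto
  finally show ?case by simp
qed

lemma rearrangement_sign_remove:
  assumes "distinct (as @ w # bs)" "distinct (cs @ w # ds)" "set (as @ w # bs) = set (cs @ w # ds)"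
  shows "rearrangement_sign (as @ w # bs) (cs @ w # ds)
    = (-1) ^ (length as + length cs) * rearrangement_sign (as @ bs) (cs @ ds)"
proof -
  have set: "set (as @ bs) = set (cs @ ds)"
    using assms by auto
  have "length (as @ w # bs) = length (cs @ w # ds)"
    using assms by (metis distinct_card)
  then have len: "length as + length bs = length cs + length ds" by simp
  have "rearrangement_sign (as @ w # bs) (cs @ w # ds)
      = rearrangement_sign (as @ w # bs) (as @ bs @ [w]) * rearrangement_sign (as @ bs @ [w]) (cs @ w # ds)"
    using assms by (intro rearrangement_sign_trans) auto
  also have "rearrangement_sign (as @ bs @ [w]) (cs @ w # ds)
      = rearrangement_sign (as @ bs @ [w]) (cs @ ds @ [w]) * rearrangement_sign (cs @ ds @ [w]) (cs @ w # ds)"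
    using assms set by (intro rearrangement_sign_trans) auto
  also have "rearrangement_sign (cs @ ds @ [w]) (cs @ w # ds) = (-1) ^ length ds"
    using rearrangement_sign_commute[of "cs @ w # ds" "cs @ ds @ [w]"] rearrangement_sign_move_last[OF assms(2)]
      assms by auto
  also have "rearrangement_sign (as @ w # bs) (as @ bs @ [w]) = (-1) ^ length bs"
    by (rule rearrangement_sign_move_last[OF assms(1)])
  also have "rearrangement_sign (as @ bs @ [w]) (cs @ ds @ [w]) = rearrangement_sign (as @ bs) (cs @ ds)"
    using rearrangement_sign_snoc[of "as @ bs" w "cs @ ds"] assms set by auto
  finally have "rearrangement_sign (as @ w # bs) (cs @ w # ds)
      = (-1) ^ (length bs + length ds) * rearrangement_sign (as @ bs) (cs @ ds)"
    by (simp add: power_add)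
  \<comment> \<open>Moving \<open>w\<close> to the end counts the entries behind it; the claim
    counts those in front. The lists have equal length, so the parities agree.\<close>
  moreover have "even (length bs + length ds) = even (length as + length cs)"
    using len by presburger
  then have "(-1 :: int) ^ (length bs + length ds) = (-1) ^ (length as + length cs)"
    by (simp add: minus_one_power_iff)
  ultimately show ?thesis by simp
qed

text \<open>Closure under all subsets includes the empty one: a nonempty \<open>C\<close> is a
  complex with the empty simplex adjoined.\<close>

locale oriented_complex =
  fixes C :: "'v set set" and \<omega> :: "'v set \<Rightarrow> 'v list"
  assumes finite_cell: "\<sigma> \<in> C \<Longrightarrow> finite \<sigma>"
    and face_closed: "\<sigma> \<in> C \<Longrightarrow> \<tau> \<subseteq> \<sigma> \<Longrightarrow> \<tau> \<in> C"
    and oriented: "orientation C \<omega>"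
begin

lemma distinct_ordering: "\<sigma> \<in> C \<Longrightarrow> distinct (\<omega> \<sigma>)" and set_ordering: "\<sigma> \<in> C \<Longrightarrow> set (\<omega> \<sigma>) = \<sigma>"
  using oriented by (auto simp: orientation_def)

lemma incidence_split:
  assumes \<sigma>: "\<sigma> \<in> C" and L: "\<omega> \<sigma> = as @ v # bs"
  shows "incidence \<omega> \<sigma> (\<sigma> - {v}) = (-1) ^ length as * rearrangement_sign (as @ bs) (\<omega> (\<sigma> - {v}))"
proof -
  have d: "distinct (as @ v # bs)" and s: "set (as @ v # bs) = \<sigma>"
    using distinct_ordering[OF \<sigma>] set_ordering[OF \<sigma>] L by auto
  have v: "v \<in> \<sigma>" using s by auto
  have "card \<sigma> = Suc (card (\<sigma> - {v}))"
    using v finite_cell[OF \<sigma>] by (metis card_Suc_Diff1)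
  moreover have "takeWhile (\<lambda>u. u \<in> \<sigma> - {v}) (\<omega> \<sigma>) = as"
    unfolding L using d s by (subst takeWhile_append2) auto
  moreover have "filter (\<lambda>u. u \<in> \<sigma> - {v}) as = as" "filter (\<lambda>u. u \<in> \<sigma> - {v}) bs = bs"
    by (rule filter_True; use d s in auto)+
  then have "filter (\<lambda>u. u \<in> \<sigma> - {v}) (\<omega> \<sigma>) = as @ bs"
    unfolding L by simp
  ultimately show ?thesis by (auto simp: incidence_def)
qed

lemma split_ordering:
  assumes "\<sigma> \<in> C" "v \<in> \<sigma>"
  obtains as bs where "\<omega> \<sigma> = as @ v # bs"
  using assms set_ordering[OF assms(1)] by (metis split_list)

lemma incidence_cases:
  assumes \<sigma>: "\<sigma> \<in> C" and v: "v \<in> \<sigma>"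
  shows "incidence \<omega> \<sigma> (\<sigma> - {v}) = 1 \<or> incidence \<omega> \<sigma> (\<sigma> - {v}) = -1"
proof -
  obtain as bs where L: "\<omega> \<sigma> = as @ v # bs" using split_ordering[OF assms] .
  have d: "distinct (as @ v # bs)" and s: "set (as @ v # bs) = \<sigma>"
    using distinct_ordering[OF \<sigma>] set_ordering[OF \<sigma>] L by auto
  have \<tau>: "\<sigma> - {v} \<in> C" using face_closed[OF \<sigma>] by blast
  have "rearrangement_sign (as @ bs) (\<omega> (\<sigma> - {v})) = 1 \<or> rearrangement_sign (as @ bs) (\<omega> (\<sigma> - {v})) = -1"
    using d s distinct_ordering[OF \<tau>] set_ordering[OF \<tau>] by (intro rearrangement_sign_cases) auto
  then show ?thesis
    unfolding incidence_split[OF \<sigma> L] by (auto simp: minus_one_power_iff)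
qed

lemma incidence_square:
  assumes "\<sigma> \<in> C" "v \<in> \<sigma>"
  shows "incidence \<omega> \<sigma> (\<sigma> - {v}) * incidence \<omega> \<sigma> (\<sigma> - {v}) = 1"
  using incidence_cases[OF assms] by auto

text \<open>The ordering chosen for the intermediate face \<open>\<sigma> - {v}\<close> enters both
  incidence numbers and cancels. What is left are the two positions of deletion and the sign
  relative to the ordering of the final face, so the two ways of deleting \<open>v\<close> and
  \<open>w\<close> become comparable.\<close>

lemma incidence_two_step:
  assumes \<sigma>: "\<sigma> \<in> C" and L: "\<omega> \<sigma> = as @ v # bs" and L': "as @ bs = cs @ w # ds"
  shows "incidence \<omega> \<sigma> (\<sigma> - {v}) * incidence \<omega> (\<sigma> - {v}) (\<sigma> - {v} - {w})
    = (-1) ^ (length as + length cs) * rearrangement_sign (cs @ ds) (\<omega> (\<sigma> - {v} - {w}))"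
proof -
  have d: "distinct (as @ v # bs)" and s: "set (as @ v # bs) = \<sigma>"
    using distinct_ordering[OF \<sigma>] set_ordering[OF \<sigma>] L by auto
  have \<tau>: "\<sigma> - {v} \<in> C" and \<rho>: "\<sigma> - {v} - {w} \<in> C" by (rule face_closed[OF \<sigma>]; blast)+
  have s\<tau>: "set (cs @ w # ds) = \<sigma> - {v}" and d\<tau>: "distinct (cs @ w # ds)"
    unfolding L'[symmetric] using d s by auto
  then have "w \<in> \<sigma> - {v}" by auto
  then obtain es fs where M: "\<omega> (\<sigma> - {v}) = es @ w # fs"
    using split_ordering[OF \<tau>] by blast
  have dM: "distinct (es @ w # fs)" and sM: "set (es @ w # fs) = \<sigma> - {v}"
    using distinct_ordering[OF \<tau>] set_ordering[OF \<tau>] M by auto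
  let ?\<rho> = "\<sigma> - {v} - {w}"
  have 1: "rearrangement_sign (as @ bs) (\<omega> (\<sigma> - {v}))
      = (-1) ^ (length cs + length es) * rearrangement_sign (cs @ ds) (es @ fs)"
    unfolding L' M by (rule rearrangement_sign_remove[OF d\<tau> dM]) (use s\<tau> sM in simp)
  have "set (cs @ ds) = ?\<rho>" "set (es @ fs) = ?\<rho>"
    using d\<tau> dM s\<tau> sM by auto
  then have 2: "rearrangement_sign (cs @ ds) (\<omega> ?\<rho>)
      = rearrangement_sign (cs @ ds) (es @ fs) * rearrangement_sign (es @ fs) (\<omega> ?\<rho>)"
    using d\<tau> dM distinct_ordering[OF \<rho>] set_ordering[OF \<rho>]
    by (intro rearrangement_sign_trans) simp_all
  have 3: "(-1 :: int) ^ (length cs + length es) * (-1) ^ length es = (-1) ^ length cs"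
    by (simp add: minus_one_power_iff)
  have "incidence \<omega> \<sigma> (\<sigma> - {v}) * incidence \<omega> (\<sigma> - {v}) ?\<rho>
      = (-1) ^ length as * ((-1) ^ (length cs + length es) * (-1) ^ length es)
        * (rearrangement_sign (cs @ ds) (es @ fs) * rearrangement_sign (es @ fs) (\<omega> ?\<rho>))"
    unfolding incidence_split[OF \<sigma> L] incidence_split[OF \<tau> M] 1 by (simp only: ac_simps)
  then show ?thesis unfolding 2 3 by (simp only: power_add)
qed

text \<open>
  Deleting \<open>v\<close> and then \<open>w\<close> from an ordering of \<open>\<sigma>\<close> in which \<open>v\<close> comes first shifts the position of
  \<open>w\<close> by one, whereas deleting \<open>w\<close> first leaves the position of \<open>v\<close> unchanged.
\<close>

lemma incidence_cancel:
  assumes \<sigma>: "\<sigma> \<in> C" and v: "v \<in> \<sigma>" and w: "w \<in> \<sigma>" and vw: "v \<noteq> w"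
  shows "incidence \<omega> \<sigma> (\<sigma> - {v}) * incidence \<omega> (\<sigma> - {v}) (\<sigma> - {v, w})
    + incidence \<omega> \<sigma> (\<sigma> - {w}) * incidence \<omega> (\<sigma> - {w}) (\<sigma> - {v, w}) = 0"
proof -
  \<comment> \<open>The claim is symmetric in \<open>v\<close> and \<open>w\<close>, so it is enough
    to treat the case where \<open>v\<close> precedes \<open>w\<close> in the ordering of
    \<open>\<sigma>\<close>.\<close>
  have *: "incidence \<omega> \<sigma> (\<sigma> - {v}) * incidence \<omega> (\<sigma> - {v}) (\<sigma> - {v, w})
      + incidence \<omega> \<sigma> (\<sigma> - {w}) * incidence \<omega> (\<sigma> - {w}) (\<sigma> - {v, w}) = 0"
    if L: "\<omega> \<sigma> = as @ v # bs @ w # cs" for v w as bs cs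
  proof -
    have "\<sigma> - {v} - {w} = \<sigma> - {v, w}" "\<sigma> - {w} - {v} = \<sigma> - {v, w}" by auto
    then show ?thesis
      using incidence_two_step[OF \<sigma>, of as v "bs @ w # cs" "as @ bs" w cs]
        incidence_two_step[OF \<sigma>, of "as @ v # bs" w cs as v "bs @ cs"] L
      by (simp add: power_add)
  qed
  obtain as bs where L: "\<omega> \<sigma> = as @ v # bs" using split_ordering[OF \<sigma> v] .
  have "w \<in> set as \<or> w \<in> set bs" using w vw set_ordering[OF \<sigma>] L by auto
  then show ?thesis
  proof
    assume "w \<in> set bs"
    then obtain cs ds where "bs = cs @ w # ds" by (meson split_list)
    with * L show ?thesis by simp
  next
    assume "w \<in> set as"
    then obtain cs ds where "as = cs @ w # ds" by (meson split_list)
    with *[of cs w ds v bs] L show ?thesis by (simp add: insert_commute add.commute)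
  qed
qed

end

section \<open>Chains indexed by the number of vertices\<close>

definition cells :: "'v set set \<Rightarrow> nat \<Rightarrow> 'v set set" where
  "cells C p = {\<sigma>\<in>C. card \<sigma> = p}"

definition cell_chains :: "'v set set \<Rightarrow> ('v set, 'a) diagram \<Rightarrow> nat \<Rightarrow> ('v set \<Rightarrow> 'a) monoid" where
  "cell_chains C M p = sum_group (cells C p) (grp M)"

text \<open>The formula of \<open>bm_boundary\<close> with degrees counted by vertices, so that the
  map from vertices to the empty simplex is included.\<close>

definition bd ::
  "'v set set \<Rightarrow> ('v set \<Rightarrow> 'v list) \<Rightarrow> ('v set, 'a) diagram \<Rightarrow> nat \<Rightarrow> ('v set \<Rightarrow> 'a) \<Rightarrow> 'v set \<Rightarrow> 'a" where
  "bd C \<omega> M p c = (\<lambda>\<tau>\<in>cells C p. gfinprod (grp M \<tau>)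
      (\<lambda>\<sigma>. arr M \<sigma> \<tau> (c \<sigma>) [^]\<^bsub>grp M \<tau>\<^esub> incidence \<omega> \<sigma> \<tau>) {\<sigma> \<in> cells C (Suc p). \<tau> \<subseteq> \<sigma>})"

text \<open>One matrix entry of the boundary. It is extended trivially to pairs that are not faces,
  so that \<open>bd\<close> becomes a \<open>sum_matrix\<close> over all cells.\<close>

definition face_map ::
  "('v set \<Rightarrow> 'v list) \<Rightarrow> ('v set, 'a) diagram \<Rightarrow> 'v set \<Rightarrow> 'v set \<Rightarrow> 'a \<Rightarrow> 'a" where
  "face_map \<omega> M \<sigma> \<tau> x =
     (if \<tau> \<subseteq> \<sigma> then arr M \<sigma> \<tau> x [^]\<^bsub>grp M \<tau>\<^esub> incidence \<omega> \<sigma> \<tau> else \<one>\<^bsub>grp M \<tau>\<^esub>)"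

locale cellular_chains = oriented_complex C \<omega> + ab_diagram C "(\<supseteq>)" M
  for C :: "'v set set" and \<omega> and M :: "('v set, 'a) diagram"
begin

lemma cells_mem: "\<sigma> \<in> cells C p \<Longrightarrow> \<sigma> \<in> C" by (simp add: cells_def)

lemma comm_group_chains: "comm_group (cell_chains C M p)"
  unfolding cell_chains_def by (rule comm_group_sum_group) (auto intro: comm_group_grp cells_mem)

lemma group_chains: "group (cell_chains C M p)"
  using comm_group_chains comm_group.axioms(2) by blast

lemma chains_closed: "c \<in> carrier (cell_chains C M p) \<Longrightarrow> \<sigma> \<in> cells C p \<Longrightarrow> c \<sigma> \<in> carrier (grp M \<sigma>)"
  unfolding cell_chains_def by (subst (asm) carrier_sum_group) (auto intro: group_grp cells_mem)

lemma face_map_hom: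
  assumes "\<sigma> \<in> C" "\<tau> \<in> C"
  shows "face_map \<omega> M \<sigma> \<tau> \<in> hom (grp M \<sigma>) (grp M \<tau>)"
proof -
  interpret T: comm_group "grp M \<tau>" using comm_group_grp[OF assms(2)] .
  show ?thesis
    using assms arr_closed hom_mult[OF arr_hom]
    by (auto simp: face_map_def hom_def T.int_pow_distrib)
qed

lemma finite_faces: "\<sigma> \<in> C \<Longrightarrow> finite {\<tau>. \<tau> \<subseteq> \<sigma>}"
  using finite_cell by simp

lemma bd_matrix:
  assumes "c \<in> carrier (cell_chains C M (Suc p))"
  shows "bd C \<omega> M p c = sum_matrix (cells C (Suc p)) (cells C p) (grp M) (face_map \<omega> M) c"
  unfolding bd_def sum_matrix_def
proof (rule restrict_ext)
  fix \<tau> assume \<tau>: "\<tau> \<in> cells C p"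
  interpret T: comm_group "grp M \<tau>" using comm_group_grp[OF cells_mem[OF \<tau>]] .
  show "gfinprod (grp M \<tau>) (\<lambda>\<sigma>. arr M \<sigma> \<tau> (c \<sigma>) [^]\<^bsub>grp M \<tau>\<^esub> incidence \<omega> \<sigma> \<tau>) {\<sigma> \<in> cells C (Suc p). \<tau> \<subseteq> \<sigma>}
      = gfinprod (grp M \<tau>) (\<lambda>\<sigma>. face_map \<omega> M \<sigma> \<tau> (c \<sigma>)) (cells C (Suc p))"
  proof (rule T.gfinprod_mono_neutral_cong_left)
    show "(\<lambda>\<sigma>. face_map \<omega> M \<sigma> \<tau> (c \<sigma>)) \<in> cells C (Suc p) \<rightarrow> carrier (grp M \<tau>)"
      using face_map_hom[THEN hom_in_carrier] chains_closed[OF assms] cells_mem \<tau> by blast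
  qed (auto simp: face_map_def)
qed

text \<open>A simplex has finitely many faces, which is the finiteness that
  \<open>sum_matrix_hom\<close> asks for.\<close>

lemma bd_hom: "bd C \<omega> M p \<in> hom (cell_chains C M (Suc p)) (cell_chains C M p)"
proof -
  let ?m = "sum_matrix (cells C (Suc p)) (cells C p) (grp M) (face_map \<omega> M)"
  have m: "?m \<in> hom (cell_chains C M (Suc p)) (cell_chains C M p)"
    unfolding cell_chains_def
  proof (rule sum_matrix_hom)
    fix \<sigma> assume "\<sigma> \<in> cells C (Suc p)"
    then have "finite {\<tau>. \<tau> \<subseteq> \<sigma>}" by (intro finite_faces cells_mem)
    then show "finite {\<tau> \<in> cells C p. \<exists>x\<in>carrier (grp M \<sigma>). face_map \<omega> M \<sigma> \<tau> x \<noteq> \<one>\<^bsub>grp M \<tau>\<^esub>}"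
      by (rule rev_finite_subset) (auto simp: face_map_def split: if_splits)
  qed (auto intro: group_grp comm_group_grp face_map_hom cells_mem)
  show ?thesis
    using m group.is_monoid[OF group_chains, THEN monoid.m_closed]
    by (simp add: hom_def Pi_iff bd_matrix)
qed

lemma bd_closed: "c \<in> carrier (cell_chains C M (Suc p)) \<Longrightarrow> bd C \<omega> M p c \<in> carrier (cell_chains C M p)"
  using bd_hom hom_in_carrier by fast

lemma sum_inj_chains:
  "\<sigma> \<in> cells C p \<Longrightarrow> x \<in> carrier (grp M \<sigma>) \<Longrightarrow> sum_inj (cells C p) (grp M) \<sigma> x \<in> carrier (cell_chains C M p)"
  unfolding cell_chains_def by (rule sum_inj_closed) (auto intro: group_grp cells_mem)

lemma bd_sum_inj:
  assumes "\<sigma> \<in> cells C (Suc p)" "x \<in> carrier (grp M \<sigma>)"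
  shows "bd C \<omega> M p (sum_inj (cells C (Suc p)) (grp M) \<sigma> x) = (\<lambda>\<tau>\<in>cells C p. face_map \<omega> M \<sigma> \<tau> x)"
  unfolding bd_matrix[OF sum_inj_chains[OF assms]]
  by (rule sum_matrix_inj) (use assms in \<open>auto intro: group_grp comm_group_grp face_map_hom cells_mem\<close>)

lemma face_map_face_map:
  assumes \<sigma>: "\<sigma> \<in> C" and \<tau>: "\<rho> \<subseteq> \<tau>" "\<tau> \<subseteq> \<sigma>" and x: "x \<in> carrier (grp M \<sigma>)"
  shows "face_map \<omega> M \<tau> \<rho> (face_map \<omega> M \<sigma> \<tau> x)
    = arr M \<sigma> \<rho> x [^]\<^bsub>grp M \<rho>\<^esub> (incidence \<omega> \<sigma> \<tau> * incidence \<omega> \<tau> \<rho>)"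
proof -
  have \<tau>C: "\<tau> \<in> C" and \<rho>C: "\<rho> \<in> C" using \<sigma> \<tau> face_closed by blast+
  interpret T: group "grp M \<tau>" using group_grp[OF \<tau>C] .
  interpret R: group "grp M \<rho>" using group_grp[OF \<rho>C] .
  have "arr M \<tau> \<rho> (arr M \<sigma> \<tau> x [^]\<^bsub>grp M \<tau>\<^esub> k) = arr M \<sigma> \<rho> x [^]\<^bsub>grp M \<rho>\<^esub> k" for k :: int
    using hom_int_pow[OF arr_hom[OF \<tau>C \<rho>C \<tau>(1)] arr_closed[OF \<sigma> \<tau>C \<tau>(2) x] T.is_group R.is_group]
      arr_comp[OF \<sigma> \<tau>C \<rho>C \<tau>(2,1) x] by simp
  then show ?thesis
    using \<tau> arr_closed[OF \<sigma> \<rho>C _ x] by (simp add: face_map_def R.int_pow_pow)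
qed

text \<open>For a chain on one simplex \<open>\<sigma>\<close> and a face \<open>\<rho>\<close> with
  two vertices fewer, exactly two simplices lie strictly between them. Both contribute a power of
  the same element, and the exponents add up to 0 by \<open>incidence_cancel\<close>.\<close>

lemma bd_bd:
  assumes "c \<in> carrier (cell_chains C M (Suc (Suc p)))"
  shows "bd C \<omega> M p (bd C \<omega> M (Suc p) c) = \<one>\<^bsub>cell_chains C M p\<^esub>"
proof -
  \<comment> \<open>The trivial homomorphism, so that the claim becomes an equality of two
    homomorphisms.\<close>
  let ?one = "\<lambda>c :: 'v set \<Rightarrow> 'a. \<one>\<^bsub>cell_chains C M p\<^esub>"
  interpret CP: group "cell_chains C M p" by (rule group_chains)
  have "(bd C \<omega> M p \<circ> bd C \<omega> M (Suc p)) c = ?one c"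
  proof (rule sum_group_hom_ext[OF _ group_chains[of p] _ _ _ assms[unfolded cell_chains_def]])
    show "bd C \<omega> M p \<circ> bd C \<omega> M (Suc p) \<in> hom (sum_group (cells C (Suc (Suc p))) (grp M)) (cell_chains C M p)"
      using hom_compose[OF bd_hom bd_hom] unfolding cell_chains_def by blast
    show "?one \<in> hom (sum_group (cells C (Suc (Suc p))) (grp M)) (cell_chains C M p)"
      by (simp add: hom_def)
    fix \<sigma> x assume \<sigma>: "\<sigma> \<in> cells C (Suc (Suc p))" and x: "x \<in> carrier (grp M \<sigma>)"
    note \<sigma>C = cells_mem[OF \<sigma>]
    let ?b = "\<lambda>\<tau>\<in>cells C (Suc p). face_map \<omega> M \<sigma> \<tau> x"
    have b: "?b \<in> carrier (cell_chains C M (Suc p))"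
      using bd_closed[OF sum_inj_chains[OF \<sigma> x]] bd_sum_inj[OF \<sigma> x] by simp
    have "gfinprod (grp M \<rho>) (\<lambda>\<tau>. face_map \<omega> M \<tau> \<rho> (?b \<tau>)) (cells C (Suc p)) = \<one>\<^bsub>grp M \<rho>\<^esub>"
      if \<rho>: "\<rho> \<in> cells C p" for \<rho>
    proof -
      note \<rho>C = cells_mem[OF \<rho>]
      interpret R: comm_group "grp M \<rho>" using comm_group_grp[OF \<rho>C] .
      have mem: "face_map \<omega> M \<tau> \<rho> (?b \<tau>) \<in> carrier (grp M \<rho>)" if "\<tau> \<in> cells C (Suc p)" for \<tau>
        using chains_closed[OF b that] face_map_hom[OF cells_mem[OF that] \<rho>C] by (rule hom_in_carrier[rotated])
      have triv: "face_map \<omega> M \<tau> \<rho> (?b \<tau>) = \<one>\<^bsub>grp M \<rho>\<^esub>"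
        if "\<tau> \<in> cells C (Suc p)" "\<not> (\<rho> \<subseteq> \<tau> \<and> \<tau> \<subseteq> \<sigma>)" for \<tau>
        using that hom_one[OF face_map_hom[OF cells_mem[OF that(1)] \<rho>C] group_grp[OF cells_mem[OF that(1)]] R.is_group]
        by (auto simp: face_map_def)
      show ?thesis
      proof (cases "\<rho> \<subseteq> \<sigma>")
        case False
        then have "gfinprod (grp M \<rho>) (\<lambda>\<tau>. face_map \<omega> M \<tau> \<rho> (?b \<tau>)) (cells C (Suc p))
            = gfinprod (grp M \<rho>) (\<lambda>\<tau>. face_map \<omega> M \<tau> \<rho> (?b \<tau>)) {}"
          by (intro R.gfinprod_mono_neutral_cong_right triv Pi_I mem) (use False in auto)
        then show ?thesis by simp
      next
        case True
        have fin: "finite \<sigma>" using finite_cell[OF \<sigma>C] .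
        have "card (\<sigma> - \<rho>) = 2"
          using True \<sigma> \<rho> fin by (simp add: card_Diff_subset finite_subset cells_def)
        then obtain v w where vw: "\<sigma> - \<rho> = {v, w}" "v \<noteq> w" by (meson card_2_iff)
        then have vw': "v \<in> \<sigma>" "w \<in> \<sigma>" "v \<notin> \<rho>" "w \<notin> \<rho>" "\<rho> = \<sigma> - {v, w}" using True by auto
        have cellsvw: "\<sigma> - {u} \<in> cells C (Suc p)" if "u \<in> \<sigma>" for u
          using \<sigma> that face_closed[OF \<sigma>C] by (auto simp: cells_def)
        \<comment> \<open>An intermediate simplex omits one vertex of \<open>\<sigma>\<close>, and
          this vertex is one of the two missing from \<open>\<rho>\<close>.\<close>
        have between: "\<tau> = \<sigma> - {v} \<or> \<tau> = \<sigma> - {w}"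
          if "\<tau> \<in> cells C (Suc p)" "\<rho> \<subseteq> \<tau>" "\<tau> \<subseteq> \<sigma>" for \<tau>
        proof -
          have "card (\<sigma> - \<tau>) = 1"
            using that \<sigma> fin by (simp add: card_Diff_subset finite_subset cells_def)
          then obtain u where u: "\<sigma> - \<tau> = {u}" by (meson card_1_singletonE)
          then have "u \<in> \<sigma> - \<rho>" using that by auto
          then show ?thesis using u that(3) vw by auto
        qed
        let ?y = "arr M \<sigma> \<rho> x"
        have y: "?y \<in> carrier (grp M \<rho>)" using arr_closed[OF \<sigma>C \<rho>C True x] .
        have val: "face_map \<omega> M (\<sigma> - {u}) \<rho> (?b (\<sigma> - {u}))
            = ?y [^]\<^bsub>grp M \<rho>\<^esub> (incidence \<omega> \<sigma> (\<sigma> - {u}) * incidence \<omega> (\<sigma> - {u}) \<rho>)" if "u \<in> {v, w}" for u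
          using face_map_face_map[OF \<sigma>C _ _ x, of \<rho> "\<sigma> - {u}"] cellsvw vw' that by auto
        have "gfinprod (grp M \<rho>) (\<lambda>\<tau>. face_map \<omega> M \<tau> \<rho> (?b \<tau>)) (cells C (Suc p))
            = gfinprod (grp M \<rho>) (\<lambda>\<tau>. face_map \<omega> M \<tau> \<rho> (?b \<tau>)) {\<sigma> - {v}, \<sigma> - {w}}"
        proof (rule R.gfinprod_mono_neutral_cong_right)
          show "{\<sigma> - {v}, \<sigma> - {w}} \<subseteq> cells C (Suc p)" using cellsvw vw' by simp
          show "face_map \<omega> M \<tau> \<rho> (?b \<tau>) = \<one>\<^bsub>grp M \<rho>\<^esub>"
            if "\<tau> \<in> cells C (Suc p) - {\<sigma> - {v}, \<sigma> - {w}}" for \<tau>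
            using triv[of \<tau>] between[of \<tau>] that by blast
          show "(\<lambda>\<tau>. face_map \<omega> M \<tau> \<rho> (?b \<tau>)) \<in> cells C (Suc p) \<rightarrow> carrier (grp M \<rho>)"
            by (rule Pi_I) (rule mem)
        qed (rule refl)
        also have "\<dots> = finprod (grp M \<rho>) (\<lambda>\<tau>. face_map \<omega> M \<tau> \<rho> (?b \<tau>)) {\<sigma> - {v}, \<sigma> - {w}}"
        proof (rule R.gfinprod_eq_finprod[OF _ Pi_I])
          fix \<tau> assume "\<tau> \<in> {\<sigma> - {v}, \<sigma> - {w}}"
          then have "\<tau> \<in> cells C (Suc p)" using cellsvw vw'(1,2) by blast
          then show "face_map \<omega> M \<tau> \<rho> (?b \<tau>) \<in> carrier (grp M \<rho>)" by (rule mem)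
        qed simp
        also have "\<dots> = face_map \<omega> M (\<sigma> - {v}) \<rho> (?b (\<sigma> - {v})) \<otimes>\<^bsub>grp M \<rho>\<^esub> face_map \<omega> M (\<sigma> - {w}) \<rho> (?b (\<sigma> - {w}))"
        proof -
          have ne: "\<sigma> - {v} \<noteq> \<sigma> - {w}" using vw vw' by auto
          have m: "face_map \<omega> M (\<sigma> - {v}) \<rho> (?b (\<sigma> - {v})) \<in> carrier (grp M \<rho>)"
            "face_map \<omega> M (\<sigma> - {w}) \<rho> (?b (\<sigma> - {w})) \<in> carrier (grp M \<rho>)"
            by (rule mem[OF cellsvw], rule vw')+
          show ?thesis
            using ne m by (subst R.finprod_insert) (auto simp: R.finprod_singleton simp del: restrict_apply)
        qed
        also have "\<dots> = ?y [^]\<^bsub>grp M \<rho>\<^esub> (0 :: int)"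
          unfolding val[OF insertI1] val[OF insertI2[OF insertI1]] R.int_pow_mult[OF y, symmetric]
          using incidence_cancel[OF \<sigma>C vw'(1,2) vw(2)] by (simp only: vw'(5))
        finally show ?thesis by simp
      qed
    qed
    then have "bd C \<omega> M p ?b = \<one>\<^bsub>cell_chains C M p\<^esub>"
      unfolding bd_matrix[OF b] sum_matrix_def cell_chains_def one_sum_group by (auto intro: restrict_ext)
    then show "(bd C \<omega> M p \<circ> bd C \<omega> M (Suc p)) (sum_inj (cells C (Suc (Suc p))) (grp M) \<sigma> x)
        = \<one>\<^bsub>cell_chains C M p\<^esub>"
      using bd_sum_inj[OF \<sigma> x] by simp
  qed (auto intro: group_grp cells_mem)
  then show ?thesis by simp
qed

end

lemma bd_natural:
  assumes M: "cellular_chains C \<omega> M" and N: "cellular_chains C \<omega> N"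
    and \<eta>: "\<And>\<sigma>. \<sigma> \<in> C \<Longrightarrow> \<eta> \<sigma> \<in> hom (grp M \<sigma>) (grp N \<sigma>)"
    and nat: "\<And>\<sigma> \<tau> x. \<sigma> \<in> C \<Longrightarrow> \<tau> \<in> C \<Longrightarrow> \<tau> \<subseteq> \<sigma> \<Longrightarrow> x \<in> carrier (grp M \<sigma>) \<Longrightarrow>
      \<eta> \<tau> (arr M \<sigma> \<tau> x) = arr N \<sigma> \<tau> (\<eta> \<sigma> x)"
    and c: "c \<in> carrier (cell_chains C M (Suc p))"
  shows "bd C \<omega> N p (sum_map (cells C (Suc p)) \<eta> c) = sum_map (cells C p) \<eta> (bd C \<omega> M p c)"
proof -
  interpret M: cellular_chains C \<omega> M by fact
  interpret N: cellular_chains C \<omega> N by fact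
  have \<eta>_chains: "sum_map (cells C p) \<eta> \<in> hom (cell_chains C M p) (cell_chains C N p)" for p
    unfolding cell_chains_def by (rule sum_map_hom) (auto intro: M.group_grp N.group_grp \<eta> M.cells_mem)
  have "(bd C \<omega> N p \<circ> sum_map (cells C (Suc p)) \<eta>) c = (sum_map (cells C p) \<eta> \<circ> bd C \<omega> M p) c"
  proof (rule sum_group_hom_ext[OF _ N.group_chains[of p] _ _ _ c[unfolded cell_chains_def]])
    show "bd C \<omega> N p \<circ> sum_map (cells C (Suc p)) \<eta> \<in> hom (sum_group (cells C (Suc p)) (grp M)) (cell_chains C N p)"
      using hom_compose[OF \<eta>_chains N.bd_hom] unfolding cell_chains_def by blast
    show "sum_map (cells C p) \<eta> \<circ> bd C \<omega> M p \<in> hom (sum_group (cells C (Suc p)) (grp M)) (cell_chains C N p)"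
      using hom_compose[OF M.bd_hom \<eta>_chains] unfolding cell_chains_def by blast
    fix \<sigma> x assume \<sigma>: "\<sigma> \<in> cells C (Suc p)" and x: "x \<in> carrier (grp M \<sigma>)"
    note \<sigma>C = M.cells_mem[OF \<sigma>]
    have \<eta>x: "\<eta> \<sigma> x \<in> carrier (grp N \<sigma>)" using \<eta>[OF \<sigma>C] x by (rule hom_in_carrier)
    have "sum_map (cells C (Suc p)) \<eta> (sum_inj (cells C (Suc p)) (grp M) \<sigma> x)
        = sum_inj (cells C (Suc p)) (grp N) \<sigma> (\<eta> \<sigma> x)"
      using hom_one[OF \<eta> M.group_grp N.group_grp] M.cells_mem
      by (auto simp: sum_map_def sum_inj_def fun_eq_iff)
    moreover have "\<eta> \<tau> (face_map \<omega> M \<sigma> \<tau> x) = face_map \<omega> N \<sigma> \<tau> (\<eta> \<sigma> x)" if "\<tau> \<in> cells C p" for \<tau>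
    proof -
      note \<tau>C = M.cells_mem[OF that]
      show ?thesis
        using nat[OF \<sigma>C \<tau>C _ x] hom_one[OF \<eta>[OF \<tau>C] M.group_grp[OF \<tau>C] N.group_grp[OF \<tau>C]]
          hom_int_pow[OF \<eta>[OF \<tau>C] M.arr_closed[OF \<sigma>C \<tau>C _ x] M.group_grp[OF \<tau>C] N.group_grp[OF \<tau>C]]
        by (simp add: face_map_def)
    qed
    ultimately show "(bd C \<omega> N p \<circ> sum_map (cells C (Suc p)) \<eta>) (sum_inj (cells C (Suc p)) (grp M) \<sigma> x)
        = (sum_map (cells C p) \<eta> \<circ> bd C \<omega> M p) (sum_inj (cells C (Suc p)) (grp M) \<sigma> x)"
      using M.bd_sum_inj[OF \<sigma> x] N.bd_sum_inj[OF \<sigma> \<eta>x] by (auto simp: sum_map_def intro: restrict_ext)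
  qed (auto intro: M.group_grp M.cells_mem)
  then show ?thesis by simp
qed

section \<open>Acyclicity of projective cosheaves\<close>

lemma finprod_free_Abelian_group:
  "finite A \<Longrightarrow> (\<And>i. i \<in> A \<Longrightarrow> Poly_Mapping.keys (f i) \<subseteq> S) \<Longrightarrow> finprod (free_Abelian_group S) f A = sum f A"
proof (induction A rule: finite_induct)
  case empty
  then show ?case
    using comm_monoid.finprod_empty[of "free_Abelian_group S" f] abelian_free_Abelian_group[of S]
    by (simp add: comm_group_def)
next
  case (insert i A)
  interpret comm_group "free_Abelian_group S" by (rule abelian_free_Abelian_group)
  show ?case
    using insert by (subst finprod_insert) auto
qed

text \<open>Turns a product over possibly infinitely many cofaces into an integer sum, one
  coefficient at a time; for a fixed generator \<open>k\<close> a finite set \<open>J\<close> of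
  cofaces is enough.\<close>

lemma lookup_gfinprod_free:
  assumes keys: "\<And>i. i \<in> I \<Longrightarrow> Poly_Mapping.keys (f i) \<subseteq> S" and fin: "finite {i \<in> I. f i \<noteq> 0}"
    and J: "finite J" "J \<subseteq> I" "\<And>i. i \<in> I - J \<Longrightarrow> poly_mapping.lookup (f i) k = 0"
  shows "poly_mapping.lookup (gfinprod (free_Abelian_group S) f I) k = (\<Sum>i\<in>J. poly_mapping.lookup (f i) k)"
proof -
  have "gfinprod (free_Abelian_group S) f I = sum f {i \<in> I. f i \<noteq> 0}"
  proof -
    have "finprod (free_Abelian_group S) f {i \<in> I. f i \<noteq> 0} = sum f {i \<in> I. f i \<noteq> 0}"
      using fin keys by (intro finprod_free_Abelian_group) auto
    with fin show ?thesis by (simp add: gfinprod_def)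
  qed
  then have "poly_mapping.lookup (gfinprod (free_Abelian_group S) f I) k
      = (\<Sum>i\<in>{i \<in> I. f i \<noteq> 0}. poly_mapping.lookup (f i) k)"
    by (simp add: lookup_sum)
  also have "\<dots> = (\<Sum>i\<in>J. poly_mapping.lookup (f i) k)"
    using fin J by (intro sum.mono_neutral_cong) auto
  finally show ?thesis .
qed

text \<open>
  Since \<open>star K {} = K\<close>, the value at the empty simplex is the group of global cosections, and the
  boundary map from vertices to the empty simplex is the augmentation.
\<close>

definition star_diagram :: "'v set set \<Rightarrow> ('v set, 'a) precosheaf \<Rightarrow> ('v set, 'a) diagram" where
  "star_diagram K G =
     \<lparr>grp = (\<lambda>\<sigma>. grp G (star K \<sigma>)), arr = (\<lambda>\<sigma> \<tau>. arr G (star K \<sigma>) (star K \<tau>))\<rparr>"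

lemma star_diagram_functor:
  assumes "precosheaf (face_space K) G"
  shows "ab_functor C (\<supseteq>) (star_diagram K G)"
proof -
  interpret precosheaf_on "face_space K" G using assms by unfold_locales
  have op: "star K \<sigma> \<in> {U. openin (face_space K) U}" for \<sigma> by (simp add: openin_star)
  show ?thesis
    unfolding ab_functor_def star_diagram_def diagram.simps
  proof (intro conjI ballI impI)
    show "comm_group (grp G (star K \<sigma>))" for \<sigma> by (rule comm_group_grp[OF op])
    show "arr G (star K \<sigma>) (star K \<tau>) \<in> hom (grp G (star K \<sigma>)) (grp G (star K \<tau>))" if "\<tau> \<subseteq> \<sigma>" for \<sigma> \<tau>
      by (rule arr_hom[OF op op star_antimono[OF that]])
    show "arr G (star K \<sigma>) (star K \<sigma>) x = x" if "x \<in> carrier (grp G (star K \<sigma>))" for \<sigma> x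
      by (rule arr_id[OF op that])
    show "arr G (star K \<tau>) (star K \<rho>) (arr G (star K \<sigma>) (star K \<tau>) x) = arr G (star K \<sigma>) (star K \<rho>) x"
      if "\<tau> \<subseteq> \<sigma>" "\<rho> \<subseteq> \<tau>" "x \<in> carrier (grp G (star K \<sigma>))" for \<sigma> \<tau> \<rho> x
      by (rule arr_comp[OF op op op star_antimono[OF that(1)] star_antimono[OF that(2)] that(3)])
  qed
qed

text \<open>For \<open>p = 0\<close> the cycle condition is vacuous. Acyclicity thus includes that
  the vertices map onto the value at the empty simplex.\<close>

definition acyclic_chains ::
  "'v set set \<Rightarrow> ('v set \<Rightarrow> 'v list) \<Rightarrow> ('v set, 'a) diagram \<Rightarrow> bool" where
  "acyclic_chains C \<omega> M \<longleftrightarrow> (\<forall>p. \<forall>c\<in>carrier (cell_chains C M p).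
     (\<forall>q. p = Suc q \<longrightarrow> bd C \<omega> M q c = \<one>\<^bsub>cell_chains C M q\<^esub>) \<longrightarrow>
     (\<exists>b\<in>carrier (cell_chains C M (Suc p)). bd C \<omega> M p b = c))"

definition natural_map ::
  "'v set set \<Rightarrow> ('v set, 'a) diagram \<Rightarrow> ('v set, 'b) diagram \<Rightarrow> ('v set \<Rightarrow> 'a \<Rightarrow> 'b) \<Rightarrow> bool" where
  "natural_map C M N \<eta> \<longleftrightarrow> (\<forall>\<sigma>\<in>C. \<eta> \<sigma> \<in> hom (grp M \<sigma>) (grp N \<sigma>)) \<and>
     (\<forall>\<sigma>\<in>C. \<forall>\<tau>\<in>C. \<tau> \<subseteq> \<sigma> \<longrightarrow> (\<forall>x\<in>carrier (grp M \<sigma>). \<eta> \<tau> (arr M \<sigma> \<tau> x) = arr N \<sigma> \<tau> (\<eta> \<sigma> x)))"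

lemma natural_map_chains:
  assumes M: "cellular_chains C \<omega> M" and N: "cellular_chains C \<omega> N" and \<eta>: "natural_map C M N \<eta>"
  shows "sum_map (cells C p) \<eta> \<in> hom (cell_chains C M p) (cell_chains C N p)"
    and "c \<in> carrier (cell_chains C M (Suc p)) \<Longrightarrow>
      bd C \<omega> N p (sum_map (cells C (Suc p)) \<eta> c) = sum_map (cells C p) \<eta> (bd C \<omega> M p c)"
proof -
  interpret M: cellular_chains C \<omega> M by fact
  interpret N: cellular_chains C \<omega> N by fact
  show "sum_map (cells C p) \<eta> \<in> hom (cell_chains C M p) (cell_chains C N p)"
    unfolding cell_chains_def using \<eta>
    by (intro sum_map_hom) (auto intro: M.group_grp N.group_grp M.cells_mem simp: natural_map_def)
  show "c \<in> carrier (cell_chains C M (Suc p)) \<Longrightarrow>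
      bd C \<omega> N p (sum_map (cells C (Suc p)) \<eta> c) = sum_map (cells C p) \<eta> (bd C \<omega> M p c)"
    by (rule bd_natural[OF M N]) (use \<eta> in \<open>auto simp: natural_map_def\<close>)
qed

text \<open>A cycle of \<open>N\<close> is sent to \<open>M\<close> by \<open>i\<close>, bounded
  there, and the bounding chain is brought back by \<open>r\<close>.\<close>

lemma acyclic_chains_retract:
  assumes M: "cellular_chains C \<omega> M" and N: "cellular_chains C \<omega> N"
    and i: "natural_map C N M i" and r: "natural_map C M N r"
    and ri: "\<And>\<sigma> x. \<sigma> \<in> C \<Longrightarrow> x \<in> carrier (grp N \<sigma>) \<Longrightarrow> r \<sigma> (i \<sigma> x) = x"
    and acyclic: "acyclic_chains C \<omega> M"
  shows "acyclic_chains C \<omega> N"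
  unfolding acyclic_chains_def
proof (intro allI ballI impI)
  interpret M: cellular_chains C \<omega> M by fact
  interpret N: cellular_chains C \<omega> N by fact
  fix p c assume c: "c \<in> carrier (cell_chains C N p)" and cyc: "\<forall>q. p = Suc q \<longrightarrow> bd C \<omega> N q c = \<one>\<^bsub>cell_chains C N q\<^esub>"
  note ich = natural_map_chains[OF N M i] and rch = natural_map_chains[OF M N r]
  let ?ic = "sum_map (cells C p) i c"
  have "?ic \<in> carrier (cell_chains C M p)" using ich(1) c by (rule hom_in_carrier)
  moreover have "bd C \<omega> M q ?ic = \<one>\<^bsub>cell_chains C M q\<^esub>" if "p = Suc q" for q
    using ich(2)[of c q] c cyc that hom_one[OF ich(1) N.group_chains M.group_chains] by simp
  ultimately obtain b where b: "b \<in> carrier (cell_chains C M (Suc p))" "bd C \<omega> M p b = ?ic"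
    using acyclic unfolding acyclic_chains_def by blast
  have "bd C \<omega> N p (sum_map (cells C (Suc p)) r b) = sum_map (cells C p) r ?ic"
    using rch(2)[OF b(1)] b(2) by simp
  also have "\<dots> = c"
  proof
    fix \<sigma>
    have "c \<in> extensional (cells C p)"
      using c unfolding cell_chains_def
      by (subst (asm) carrier_sum_group) (auto intro: N.group_grp N.cells_mem simp: PiE_def)
    then show "sum_map (cells C p) r ?ic \<sigma> = c \<sigma>"
      using N.chains_closed[OF c] ri N.cells_mem by (simp add: sum_map_def extensional_def)
  qed
  finally show "\<exists>b\<in>carrier (cell_chains C N (Suc p)). bd C \<omega> N p b = c"
    using hom_in_carrier[OF rch(1) b(1)] by blast
qed

lemma precosheaf_hom_star_diagram:
  assumes "\<alpha> \<in> precosheaf_hom (face_space K) G G'"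
  shows "natural_map C (star_diagram K G) (star_diagram K G') (\<lambda>\<sigma>. \<alpha> (star K \<sigma>))"
  unfolding natural_map_def star_diagram_def diagram.simps
proof (intro conjI ballI impI)
  show "\<alpha> (star K \<sigma>) \<in> hom (grp G (star K \<sigma>)) (grp G' (star K \<sigma>))" for \<sigma>
    by (rule precosheaf_homD(1)[OF assms openin_star])
  show "\<alpha> (star K \<tau>) (arr G (star K \<sigma>) (star K \<tau>) x) = arr G' (star K \<sigma>) (star K \<tau>) (\<alpha> (star K \<sigma>) x)"
    if "\<tau> \<subseteq> \<sigma>" "x \<in> carrier (grp G (star K \<sigma>))" for \<sigma> \<tau> x
    by (rule precosheaf_homD(2)[OF assms openin_star openin_star star_antimono[OF that(1)] that(2)])
qed

text \<open>The empty simplex gets an ordering as well, because the augmentation uses incidence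
  numbers of vertices over it.\<close>

locale oriented_simplicial_complex =
  fixes K :: "'v set set" and \<omega> :: "'v set \<Rightarrow> 'v list"
  assumes simplicial: "abstract_simplicial_complex K"
    and orientation: "orientation (insert {} K) \<omega>"
begin

abbreviation "C \<equiv> insert {} K"

sublocale oriented_complex C \<omega>
  using simplicial orientation
  by unfold_locales (auto simp: abstract_simplicial_complex_def)

lemma cellular_chains_star_diagram:
  "precosheaf (face_space K) G \<Longrightarrow> cellular_chains C \<omega> (star_diagram K G)"
  by (intro cellular_chains.intro oriented_complex_axioms ab_diagram.intro star_diagram_functor)

text \<open>
  In the coefficients spanned by \<open>(x, g)\<close> the complex is that of the full simplex \<open>x\<close>, and the
  cone with apex \<open>v\<^sub>x\<close> is a contracting homotopy: \<open>h(\<sigma>) = [\<sigma> \<union> v\<^sub>x : \<sigma>] (\<sigma> \<union> v\<^sub>x)\<close> if \<open>v\<^sub>x \<notin> \<sigma>\<close>,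
  and \<open>h(\<sigma>) = 0\<close> otherwise.
\<close>

lemma acyclic_chains_free: "acyclic_chains C \<omega> (star_diagram K (free_cosheaf S))"
  unfolding acyclic_chains_def
proof (intro allI ballI impI)
  let ?M = "star_diagram K (free_cosheaf S)"
  let ?lk = "poly_mapping.lookup"
  interpret M: cellular_chains C \<omega> ?M
    by (rule cellular_chains_star_diagram[OF precosheaf_free_cosheaf])
  have grpM: "grp ?M \<sigma> = free_Abelian_group (Sigma (star K \<sigma>) S)" and arrM: "arr ?M \<sigma> \<tau> = id" for \<sigma> \<tau>
    by (simp_all add: star_diagram_def)
  have carrier_chains: "c \<in> carrier (cell_chains C ?M p) \<longleftrightarrow> c \<in> extensional (cells C p) \<and>
      (\<forall>\<sigma>\<in>cells C p. Poly_Mapping.keys (c \<sigma>) \<subseteq> Sigma (star K \<sigma>) S) \<and> finite {\<sigma>\<in>cells C p. c \<sigma> \<noteq> 0}" for c p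
    unfolding cell_chains_def by (subst carrier_sum_group) (auto simp: grpM PiE_iff)
  have ne: "x \<noteq> {}" and finx: "finite x" and sub: "\<tau> \<subseteq> x \<Longrightarrow> \<tau> \<in> C" if "x \<in> K" for x \<tau>
    using that simplicial unfolding abstract_simplicial_complex_def by blast+
  \<comment> \<open>The generator \<open>(x, g)\<close> occurs only at simplices contained in
    \<open>x\<close>, so among the cofaces of \<open>\<tau>\<close> only those obtained by adding a
    vertex of \<open>x\<close> matter. This finite sum is the boundary in the full simplex
    \<open>x\<close>.\<close>
  have bd_lookup: "?lk (bd C \<omega> ?M p c \<tau>) (x, g)
      = (\<Sum>u\<in>x - \<tau>. incidence \<omega> (insert u \<tau>) \<tau> * ?lk (c (insert u \<tau>)) (x, g))"
    if c: "c \<in> carrier (cell_chains C ?M (Suc p))" and \<tau>: "\<tau> \<in> cells C p" "\<tau> \<subseteq> x" and x: "x \<in> K" for c p \<tau> x g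
  proof -
    let ?I = "{\<sigma> \<in> cells C (Suc p). \<tau> \<subseteq> \<sigma>}"
    let ?J = "(\<lambda>u. insert u \<tau>) ` (x - \<tau>)"
    let ?f = "\<lambda>\<sigma>. arr ?M \<sigma> \<tau> (c \<sigma>) [^]\<^bsub>grp ?M \<tau>\<^esub> incidence \<omega> \<sigma> \<tau>"
    have ck: "Poly_Mapping.keys (c \<sigma>) \<subseteq> Sigma (star K \<sigma>) S" if "\<sigma> \<in> cells C (Suc p)" for \<sigma>
      using c that by (simp add: carrier_chains)
    have ck\<tau>: "Poly_Mapping.keys (c \<sigma>) \<subseteq> Sigma (star K \<tau>) S" if "\<sigma> \<in> ?I" for \<sigma>
      using ck[of \<sigma>] star_antimono[of \<tau> \<sigma> K] that by blast
    have f: "?f \<sigma> = frag_cmul (incidence \<omega> \<sigma> \<tau>) (c \<sigma>)" if "\<sigma> \<in> ?I" for \<sigma>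
      using int_pow_free_Abelian_group[OF ck\<tau>[OF that]] by (simp add: arrM grpM)
    have fin\<tau>: "finite \<tau>" using \<tau>(2) finx[OF x] finite_subset by blast
    have JI: "?J \<subseteq> ?I"
    proof clarify
      fix u assume "u \<in> x" "u \<notin> \<tau>"
      then show "insert u \<tau> \<in> cells C (Suc p) \<and> \<tau> \<subseteq> insert u \<tau>"
        using \<tau> sub[OF x, of "insert u \<tau>"] fin\<tau> by (auto simp: cells_def)
    qed
    have "?lk (gfinprod (free_Abelian_group (Sigma (star K \<tau>) S)) ?f ?I) (x, g) = (\<Sum>\<sigma>\<in>?J. ?lk (?f \<sigma>) (x, g))"
    proof (rule lookup_gfinprod_free)
      show "Poly_Mapping.keys (?f \<sigma>) \<subseteq> Sigma (star K \<tau>) S" if "\<sigma> \<in> ?I" for \<sigma>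
        unfolding f[OF that] using ck\<tau>[OF that] keys_cmul by blast
      have supp: "{\<sigma> \<in> ?I. ?f \<sigma> \<noteq> 0} \<subseteq> {\<sigma>\<in>cells C (Suc p). c \<sigma> \<noteq> 0}"
      proof
        fix \<sigma> assume \<sigma>: "\<sigma> \<in> {\<sigma> \<in> ?I. ?f \<sigma> \<noteq> 0}"
        then have "frag_cmul (incidence \<omega> \<sigma> \<tau>) (c \<sigma>) \<noteq> 0" using f[of \<sigma>] by simp
        then show "\<sigma> \<in> {\<sigma>\<in>cells C (Suc p). c \<sigma> \<noteq> 0}" using \<sigma> by auto
      qed
      have "finite {\<sigma>\<in>cells C (Suc p). c \<sigma> \<noteq> 0}" using c by (simp add: carrier_chains)
      from finite_subset[OF supp this] show "finite {\<sigma> \<in> ?I. ?f \<sigma> \<noteq> 0}" .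
      show "finite ?J" using finx[OF x] by simp
      show "?J \<subseteq> ?I" by (rule JI)
      fix \<sigma> assume \<sigma>: "\<sigma> \<in> ?I - ?J"
      have "\<not> \<sigma> \<subseteq> x"
      proof
        assume "\<sigma> \<subseteq> x"
        have "card (\<sigma> - \<tau>) = 1"
          using \<sigma> \<tau>(1) fin\<tau> by (auto simp: card_Diff_subset cells_def)
        then obtain u where "\<sigma> - \<tau> = {u}" by (meson card_1_singletonE)
        then have "\<sigma> = insert u \<tau>" "u \<in> x - \<tau>" using \<sigma> \<open>\<sigma> \<subseteq> x\<close> by auto
        with \<sigma> show False by blast
      qed
      then have "(x, g) \<notin> Poly_Mapping.keys (c \<sigma>)"
        using ck[of \<sigma>] \<sigma> by (auto simp: star_def)
      moreover have "\<sigma> \<in> ?I" using \<sigma> by blast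
      ultimately show "?lk (?f \<sigma>) (x, g) = 0"
        using f by (simp add: in_keys_iff)
    qed
    also have "\<dots> = (\<Sum>\<sigma>\<in>?J. incidence \<omega> \<sigma> \<tau> * ?lk (c \<sigma>) (x, g))"
    proof (rule sum.cong[OF refl])
      fix \<sigma> assume "\<sigma> \<in> ?J"
      then have "\<sigma> \<in> ?I" using JI by blast
      then show "?lk (?f \<sigma>) (x, g) = incidence \<omega> \<sigma> \<tau> * ?lk (c \<sigma>) (x, g)" using f by simp
    qed
    also have "\<dots> = (\<Sum>u\<in>x - \<tau>. incidence \<omega> (insert u \<tau>) \<tau> * ?lk (c (insert u \<tau>)) (x, g))"
      by (subst sum.reindex) (auto simp: inj_on_def)
    finally show ?thesis using \<tau>(1) by (simp add: bd_def grpM)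
  qed
  fix p c assume c: "c \<in> carrier (cell_chains C ?M p)" and cyc: "\<forall>q. p = Suc q \<longrightarrow> bd C \<omega> ?M q c = \<one>\<^bsub>cell_chains C ?M q\<^esub>"
  \<comment> \<open>The apex is fixed once for each \<open>x\<close>: the homotopy has to use the
    same vertex in all terms with generator \<open>(x, g)\<close>.\<close>
  define vx where "vx x = (SOME v. v \<in> x)" for x :: "'v set"
  have vx: "vx x \<in> x" if "x \<in> K" for x using ne[OF that] unfolding vx_def by (simp add: some_in_eq)
  \<comment> \<open>The cone read off at its target: the coefficient at \<open>\<sigma>\<close>
    comes from the face of \<open>\<sigma>\<close> opposite the apex. Since the apex depends on the
    generator \<open>k\<close>, the chain \<open>b\<close> must be assembled coefficient by
    coefficient.\<close>
  define h where "h \<sigma> k = (if vx (fst k) \<in> \<sigma>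
      then incidence \<omega> \<sigma> (\<sigma> - {vx (fst k)}) * ?lk (c (\<sigma> - {vx (fst k)})) k else 0)" for \<sigma> k
  define b where "b = (\<lambda>\<sigma>\<in>cells C (Suc p). Abs_poly_mapping (h \<sigma>))"
  have ck: "Poly_Mapping.keys (c \<sigma>) \<subseteq> Sigma (star K \<sigma>) S" if "\<sigma> \<in> cells C p" for \<sigma>
    using c that by (simp add: carrier_chains)
  have remove: "\<sigma> - {v} \<in> cells C p" if "\<sigma> \<in> cells C (Suc p)" "v \<in> \<sigma>" for \<sigma> v
    using that face_closed[of \<sigma> "\<sigma> - {v}"] by (auto simp: cells_def)
  have h_supp: "{k. h \<sigma> k \<noteq> 0} \<subseteq> (\<Union>v\<in>\<sigma>. Poly_Mapping.keys (c (\<sigma> - {v})))" for \<sigma>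
    by (auto simp: h_def in_keys_iff split: if_splits)
  have lkb: "?lk (b \<sigma>) k = h \<sigma> k" if \<sigma>: "\<sigma> \<in> cells C (Suc p)" for \<sigma> k
  proof -
    have "finite (\<Union>v\<in>\<sigma>. Poly_Mapping.keys (c (\<sigma> - {v})))"
      using finite_cell[OF M.cells_mem[OF \<sigma>]] by simp
    then have "finite {k. h \<sigma> k \<noteq> 0}" using h_supp finite_subset by blast
    then show ?thesis using \<sigma> by (simp add: b_def)
  qed
  have b: "b \<in> carrier (cell_chains C ?M (Suc p))"
    unfolding carrier_chains
  proof (intro conjI ballI)
    show "b \<in> extensional (cells C (Suc p))" by (simp add: b_def)
    show "Poly_Mapping.keys (b \<sigma>) \<subseteq> Sigma (star K \<sigma>) S" if \<sigma>: "\<sigma> \<in> cells C (Suc p)" for \<sigma>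
    proof
      fix k assume k: "k \<in> Poly_Mapping.keys (b \<sigma>)"
      then have "h \<sigma> k \<noteq> 0" using lkb[OF \<sigma>] by (simp add: in_keys_iff)
      then have v: "vx (fst k) \<in> \<sigma>" and "k \<in> Poly_Mapping.keys (c (\<sigma> - {vx (fst k)}))"
        by (auto simp: h_def in_keys_iff split: if_splits)
      then have "k \<in> Sigma (star K (\<sigma> - {vx (fst k)})) S"
        using ck[OF remove[OF \<sigma> v]] by blast
      then have "fst k \<in> K" "\<sigma> - {vx (fst k)} \<subseteq> fst k" "snd k \<in> S (fst k)" by (auto simp: star_def)
      moreover from this(1) have "vx (fst k) \<in> fst k" by (rule vx)
      ultimately have "fst k \<in> star K \<sigma>" "snd k \<in> S (fst k)" by (auto simp: star_def)
      then show "k \<in> Sigma (star K \<sigma>) S" by (cases k) simp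
    qed
    \<comment> \<open>A simplex in the support of \<open>b\<close> is recovered from a simplex in
      the support of \<open>c\<close> and a key there, by adding the apex; there are finitely many
      such pairs.\<close>
    let ?T = "Sigma {\<sigma>\<in>cells C p. c \<sigma> \<noteq> 0} (\<lambda>\<sigma>. Poly_Mapping.keys (c \<sigma>))"
    have "{\<sigma>\<in>cells C (Suc p). b \<sigma> \<noteq> 0} \<subseteq> (\<lambda>(\<sigma>, k). insert (vx (fst k)) \<sigma>) ` ?T"
    proof clarify
      fix \<sigma> assume \<sigma>: "\<sigma> \<in> cells C (Suc p)" and "b \<sigma> \<noteq> 0"
      then obtain k where "?lk (b \<sigma>) k \<noteq> 0" by (metis poly_mapping_eqI lookup_zero)
      then have "h \<sigma> k \<noteq> 0" using lkb[OF \<sigma>] by simp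
      then have v: "vx (fst k) \<in> \<sigma>" and k: "k \<in> Poly_Mapping.keys (c (\<sigma> - {vx (fst k)}))"
        by (auto simp: h_def in_keys_iff split: if_splits)
      have "(\<sigma> - {vx (fst k)}, k) \<in> ?T" using remove[OF \<sigma> v] k by auto
      moreover have "\<sigma> = insert (vx (fst k)) (\<sigma> - {vx (fst k)})" using v by auto
      ultimately show "\<sigma> \<in> (\<lambda>(\<sigma>, k). insert (vx (fst k)) \<sigma>) ` ?T"
        by (metis (no_types, lifting) case_prod_conv image_eqI)
    qed
    moreover have "finite ?T" using c by (simp add: carrier_chains)
    ultimately show "finite {\<sigma>\<in>cells C (Suc p). b \<sigma> \<noteq> 0}" using finite_subset by blast
  qed
  have "bd C \<omega> ?M p b = c"
  proof
    fix \<tau>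
    show "bd C \<omega> ?M p b \<tau> = c \<tau>"
    proof (cases "\<tau> \<in> cells C p")
      case False
      then show ?thesis using c by (simp add: bd_def carrier_chains extensional_def)
    next
      case \<tau>: True
      show ?thesis
      proof (rule poly_mapping_eqI)
        fix k :: "'v set \<times> 'a"
        obtain x g where k: "k = (x, g)" by (cases k)
        show "?lk (bd C \<omega> ?M p b \<tau>) k = ?lk (c \<tau>) k"
        proof (cases "x \<in> K \<and> \<tau> \<subseteq> x")
          case False
          have "bd C \<omega> ?M p b \<tau> \<in> carrier (grp ?M \<tau>)"
            using M.chains_closed[OF M.bd_closed[OF b] \<tau>] .
          then have "k \<notin> Poly_Mapping.keys (bd C \<omega> ?M p b \<tau>)" "k \<notin> Poly_Mapping.keys (c \<tau>)"
            using ck[OF \<tau>] False by (auto simp: grpM k star_def)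
          then show ?thesis by (simp add: in_keys_iff)
        next
          case True
          then have x: "x \<in> K" and \<tau>x: "\<tau> \<subseteq> x" by auto
          let ?v = "vx x"
          have v: "?v \<in> x" by (rule vx[OF x])
          have cell: "insert u \<tau> \<in> cells C (Suc p)" if "u \<in> x - \<tau>" for u
            using \<tau> sub[OF x, of "insert u \<tau>"] \<tau>x that finite_subset[OF \<tau>x finx[OF x]] by (auto simp: cells_def)
          have sum: "?lk (bd C \<omega> ?M p b \<tau>) k
              = (\<Sum>u\<in>x - \<tau>. incidence \<omega> (insert u \<tau>) \<tau> * h (insert u \<tau>) (x, g))"
            unfolding k bd_lookup[OF b \<tau> \<tau>x x] using lkb[OF cell] by simp
          show ?thesis
          proof (cases "?v \<in> \<tau>")
            \<comment> \<open>If the apex is not in \<open>\<tau>\<close>, only the coface with the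
              apex added carries a cone term, and its incidence number occurs squared.\<close>
            case False
            have "(\<Sum>u\<in>x - \<tau>. incidence \<omega> (insert u \<tau>) \<tau> * h (insert u \<tau>) (x, g))
                = (\<Sum>u\<in>{?v}. incidence \<omega> (insert u \<tau>) \<tau> * h (insert u \<tau>) (x, g))"
              using False v finx[OF x] by (intro sum.mono_neutral_right) (auto simp: h_def)
            also have "\<dots> = ?lk (c \<tau>) k"
              using incidence_square[OF M.cells_mem[OF cell], of ?v ?v] False v
              by (simp add: h_def k flip: mult.assoc)
            finally show ?thesis using sum by simp
          next
            \<comment> \<open>If the apex is in \<open>\<tau>\<close>, then \<open>\<tau>\<close> is
              nonempty, so \<open>c\<close> satisfies a cycle condition. Read at the face
              \<open>?\<rho>\<close> opposite the apex, it expresses the coefficient of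
              \<open>c\<close> at \<open>\<tau>\<close> through those at the other cofaces of
              \<open>?\<rho>\<close>, which are the ones that the cone terms involve.\<close>
            case True
            then obtain q where p: "p = Suc q"
              using \<tau> finite_subset[OF \<tau>x finx[OF x]] by (cases p) (auto simp: cells_def)
            let ?\<rho> = "\<tau> - {?v}"
            have \<tau>\<rho>: "insert ?v ?\<rho> = \<tau>" using True by auto
            have \<rho>: "?\<rho> \<in> cells C q" "?\<rho> \<subseteq> x"
              using \<tau> \<tau>x True face_closed[OF M.cells_mem[OF \<tau>], of ?\<rho>] by (auto simp: p cells_def)
            let ?f = "incidence \<omega> \<tau> ?\<rho>"
            let ?s = "\<Sum>u\<in>x - \<tau>. incidence \<omega> (insert u ?\<rho>) ?\<rho> * ?lk (c (insert u ?\<rho>)) (x, g)"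
            have "x - ?\<rho> = insert ?v (x - \<tau>)" using True v by auto
            moreover have "?lk (bd C \<omega> ?M q c ?\<rho>) (x, g) = 0"
              using cyc p \<rho>(1) by (simp add: cell_chains_def one_sum_group grpM)
            ultimately have zero: "?f * ?lk (c \<tau>) (x, g) + ?s = 0"
              using bd_lookup[OF c[unfolded p] \<rho> x, of g] True finx[OF x] by (simp add: insert_absorb[OF True])
            \<comment> \<open>This is \<open>incidence_cancel\<close> for the two vertices
              \<open>u\<close> and \<open>?v\<close> of \<open>insert u \<tau>\<close>, solved for
              the product of signs using that all of them are 1 or -1.\<close>
            have summand: "incidence \<omega> (insert u \<tau>) \<tau> * h (insert u \<tau>) (x, g)
                = - ?f * (incidence \<omega> (insert u ?\<rho>) ?\<rho> * ?lk (c (insert u ?\<rho>)) (x, g))"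
              if u: "u \<in> x - \<tau>" for u
            proof -
              let ?\<sigma> = "insert u \<tau>"
              have \<sigma>: "?\<sigma> \<in> C" using M.cells_mem[OF cell[OF u]] .
              have eq: "?\<sigma> - {?v} = insert u ?\<rho>" "?\<sigma> - {u} = \<tau>" "?\<sigma> - {?v, u} = ?\<rho>"
                using u True by auto
              have uv: "?v \<noteq> u" using u True by auto
              have "?f * ?f = 1"
                using incidence_square[OF M.cells_mem[OF \<tau>] True] .
              moreover have "incidence \<omega> (insert u ?\<rho>) ?\<rho> = 1 \<or> incidence \<omega> (insert u ?\<rho>) ?\<rho> = -1"
                using incidence_cases[of "insert u ?\<rho>" u] face_closed[OF \<sigma>, of "insert u ?\<rho>"] u True
                by (simp add: insert_Diff_if Diff_insert_absorb) blast
              moreover have "incidence \<omega> ?\<sigma> \<tau> = 1 \<or> incidence \<omega> ?\<sigma> \<tau> = -1"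
                using incidence_cases[OF \<sigma>, of u] eq by simp
              moreover have "incidence \<omega> ?\<sigma> (insert u ?\<rho>) = 1 \<or> incidence \<omega> ?\<sigma> (insert u ?\<rho>) = -1"
                using incidence_cases[OF \<sigma>, of ?v] eq True by simp
              moreover have "incidence \<omega> ?\<sigma> (insert u ?\<rho>) * incidence \<omega> (insert u ?\<rho>) ?\<rho>
                  + incidence \<omega> ?\<sigma> \<tau> * ?f = 0"
                using incidence_cancel[OF \<sigma> _ _ uv] True by (simp only: eq) blast
              ultimately have "incidence \<omega> ?\<sigma> \<tau> * incidence \<omega> ?\<sigma> (insert u ?\<rho>)
                  = - ?f * incidence \<omega> (insert u ?\<rho>) ?\<rho>"
                by auto
              then show ?thesis
                using True eq(1) by (simp add: h_def flip: mult.assoc)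
            qed
            have "(\<Sum>u\<in>x - \<tau>. incidence \<omega> (insert u \<tau>) \<tau> * h (insert u \<tau>) (x, g)) = - ?f * ?s"
              unfolding sum_distrib_left using summand by (intro sum.cong) auto
            also have "\<dots> = ?f * ?f * ?lk (c \<tau>) (x, g)"
              using zero by (metis (no_types, lifting) add_eq_0_iff2 minus_mult_left minus_mult_right mult.assoc)
            also have "\<dots> = ?lk (c \<tau>) k"
              using incidence_square[OF M.cells_mem[OF \<tau>] True] by (simp add: k)
            finally show ?thesis using sum by simp
          qed
        qed
      qed
    qed
  qed
  with b show "\<exists>b\<in>carrier (cell_chains C ?M (Suc p)). bd C \<omega> ?M p b = c" by blast
qed

text \<open>The tests in \<open>projective_cosheaf\<close> require targets valued in the free type.
  \<open>P\<close> itself is not of that type, so its copy along \<open>j\<close> serves as target: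
  lifting \<open>j\<close> through the composite of the free cover with \<open>j\<close> splits the
  cover, because \<open>j\<close> is injective.\<close>

lemma acyclic_chains_projective:
  fixes P :: "('v set, 'p) precosheaf"
  assumes proj: "projective_cosheaf (face_space K) P"
  shows "acyclic_chains C \<omega> (star_diagram K P)"
proof -
  let ?X = "face_space K"
  have P: "cosheaf ?X P" "precosheaf ?X P" using proj by (auto simp: projective_cosheaf_def cosheaf_def)
  let ?S = "\<lambda>x. carrier (costalk ?X P x)"
  let ?Q = "free_cosheaf ?S"
  define j :: "'p \<Rightarrow> ('v set, 'p) free_type" where "j a = frag_of (undefined, a)" for a
  have j: "inj j" by (rule injI) (simp add: j_def frag_of_eq)
  note copy = copy_diagram_homs[OF j P(2)]
  from face_space.free_cosheaf_cover_costalks[OF P(2)]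
  obtain \<alpha> where \<alpha>: "\<alpha> \<in> precosheaf_hom ?X ?Q P"
    "\<And>x. x \<in> topspace ?X \<Longrightarrow> \<alpha> (min_nhd ?X x) ` carrier (costalk ?X ?Q x) = ?S x"
    by (elim bexE) simp
  have "cosheaf_surj ?X ?Q (copy_diagram j P) (\<lambda>U. j \<circ> \<alpha> U)"
    unfolding cosheaf_surj_def
  proof
    fix x assume x: "x \<in> topspace ?X"
    have "(j \<circ> \<alpha> (min_nhd ?X x)) ` carrier (costalk ?X ?Q x)
        = j ` (\<alpha> (min_nhd ?X x) ` carrier (costalk ?X ?Q x))"
      by (simp only: image_comp)
    also have "\<dots> = carrier (costalk ?X (copy_diagram j P) x)"
      unfolding \<alpha>(2)[OF x] by (simp add: costalk_def copy_diagram_def)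
    finally show "(j \<circ> \<alpha> (min_nhd ?X x)) ` carrier (costalk ?X ?Q x)
        = carrier (costalk ?X (copy_diagram j P) x)" .
  qed
  then have "\<exists>\<gamma>\<in>precosheaf_hom ?X P ?Q. \<forall>U. openin ?X U \<longrightarrow>
      (\<forall>x\<in>carrier (grp P U). (j \<circ> \<alpha> U) (\<gamma> U x) = j x)"
    using proj face_space.cosheaf_free_cosheaf[of K ?S] cosheaf_copy_diagram[OF j P(1)]
      precosheaf_hom_compose[OF \<alpha>(1) copy(1)] copy(1)
    unfolding projective_cosheaf_def by blast
  then obtain \<gamma> where \<gamma>: "\<gamma> \<in> precosheaf_hom ?X P ?Q"
    "\<And>U x. openin ?X U \<Longrightarrow> x \<in> carrier (grp P U) \<Longrightarrow> (j \<circ> \<alpha> U) (\<gamma> U x) = j x"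
    by (elim bexE) simp
  show ?thesis
  proof (rule acyclic_chains_retract[OF _ _ _ _ _ acyclic_chains_free])
    show "cellular_chains C \<omega> (star_diagram K ?Q)" "cellular_chains C \<omega> (star_diagram K P)"
      using P precosheaf_free_cosheaf by (auto intro: cellular_chains_star_diagram)
    show "natural_map C (star_diagram K P) (star_diagram K ?Q) (\<lambda>\<sigma>. \<gamma> (star K \<sigma>))"
      by (rule precosheaf_hom_star_diagram[OF \<gamma>(1)])
    show "natural_map C (star_diagram K ?Q) (star_diagram K P) (\<lambda>\<sigma>. \<alpha> (star K \<sigma>))"
      by (rule precosheaf_hom_star_diagram[OF \<alpha>(1)])
    fix \<sigma> x assume "x \<in> carrier (grp (star_diagram K P) \<sigma>)"
    then show "\<alpha> (star K \<sigma>) (\<gamma> (star K \<sigma>) x) = x"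
      using \<gamma>(2)[OF openin_star] injD[OF j] by (simp add: star_diagram_def)
  qed
qed

end

section \<open>Dimension shifting\<close>

text \<open>The form of \<open>FactGroup_iso_of_span\<close> suited to homology groups, that is for
  cycles modulo boundaries inside ambient chain groups. The two legs of the span matter only on the
  subgroup \<open>S\<close>.\<close>

lemma subquotient_iso:
  assumes G: "comm_group G" and A: "comm_group A" and B: "comm_group B"
    and S: "subgroup S G" and T: "subgroup T A" and U: "subgroup U B"
    and f: "\<And>x y. x \<in> S \<Longrightarrow> y \<in> S \<Longrightarrow> f (x \<otimes>\<^bsub>G\<^esub> y) = f x \<otimes>\<^bsub>A\<^esub> f y" "f ` S = T"
    and g: "\<And>x y. x \<in> S \<Longrightarrow> y \<in> S \<Longrightarrow> g (x \<otimes>\<^bsub>G\<^esub> y) = g x \<otimes>\<^bsub>B\<^esub> g y" "g ` S = U"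
    and N: "subgroup N A" "N \<subseteq> T" and L: "subgroup L B" "L \<subseteq> U"
    and eq: "\<And>z. z \<in> S \<Longrightarrow> f z \<in> N \<longleftrightarrow> g z \<in> L"
  shows "subgroup_generated A T Mod N \<cong> subgroup_generated B U Mod L"
proof (rule FactGroup_iso_of_span[where Z = "subgroup_generated G S" and f = f and g = g])
  have carr: "carrier (subgroup_generated G S) = S" "carrier (subgroup_generated A T) = T"
    "carrier (subgroup_generated B U) = U"
    using S T U by (simp_all add: subgroup.carrier_subgroup_generated_subgroup)
  show "comm_group (subgroup_generated G S)" "comm_group (subgroup_generated A T)"
    "comm_group (subgroup_generated B U)"
    using G A B by (simp_all add: group.abelian_subgroup_generated comm_group.axioms(2))
  show "f \<in> hom (subgroup_generated G S) (subgroup_generated A T)"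
    "g \<in> hom (subgroup_generated G S) (subgroup_generated B U)"
    using f g by (auto simp: hom_def carr)
  show "f ` carrier (subgroup_generated G S) = carrier (subgroup_generated A T)"
    "g ` carrier (subgroup_generated G S) = carrier (subgroup_generated B U)"
    using f g by (simp_all add: carr)
  show "subgroup N (subgroup_generated A T)" "subgroup L (subgroup_generated B U)"
    using A B N L by (simp_all add: group.subgroup_subgroup_generated_iff comm_group.axioms(2) carr)
  show "f z \<in> N \<longleftrightarrow> g z \<in> L" if "z \<in> carrier (subgroup_generated G S)" for z
    using eq that by (simp add: carr)
qed

lemma natural_mapD:
  assumes "natural_map C M N \<eta>"
  shows "\<sigma> \<in> C \<Longrightarrow> \<eta> \<sigma> \<in> hom (grp M \<sigma>) (grp N \<sigma>)"
    and "\<sigma> \<in> C \<Longrightarrow> \<tau> \<in> C \<Longrightarrow> \<tau> \<subseteq> \<sigma> \<Longrightarrow> x \<in> carrier (grp M \<sigma>) \<Longrightarrow>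
      \<eta> \<tau> (arr M \<sigma> \<tau> x) = arr N \<sigma> \<tau> (\<eta> \<sigma> x)"
  using assms unfolding natural_map_def by blast+

lemma natural_map_compose:
  assumes \<eta>: "natural_map C L M \<eta>" and \<theta>: "natural_map C M N \<theta>"
  shows "natural_map C L N (\<lambda>\<sigma>. \<theta> \<sigma> \<circ> \<eta> \<sigma>)"
  unfolding natural_map_def
proof (intro conjI ballI impI)
  show "\<theta> \<sigma> \<circ> \<eta> \<sigma> \<in> hom (grp L \<sigma>) (grp N \<sigma>)" if "\<sigma> \<in> C" for \<sigma>
    by (rule hom_compose[OF natural_mapD(1)[OF \<eta> that] natural_mapD(1)[OF \<theta> that]])
  show "(\<theta> \<tau> \<circ> \<eta> \<tau>) (arr L \<sigma> \<tau> x) = arr N \<sigma> \<tau> ((\<theta> \<sigma> \<circ> \<eta> \<sigma>) x)"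
    if "\<sigma> \<in> C" "\<tau> \<in> C" "\<tau> \<subseteq> \<sigma>" "x \<in> carrier (grp L \<sigma>)" for \<sigma> \<tau> x
    using natural_mapD(2)[OF \<eta> that] natural_mapD(2)[OF \<theta> that(1-3)]
      hom_in_carrier[OF natural_mapD(1)[OF \<eta> that(1)] that(4)] by simp
qed

text \<open>Only the carriers shrink while the operations stay those of \<open>M\<close>. Chains
  with coefficients in the kernel are therefore literally chains with coefficients in
  \<open>M\<close>.\<close>

definition kernel_diagram ::
  "('v set, 'a) diagram \<Rightarrow> ('v set, 'b) diagram \<Rightarrow> ('v set \<Rightarrow> 'a \<Rightarrow> 'b) \<Rightarrow> ('v set, 'a) diagram" where
  "kernel_diagram M N \<eta> =
     \<lparr>grp = (\<lambda>\<sigma>. (grp M \<sigma>)\<lparr>carrier := kernel (grp M \<sigma>) (grp N \<sigma>) (\<eta> \<sigma>)\<rparr>), arr = arr M\<rparr>"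

lemma
  shows carrier_kernel_diagram:
      "carrier (grp (kernel_diagram M N \<eta>) \<sigma>) = kernel (grp M \<sigma>) (grp N \<sigma>) (\<eta> \<sigma>)"
    and mult_kernel_diagram [simp]: "monoid.mult (grp (kernel_diagram M N \<eta>) \<sigma>) = monoid.mult (grp M \<sigma>)"
    and one_kernel_diagram [simp]: "\<one>\<^bsub>grp (kernel_diagram M N \<eta>) \<sigma>\<^esub> = \<one>\<^bsub>grp M \<sigma>\<^esub>"
    and arr_kernel_diagram [simp]: "arr (kernel_diagram M N \<eta>) = arr M"
  by (simp_all add: kernel_diagram_def)

lemma kernel_diagram_functor:
  assumes M: "ab_functor C (\<supseteq>) M" and N: "ab_functor C (\<supseteq>) N" and \<eta>: "natural_map C M N \<eta>"
  shows "ab_functor C (\<supseteq>) (kernel_diagram M N \<eta>)"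
proof -
  interpret M: ab_diagram C "(\<supseteq>)" M by unfold_locales fact
  interpret N: ab_diagram C "(\<supseteq>)" N by unfold_locales fact
  have \<eta>_hom: "\<eta> \<sigma> \<in> hom (grp M \<sigma>) (grp N \<sigma>)" if "\<sigma> \<in> C" for \<sigma>
    using \<eta> that by (simp add: natural_map_def)
  have arr: "arr M \<sigma> \<tau> x \<in> kernel (grp M \<tau>) (grp N \<tau>) (\<eta> \<tau>)"
    if *: "\<sigma> \<in> C" "\<tau> \<in> C" "\<tau> \<subseteq> \<sigma>" "x \<in> kernel (grp M \<sigma>) (grp N \<sigma>) (\<eta> \<sigma>)" for \<sigma> \<tau> x
  proof -
    have x: "x \<in> carrier (grp M \<sigma>)" "\<eta> \<sigma> x = \<one>\<^bsub>grp N \<sigma>\<^esub>" using * by (auto simp: kernel_def)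
    have "\<eta> \<tau> (arr M \<sigma> \<tau> x) = arr N \<sigma> \<tau> (\<eta> \<sigma> x)" using \<eta> * x by (simp add: natural_map_def)
    also have "\<dots> = \<one>\<^bsub>grp N \<tau>\<^esub>"
      unfolding x(2) by (rule hom_one[OF N.arr_hom[OF *(1,2,3)] N.group_grp[OF *(1)] N.group_grp[OF *(2)]])
    finally show ?thesis using M.arr_closed[OF *(1,2,3) x(1)] by (simp add: kernel_def)
  qed
  show ?thesis
    unfolding ab_functor_def
  proof (intro conjI ballI impI)
    fix \<sigma> assume \<sigma>: "\<sigma> \<in> C"
    interpret \<eta>: group_hom "grp M \<sigma>" "grp N \<sigma>" "\<eta> \<sigma>"
      using M.group_grp[OF \<sigma>] N.group_grp[OF \<sigma>] \<eta>_hom[OF \<sigma>] by (rule group_homI)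
    interpret MC: comm_group "grp M \<sigma>" using M.comm_group_grp[OF \<sigma>] .
    show "comm_group (grp (kernel_diagram M N \<eta>) \<sigma>)"
    proof (rule group.group_comm_groupI)
      show "group (grp (kernel_diagram M N \<eta>) \<sigma>)"
        using \<eta>.G.subgroup_imp_group[OF \<eta>.subgroup_kernel] by (simp add: kernel_diagram_def)
    qed (auto simp: carrier_kernel_diagram kernel_def intro: MC.m_comm)
    show "arr (kernel_diagram M N \<eta>) \<sigma> \<sigma> x = x" if "x \<in> carrier (grp (kernel_diagram M N \<eta>) \<sigma>)" for x
      using that M.arr_id[OF \<sigma>] by (simp add: carrier_kernel_diagram kernel_def)
    fix \<tau> assume \<tau>: "\<tau> \<in> C"
    show "arr (kernel_diagram M N \<eta>) \<sigma> \<tau> \<in> hom (grp (kernel_diagram M N \<eta>) \<sigma>) (grp (kernel_diagram M N \<eta>) \<tau>)"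
      if "\<tau> \<subseteq> \<sigma>"
      using arr[OF \<sigma> \<tau> that] hom_mult[OF M.arr_hom[OF \<sigma> \<tau> that]]
      by (auto simp: hom_def carrier_kernel_diagram) (auto simp: kernel_def)
    fix \<rho> x assume "\<rho> \<in> C" "\<tau> \<subseteq> \<sigma>" "\<rho> \<subseteq> \<tau>" "x \<in> carrier (grp (kernel_diagram M N \<eta>) \<sigma>)"
    then show "arr (kernel_diagram M N \<eta>) \<tau> \<rho> (arr (kernel_diagram M N \<eta>) \<sigma> \<tau> x) = arr (kernel_diagram M N \<eta>) \<sigma> \<rho> x"
      using M.arr_comp[OF \<sigma> \<tau>] by (simp add: carrier_kernel_diagram kernel_def)
  qed
qed

section \<open>Cycles and boundaries of cellular chains\<close>

context cellular_chains
begin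

lemma cycles_iff: "c \<in> cycles (cell_chains C M) (bd C \<omega> M) p \<longleftrightarrow>
    c \<in> carrier (cell_chains C M p) \<and> (\<forall>q. p = Suc q \<longrightarrow> bd C \<omega> M q c = \<one>\<^bsub>cell_chains C M q\<^esub>)"
  by (cases p) (auto simp: cycles_def kernel_def)

lemma bd_group_hom: "group_hom (cell_chains C M (Suc p)) (cell_chains C M p) (bd C \<omega> M p)"
  by (rule group_homI[OF group_chains group_chains bd_hom])

lemma subgroup_cycles: "subgroup (cycles (cell_chains C M) (bd C \<omega> M) p) (cell_chains C M p)"
proof (cases p)
  case 0
  then show ?thesis using group.subgroup_self[OF group_chains] by (simp add: cycles_def)
next
  case (Suc q)
  then show ?thesis
    using group_hom.subgroup_kernel[OF bd_group_hom] by (simp add: cycles_def)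
qed

lemma subgroup_boundaries: "subgroup (bd C \<omega> M p ` carrier (cell_chains C M (Suc p))) (cell_chains C M p)"
  by (rule group_hom.img_is_subgroup[OF bd_group_hom])

lemma boundaries_cycles:
  "bd C \<omega> M p ` carrier (cell_chains C M (Suc p)) \<subseteq> cycles (cell_chains C M) (bd C \<omega> M) p"
  using bd_closed bd_bd by (auto simp: cycles_iff)

lemma chains_extensional: "c \<in> carrier (cell_chains C M p) \<Longrightarrow> c \<in> extensional (cells C p)"
  unfolding cell_chains_def by (subst (asm) carrier_sum_group) (auto intro: group_grp cells_mem simp: PiE_iff)

end

text \<open>Chains are finitely supported functions, so taking kernels simplex by simplex agrees
  with taking the kernel of the induced chain map.\<close>

lemma chains_kernel_diagram:
  assumes M: "cellular_chains C \<omega> M" and N: "cellular_chains C \<omega> N" and \<eta>: "natural_map C M N \<eta>"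
  defines "N' \<equiv> kernel_diagram M N \<eta>"
  shows "cellular_chains C \<omega> N'"
    and "c \<in> carrier (cell_chains C N' p) \<longleftrightarrow>
      c \<in> carrier (cell_chains C M p) \<and> sum_map (cells C p) \<eta> c = \<one>\<^bsub>cell_chains C N p\<^esub>"
    and "monoid.mult (cell_chains C N' p) = monoid.mult (cell_chains C M p)"
    and "\<one>\<^bsub>cell_chains C N' p\<^esub> = \<one>\<^bsub>cell_chains C M p\<^esub>"
    and "c \<in> carrier (cell_chains C N' (Suc p)) \<Longrightarrow> bd C \<omega> N' p c = bd C \<omega> M p c"
proof -
  interpret M: cellular_chains C \<omega> M by fact
  interpret N: cellular_chains C \<omega> N by fact
  have "ab_functor C (\<supseteq>) N'"
    unfolding N'_def using M.is_functor N.is_functor \<eta> by (rule kernel_diagram_functor)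
  then show cc: "cellular_chains C \<omega> N'"
    by (intro cellular_chains.intro M.oriented_complex_axioms ab_diagram.intro)
  interpret N': cellular_chains C \<omega> N' by fact
  show carr: "c \<in> carrier (cell_chains C N' p) \<longleftrightarrow>
      c \<in> carrier (cell_chains C M p) \<and> sum_map (cells C p) \<eta> c = \<one>\<^bsub>cell_chains C N p\<^esub>" for c p
  proof -
    have 1: "c \<in> carrier (cell_chains C N' p) \<longleftrightarrow> c \<in> (\<Pi>\<^sub>E \<sigma>\<in>cells C p. kernel (grp M \<sigma>) (grp N \<sigma>) (\<eta> \<sigma>)) \<and>
        finite {\<sigma> \<in> cells C p. c \<sigma> \<noteq> \<one>\<^bsub>grp M \<sigma>\<^esub>}"
      unfolding cell_chains_def
      by (subst carrier_sum_group) (auto intro: N'.group_grp[unfolded N'_def] N'.cells_mem simp: N'_def carrier_kernel_diagram)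
    have 2: "c \<in> carrier (cell_chains C M p) \<longleftrightarrow> c \<in> (\<Pi>\<^sub>E \<sigma>\<in>cells C p. carrier (grp M \<sigma>)) \<and>
        finite {\<sigma> \<in> cells C p. c \<sigma> \<noteq> \<one>\<^bsub>grp M \<sigma>\<^esub>}"
      unfolding cell_chains_def by (subst carrier_sum_group) (auto intro: M.group_grp M.cells_mem)
    have "sum_map (cells C p) \<eta> c = \<one>\<^bsub>cell_chains C N p\<^esub> \<longleftrightarrow> (\<forall>\<sigma>\<in>cells C p. \<eta> \<sigma> (c \<sigma>) = \<one>\<^bsub>grp N \<sigma>\<^esub>)"
      by (auto simp: sum_map_def cell_chains_def one_sum_group fun_eq_iff restrict_def)
    then show ?thesis unfolding 1 2 by (auto simp: kernel_def PiE_iff)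
  qed
  show "monoid.mult (cell_chains C N' p) = monoid.mult (cell_chains C M p)"
    by (simp add: cell_chains_def mult_sum_group N'_def)
  show "\<one>\<^bsub>cell_chains C N' p\<^esub> = \<one>\<^bsub>cell_chains C M p\<^esub>"
    by (simp add: cell_chains_def one_sum_group N'_def)
  show "bd C \<omega> N' p c = bd C \<omega> M p c" if c: "c \<in> carrier (cell_chains C N' (Suc p))"
  proof -
    have "natural_map C N' M (\<lambda>\<sigma>. id)"
      by (auto simp: natural_map_def N'_def hom_def carrier_kernel_diagram) (auto simp: kernel_def)
    from natural_map_chains(2)[OF cc M this c]
    have "bd C \<omega> M p (sum_map (cells C (Suc p)) (\<lambda>\<sigma>. id) c) = sum_map (cells C p) (\<lambda>\<sigma>. id) (bd C \<omega> N' p c)" .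
    moreover have "sum_map I (\<lambda>\<sigma>. id) b = b" if "b \<in> extensional I" for I and b :: "'a set \<Rightarrow> 'b"
      using that by (simp add: sum_map_def extensional_restrict)
    ultimately show ?thesis
      using N'.chains_extensional[OF c] N'.chains_extensional[OF N'.bd_closed[OF c]] by simp
  qed
qed

text \<open>A cell with \<open>Suc p\<close> vertices is nonempty, so surjectivity at the empty
  simplex is never called upon.\<close>

lemma chains_lift:
  assumes M: "cellular_chains C \<omega> M" and N: "cellular_chains C \<omega> N" and \<eta>: "natural_map C M N \<eta>"
    and surj: "\<And>\<sigma>. \<sigma> \<in> C \<Longrightarrow> \<sigma> \<noteq> {} \<Longrightarrow> \<eta> \<sigma> ` carrier (grp M \<sigma>) = carrier (grp N \<sigma>)"
    and c: "c \<in> carrier (cell_chains C N (Suc p))"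
  shows "\<exists>b\<in>carrier (cell_chains C M (Suc p)). sum_map (cells C (Suc p)) \<eta> b = c"
proof -
  interpret M: cellular_chains C \<omega> M by fact
  interpret N: cellular_chains C \<omega> N by fact
  have C: "\<sigma> \<in> C" "\<sigma> \<noteq> {}" if "\<sigma> \<in> cells C (Suc p)" for \<sigma> using that by (auto simp: cells_def)
  have 1: "group (grp M \<sigma>)" "group (grp N \<sigma>)" "\<eta> \<sigma> \<in> hom (grp M \<sigma>) (grp N \<sigma>)"
    "\<eta> \<sigma> ` carrier (grp M \<sigma>) = carrier (grp N \<sigma>)" if "\<sigma> \<in> cells C (Suc p)" for \<sigma>
    using C[OF that] M.group_grp N.group_grp \<eta> surj by (auto simp: natural_map_def)
  show ?thesis
    using sum_map_surj[of "cells C (Suc p)" "grp M" "grp N" \<eta>, OF 1 c[unfolded cell_chains_def]]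
    unfolding cell_chains_def by metis
qed

text \<open>
  The connecting isomorphism of the sequence \<open>0 \<rightarrow> ker \<eta> \<rightarrow> M \<rightarrow> N \<rightarrow> 0\<close>, which need only be exact
  at the nonempty simplices: the empty simplex does not occur in positive degrees.
\<close>

lemma dimension_shift:
  assumes M: "cellular_chains C \<omega> M" and N: "cellular_chains C \<omega> N" and \<eta>: "natural_map C M N \<eta>"
    and surj: "\<And>\<sigma>. \<sigma> \<in> C \<Longrightarrow> \<sigma> \<noteq> {} \<Longrightarrow> \<eta> \<sigma> ` carrier (grp M \<sigma>) = carrier (grp N \<sigma>)"
    and acyclic: "acyclic_chains C \<omega> M"
  defines "N' \<equiv> kernel_diagram M N \<eta>"
  shows "chain_homology (cell_chains C N) (bd C \<omega> N) (Suc p) \<cong> chain_homology (cell_chains C N') (bd C \<omega> N') p"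
  unfolding chain_homology_def
proof -
  interpret M: cellular_chains C \<omega> M by fact
  interpret N: cellular_chains C \<omega> N by fact
  note ker = chains_kernel_diagram[OF M N \<eta>, folded N'_def]
  interpret N': cellular_chains C \<omega> N' by (rule ker(1))
  let ?e = "\<lambda>p. sum_map (cells C p) \<eta>"
  interpret e: group_hom "cell_chains C M p" "cell_chains C N p" "?e p" for p
    by (rule group_homI[OF M.group_chains N.group_chains natural_map_chains(1)[OF M N \<eta>]])
  interpret dM: group_hom "cell_chains C M (Suc p)" "cell_chains C M p" "bd C \<omega> M p" for p by (rule M.bd_group_hom)
  interpret dN: group_hom "cell_chains C N (Suc p)" "cell_chains C N p" "bd C \<omega> N p" for p by (rule N.bd_group_hom)
  note e_bd = natural_map_chains(2)[OF M N \<eta>] and lift = chains_lift[OF M N \<eta> surj]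
  have acyc: "\<exists>b\<in>carrier (cell_chains C M (Suc p)). bd C \<omega> M p b = c"
    if "c \<in> carrier (cell_chains C M p)" "\<And>q. p = Suc q \<Longrightarrow> bd C \<omega> M q c = \<one>\<^bsub>cell_chains C M q\<^esub>" for c p
    using acyclic that unfolding acyclic_chains_def by blast
  \<comment> \<open>The apex of the span: chains of \<open>M\<close> whose image in \<open>N\<close>
    is a cycle. One leg takes this image, the other takes the boundary in \<open>M\<close>, which
    then lies in the kernel.\<close>
  let ?Z = "{m \<in> carrier (cell_chains C M (Suc p)). bd C \<omega> N p (?e (Suc p) m) = \<one>\<^bsub>cell_chains C N p\<^esub>}"
  show "subgroup_generated (cell_chains C N (Suc p)) (cycles (cell_chains C N) (bd C \<omega> N) (Suc p))
        Mod (bd C \<omega> N (Suc p) ` carrier (cell_chains C N (Suc (Suc p))))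
      \<cong> subgroup_generated (cell_chains C N' p) (cycles (cell_chains C N') (bd C \<omega> N') p)
        Mod (bd C \<omega> N' p ` carrier (cell_chains C N' (Suc p)))"
  proof (rule subquotient_iso[where G = "cell_chains C M (Suc p)" and S = ?Z and f = "?e (Suc p)" and g = "bd C \<omega> M p"])
    show "subgroup ?Z (cell_chains C M (Suc p))"
      by (rule group.subgroupI[OF M.group_chains]) auto
    show "?e (Suc p) ` ?Z = cycles (cell_chains C N) (bd C \<omega> N) (Suc p)"
    proof (intro equalityI subsetI)
      fix b assume "b \<in> cycles (cell_chains C N) (bd C \<omega> N) (Suc p)"
      then have b: "b \<in> carrier (cell_chains C N (Suc p))" "bd C \<omega> N p b = \<one>\<^bsub>cell_chains C N p\<^esub>"
        by (auto simp: N.cycles_iff)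
      with lift[OF _ _ b(1)] show "b \<in> ?e (Suc p) ` ?Z" by auto
    qed (auto simp: N.cycles_iff)
    show "bd C \<omega> M p ` ?Z = cycles (cell_chains C N') (bd C \<omega> N') p"
    proof (intro equalityI subsetI)
      fix c assume "c \<in> bd C \<omega> M p ` ?Z"
      then obtain m where m: "m \<in> carrier (cell_chains C M (Suc p))" "bd C \<omega> N p (?e (Suc p) m) = \<one>\<^bsub>cell_chains C N p\<^esub>"
        "c = bd C \<omega> M p m" by auto
      then have c: "c \<in> carrier (cell_chains C N' p)"
        using e_bd[OF m(1)] by (simp add: ker(2))
      moreover have "bd C \<omega> N' q c = \<one>\<^bsub>cell_chains C N' q\<^esub>" if "p = Suc q" for q
        using ker(5)[of c q] c m M.bd_bd that by (simp add: ker(4))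
      ultimately show "c \<in> cycles (cell_chains C N') (bd C \<omega> N') p" by (simp add: N'.cycles_iff)
    next
      fix c assume "c \<in> cycles (cell_chains C N') (bd C \<omega> N') p"
      then have c: "c \<in> carrier (cell_chains C N' p)" "\<And>q. p = Suc q \<Longrightarrow> bd C \<omega> N' q c = \<one>\<^bsub>cell_chains C N' q\<^esub>"
        by (auto simp: N'.cycles_iff)
      have cM: "c \<in> carrier (cell_chains C M p)" using c by (simp add: ker(2))
      have "bd C \<omega> M q c = \<one>\<^bsub>cell_chains C M q\<^esub>" if "p = Suc q" for q
        using c that ker(5)[of c q] by (simp add: ker(4))
      from acyc[OF cM this] obtain m where m: "m \<in> carrier (cell_chains C M (Suc p))" "bd C \<omega> M p m = c"
        by blast
      then have "bd C \<omega> N p (?e (Suc p) m) = \<one>\<^bsub>cell_chains C N p\<^esub>"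
        using e_bd[OF m(1)] c by (simp add: ker(2))
      with m show "c \<in> bd C \<omega> M p ` ?Z" by blast
    qed
    fix m assume "m \<in> ?Z"
    then have m: "m \<in> carrier (cell_chains C M (Suc p))" by simp
    show "?e (Suc p) m \<in> bd C \<omega> N (Suc p) ` carrier (cell_chains C N (Suc (Suc p)))
        \<longleftrightarrow> bd C \<omega> M p m \<in> bd C \<omega> N' p ` carrier (cell_chains C N' (Suc p))"
    proof
      assume "?e (Suc p) m \<in> bd C \<omega> N (Suc p) ` carrier (cell_chains C N (Suc (Suc p)))"
      then obtain b where b: "b \<in> carrier (cell_chains C N (Suc (Suc p)))" "?e (Suc p) m = bd C \<omega> N (Suc p) b" by blast
      obtain y where y: "y \<in> carrier (cell_chains C M (Suc (Suc p)))" "?e (Suc (Suc p)) y = b"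
        using lift[OF _ _ b(1)] by blast
      let ?y = "bd C \<omega> M (Suc p) y"
      have dy: "?y \<in> carrier (cell_chains C M (Suc p))" by (rule M.bd_closed[OF y(1)])
      \<comment> \<open>Since \<open>m\<close> and the boundary of \<open>y\<close> have the same
        image in \<open>N\<close>, their difference is a chain of the kernel, and its boundary is
        that of \<open>m\<close>.\<close>
      let ?x = "m \<otimes>\<^bsub>cell_chains C M (Suc p)\<^esub> inv\<^bsub>cell_chains C M (Suc p)\<^esub> ?y"
      have xM: "?x \<in> carrier (cell_chains C M (Suc p))" using m dy by simp
      have eq: "?e (Suc p) ?y = ?e (Suc p) m" using b y e_bd[OF y(1)] by simp
      have "?e (Suc p) ?x = \<one>\<^bsub>cell_chains C N (Suc p)\<^esub>"
        using m dy e.hom_closed[OF m] by (simp add: eq)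
      with xM have x: "?x \<in> carrier (cell_chains C N' (Suc p))" by (simp add: ker(2))
      have "bd C \<omega> N' p ?x = bd C \<omega> M p ?x" by (rule ker(5)[OF x])
      also have "\<dots> = bd C \<omega> M p m"
        using m dy M.bd_bd[OF y(1)] by simp
      finally show "bd C \<omega> M p m \<in> bd C \<omega> N' p ` carrier (cell_chains C N' (Suc p))"
        using x by (metis image_eqI)
    next
      assume "bd C \<omega> M p m \<in> bd C \<omega> N' p ` carrier (cell_chains C N' (Suc p))"
      then obtain x where x: "x \<in> carrier (cell_chains C N' (Suc p))" "bd C \<omega> M p m = bd C \<omega> M p x"
        using ker(5) by auto
      then have xM: "x \<in> carrier (cell_chains C M (Suc p))" and ex: "?e (Suc p) x = \<one>\<^bsub>cell_chains C N (Suc p)\<^esub>"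
        by (auto simp: ker(2))
      \<comment> \<open>A cycle of \<open>M\<close> with the same image in \<open>N\<close> as
        \<open>m\<close>; by acyclicity it is a boundary, and so is that image.\<close>
      let ?w = "m \<otimes>\<^bsub>cell_chains C M (Suc p)\<^esub> inv\<^bsub>cell_chains C M (Suc p)\<^esub> x"
      have w: "?w \<in> carrier (cell_chains C M (Suc p))" using m xM by simp
      have "bd C \<omega> M p ?w = \<one>\<^bsub>cell_chains C M p\<^esub>"
        using m xM M.bd_closed[OF xM] by (simp add: x(2))
      then obtain y where y: "y \<in> carrier (cell_chains C M (Suc (Suc p)))" "bd C \<omega> M (Suc p) y = ?w"
        using acyc[OF w] by auto
      have "bd C \<omega> N (Suc p) (?e (Suc (Suc p)) y) = ?e (Suc p) ?w"
        using e_bd[OF y(1)] y(2) by simp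
      also have "\<dots> = ?e (Suc p) m" using m xM e.hom_closed[OF m] by (simp add: ex)
      finally show "?e (Suc p) m \<in> bd C \<omega> N (Suc p) ` carrier (cell_chains C N (Suc (Suc p)))"
        using e.hom_closed[OF y(1)] by (metis image_eqI)
    qed
  next
    show "bd C \<omega> M p (x \<otimes>\<^bsub>cell_chains C M (Suc p)\<^esub> y) = bd C \<omega> M p x \<otimes>\<^bsub>cell_chains C N' p\<^esub> bd C \<omega> M p y"
      if "x \<in> ?Z" "y \<in> ?Z" for x y
      using that by (simp add: ker(3))
  qed (auto intro: M.comm_group_chains N.comm_group_chains N'.comm_group_chains N.subgroup_cycles
      N'.subgroup_cycles N.subgroup_boundaries N'.subgroup_boundaries
      subsetD[OF N.boundaries_cycles] subsetD[OF N'.boundaries_cycles])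
qed

section \<open>Borel-Moore chains as chains of the augmented complex\<close>

lemma sum_group_cong:
  assumes "\<And>i. i \<in> I \<Longrightarrow> G i = H i"
  shows "sum_group I G = sum_group I H"
proof -
  have "product_group I G = product_group I H"
    using assms by (auto simp: product_group_def fun_eq_iff restrict_def intro!: PiE_cong)
  moreover have "{x \<in> \<Pi>\<^sub>E i\<in>I. carrier (G i). finite {i \<in> I. x i \<noteq> \<one>\<^bsub>G i\<^esub>}}
      = {x \<in> \<Pi>\<^sub>E i\<in>I. carrier (H i). finite {i \<in> I. x i \<noteq> \<one>\<^bsub>H i\<^esub>}}"
    using assms by (simp cong: PiE_cong conj_cong)
  ultimately show ?thesis by (simp only: sum_group_def)
qed

text \<open>The trivial group at the empty simplex makes every chain on vertices a cycle.\<close>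

definition augment :: "('v set, 'a) diagram \<Rightarrow> ('v set, 'a) diagram" where
  "augment F = \<lparr>grp = (\<lambda>\<sigma>. if \<sigma> = {} then singleton_group undefined else grp F \<sigma>),
     arr = (\<lambda>\<sigma> \<tau>. if \<tau> = {} then \<lambda>x. undefined else arr F \<sigma> \<tau>)\<rparr>"

lemma augment_functor:
  assumes "ab_functor K (\<supseteq>) F"
  shows "ab_functor (insert {} K) (\<supseteq>) (augment F)"
proof -
  interpret ab_diagram K "(\<supseteq>)" F by unfold_locales fact
  show ?thesis
    unfolding ab_functor_def
  proof (intro conjI ballI impI)
    fix \<sigma> assume \<sigma>: "\<sigma> \<in> insert {} K"
    then show "comm_group (grp (augment F) \<sigma>)"
      using comm_group_grp by (auto simp: augment_def)
    show "arr (augment F) \<sigma> \<sigma> x = x" if "x \<in> carrier (grp (augment F) \<sigma>)" for x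
      using \<sigma> that arr_id by (auto simp: augment_def split: if_splits)
    fix \<tau> assume \<tau>: "\<tau> \<in> insert {} K"
    show "arr (augment F) \<sigma> \<tau> \<in> hom (grp (augment F) \<sigma>) (grp (augment F) \<tau>)" if "\<tau> \<subseteq> \<sigma>"
    proof (cases "\<tau> = {}")
      case True
      then show ?thesis by (simp add: augment_def hom_def singleton_group_def)
    next
      case False
      then have "\<sigma> \<noteq> {}" using that by auto
      with False show ?thesis using \<sigma> \<tau> that arr_hom by (auto simp: augment_def)
    qed
    fix \<rho> x assume \<rho>: "\<rho> \<in> insert {} K" "\<tau> \<subseteq> \<sigma>" "\<rho> \<subseteq> \<tau>" "x \<in> carrier (grp (augment F) \<sigma>)"
    show "arr (augment F) \<tau> \<rho> (arr (augment F) \<sigma> \<tau> x) = arr (augment F) \<sigma> \<rho> x"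
    proof (cases "\<rho> = {}")
      case False
      then have "\<sigma> \<noteq> {}" "\<tau> \<noteq> {}" using \<rho> by auto
      with False show ?thesis using \<sigma> \<tau> \<rho> arr_comp by (auto simp: augment_def)
    qed (simp add: augment_def)
  qed
qed

context oriented_simplicial_complex
begin

lemma cells_0: "cells C 0 = {{}}"
  using finite_cell by (auto simp: cells_def)

lemma nonempty_cells: "\<sigma> \<in> cells C (Suc p) \<Longrightarrow> \<sigma> \<in> K \<and> \<sigma> \<noteq> {}"
  by (auto simp: cells_def)

lemma cells_Suc: "cells C (Suc n) = simplices K n"
  by (auto simp: cells_def simplices_def)

text \<open>Simplices of dimension \<open>n\<close> have \<open>Suc n\<close> vertices, so the two
  complexes consist of the same groups up to this shift, and their differentials agree on chains.
  This gives an equality of quotient groups rather than an isomorphism. The two orderings may differ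
  outside \<open>K\<close>.\<close>

lemma borel_moore_homology_eq:
  assumes F: "ab_functor K (\<supseteq>) F"
    and \<omega>': "\<And>\<sigma>. \<sigma> \<in> K \<Longrightarrow> \<omega>' \<sigma> = \<omega> \<sigma>"
  shows "borel_moore_homology K \<omega>' F n = chain_homology (cell_chains C (augment F)) (bd C \<omega> (augment F)) (Suc n)"
proof -
  interpret A: cellular_chains C \<omega> "augment F"
    by (intro cellular_chains.intro oriented_complex_axioms ab_diagram.intro augment_functor F)
  have grp: "grp (augment F) \<sigma> = grp F \<sigma>" if "\<sigma> \<in> simplices K m" for \<sigma> m
    using that nonempty_cells[of \<sigma> m] by (simp add: cells_Suc augment_def)
  have bm: "bm_chains K F m = cell_chains C (augment F) (Suc m)" for m
    unfolding bm_chains_def cell_chains_def cells_Suc by (rule sum_group_cong) (simp add: grp)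
  interpret F: ab_diagram K "(\<supseteq>)" F by unfold_locales fact
  have bd: "bm_boundary K \<omega>' F m c = bd C \<omega> (augment F) (Suc m) c"
    if c: "c \<in> carrier (cell_chains C (augment F) (Suc (Suc m)))" for m c
    unfolding bm_boundary_def bd_def cells_Suc
  proof (rule restrict_ext)
    fix \<tau> assume \<tau>: "\<tau> \<in> simplices K m"
    then have "\<tau> \<in> K" "\<tau> \<noteq> {}" using nonempty_cells[of \<tau> m] by (auto simp: cells_Suc)
    then have arr: "arr (augment F) \<sigma> \<tau> = arr F \<sigma> \<tau>" for \<sigma> by (simp add: augment_def)
    interpret T: comm_group "grp F \<tau>" using F.comm_group_grp[OF \<open>\<tau> \<in> K\<close>] .
    have "incidence \<omega>' \<sigma> \<tau> = incidence \<omega> \<sigma> \<tau>" if "\<sigma> \<in> simplices K (Suc m)" for \<sigma>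
      using that \<open>\<tau> \<in> K\<close> \<omega>' by (simp add: incidence_def simplices_def)
    moreover have "arr F \<sigma> \<tau> (c \<sigma>) \<in> carrier (grp F \<tau>)" if "\<sigma> \<in> simplices K (Suc m)" "\<tau> \<subseteq> \<sigma>" for \<sigma>
      using that A.chains_closed[OF c, unfolded cells_Suc, OF that(1)] \<open>\<tau> \<in> K\<close>
      by (intro F.arr_closed) (auto simp: grp simplices_def)
    ultimately show "gfinprod (grp F \<tau>) (\<lambda>\<sigma>. arr F \<sigma> \<tau> (c \<sigma>) [^]\<^bsub>grp F \<tau>\<^esub> incidence \<omega>' \<sigma> \<tau>)
          {\<sigma> \<in> simplices K (Suc m). \<tau> \<subseteq> \<sigma>}
        = gfinprod (grp (augment F) \<tau>) (\<lambda>\<sigma>. arr (augment F) \<sigma> \<tau> (c \<sigma>) [^]\<^bsub>grp (augment F) \<tau>\<^esub> incidence \<omega> \<sigma> \<tau>)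
          {\<sigma> \<in> simplices K (Suc m). \<tau> \<subseteq> \<sigma>}"
      unfolding grp[OF \<tau>] arr by (intro T.gfinprod_cong) (auto simp: simp_implies_def)
  qed
  have cyc: "cycles (bm_chains K F) (bm_boundary K \<omega>' F) n = cycles (cell_chains C (augment F)) (bd C \<omega> (augment F)) (Suc n)"
  proof (cases n)
    case 0
    have "bd C \<omega> (augment F) 0 c = \<one>\<^bsub>cell_chains C (augment F) 0\<^esub>" if "c \<in> carrier (cell_chains C (augment F) (Suc 0))" for c
    proof
      fix \<sigma>
      have b: "bd C \<omega> (augment F) 0 c \<in> carrier (cell_chains C (augment F) 0)" by (rule A.bd_closed[OF that])
      show "bd C \<omega> (augment F) 0 c \<sigma> = \<one>\<^bsub>cell_chains C (augment F) 0\<^esub> \<sigma>"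
      proof (cases "\<sigma> \<in> cells C 0")
        case True
        then show ?thesis
          using A.chains_closed[OF b True] by (simp add: cells_0 augment_def cell_chains_def one_sum_group singleton_group_def)
      qed (simp add: bd_def cell_chains_def one_sum_group)
    qed
    then show ?thesis by (auto simp: 0 cycles_def kernel_def bm)
  next
    case (Suc m)
    then show ?thesis by (auto simp: cycles_def kernel_def bm bd)
  qed
  have "bm_boundary K \<omega>' F n ` carrier (cell_chains C (augment F) (Suc (Suc n)))
      = bd C \<omega> (augment F) (Suc n) ` carrier (cell_chains C (augment F) (Suc (Suc n)))"
    using bd by (intro image_cong) auto
  with cyc show ?thesis
    by (simp add: borel_moore_homology_def chain_homology_def bm)
qed

text \<open>By acyclicity in degree 0 the value of \<open>M\<close> at the empty simplex is
  generated by its values at vertices, where \<open>\<theta>\<close> vanishes. This yields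
  \<open>d d = 0\<close> on global cosections, since exactness of a resolution speaks of costalks
  only.\<close>

lemma natural_map_trivial_at_empty:
  assumes M: "cellular_chains C \<omega> M" and N: "cellular_chains C \<omega> N" and \<theta>: "natural_map C M N \<theta>"
    and acyclic: "acyclic_chains C \<omega> M"
    and triv: "\<And>\<sigma> x. \<sigma> \<in> K \<Longrightarrow> \<sigma> \<noteq> {} \<Longrightarrow> x \<in> carrier (grp M \<sigma>) \<Longrightarrow> \<theta> \<sigma> x = \<one>\<^bsub>grp N \<sigma>\<^esub>"
    and x: "x \<in> carrier (grp M {})"
  shows "\<theta> {} x = \<one>\<^bsub>grp N {}\<^esub>"
proof -
  interpret M: cellular_chains C \<omega> M by fact
  interpret N: cellular_chains C \<omega> N by fact
  let ?c = "sum_inj (cells C 0) (grp M) {} x"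
  have "?c \<in> carrier (cell_chains C M 0)" by (rule M.sum_inj_chains) (use x in \<open>simp_all add: cells_0\<close>)
  then obtain b where b: "b \<in> carrier (cell_chains C M (Suc 0))" "bd C \<omega> M 0 b = ?c"
    using acyclic unfolding acyclic_chains_def by blast
  have "sum_map (cells C (Suc 0)) \<theta> b = \<one>\<^bsub>cell_chains C N (Suc 0)\<^esub>"
    using triv nonempty_cells M.chains_closed[OF b(1)]
    by (auto simp: sum_map_def cell_chains_def one_sum_group intro!: restrict_ext)
  then have "bd C \<omega> N 0 (sum_map (cells C (Suc 0)) \<theta> b) = \<one>\<^bsub>cell_chains C N 0\<^esub>"
    using hom_one[OF N.bd_hom N.group_chains N.group_chains] by simp
  then have "sum_map (cells C 0) \<theta> ?c = \<one>\<^bsub>cell_chains C N 0\<^esub>"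
    using natural_map_chains(2)[OF M N \<theta> b(1)] b(2) by simp
  then have "sum_map (cells C 0) \<theta> ?c {} = \<one>\<^bsub>cell_chains C N 0\<^esub> {}" by simp
  then show ?thesis by (simp add: sum_map_def sum_inj_def cell_chains_def one_sum_group cells_0)
qed

end

text \<open>The left side is the form that Borel-Moore homology takes in
  \<open>borel_moore_homology_eq\<close>.\<close>

theorem cosheaf_homology_of_projective_resolution:
  fixes F :: "('v set, 'a) diagram" and P :: "nat \<Rightarrow> ('v set, 'p) precosheaf"
  assumes F: "cellular_cosheaf K F" and K: "oriented_simplicial_complex K \<omega>"
    and res: "projective_resolution (face_space K) (associated_cosheaf F) P d \<epsilon>"
  shows "chain_homology (cell_chains (insert {} K) (augment F)) (bd (insert {} K) \<omega> (augment F)) (Suc n)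
    \<cong> cosheaf_homology (face_space K) P d n"
proof -
  interpret oriented_simplicial_complex K \<omega> by fact
  interpret cellular K F by unfold_locales fact
  let ?X = "face_space K"
  have ne: "\<sigma> \<noteq> {}" if "\<sigma> \<in> K" for \<sigma> using that simplicial by (auto simp: abstract_simplicial_complex_def)
  have proj: "projective_cosheaf ?X (P q)" and d: "d q \<in> precosheaf_hom ?X (P (Suc q)) (P q)"
    and \<epsilon>: "\<epsilon> \<in> precosheaf_hom ?X (P 0) FF" and \<epsilon>_surj: "cosheaf_surj ?X (P 0) FF \<epsilon>"
    and ex0: "cosheaf_exact ?X (P 1) (P 0) FF (d 0) \<epsilon>"
    and ex: "cosheaf_exact ?X (P (Suc (Suc q))) (P (Suc q)) (P q) (d (Suc q)) (d q)" for q
    using res by (auto simp: projective_resolution_def)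
  have preP: "precosheaf ?X (P q)" for q using proj[of q] by (simp add: projective_cosheaf_def cosheaf_def)
  define M where "M q = star_diagram K (P q)" for q
  have grpM: "grp (M q) \<sigma> = grp (P q) (star K \<sigma>)" and arrM: "arr (M q) \<sigma> \<tau> = arr (P q) (star K \<sigma>) (star K \<tau>)"
    for q \<sigma> \<tau> by (simp_all add: M_def star_diagram_def)
  have M: "cellular_chains C \<omega> (M q)" for q
    unfolding M_def by (rule cellular_chains_star_diagram[OF preP])
  have acyclic: "acyclic_chains C \<omega> (M q)" for q
    unfolding M_def by (rule acyclic_chains_projective[OF proj])
  define \<delta> where "\<delta> q \<sigma> = d q (star K \<sigma>)" for q \<sigma>
  have \<delta>: "natural_map C (M (Suc q)) (M q) (\<delta> q)" for q
    unfolding M_def \<delta>_def[abs_def] by (rule precosheaf_hom_star_diagram[OF d])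
  let ?F = "augment F"
  have A: "cellular_chains C \<omega> ?F"
    by (intro cellular_chains.intro oriented_complex_axioms ab_diagram.intro augment_functor F.is_functor)
  \<comment> \<open>The augmentation of the resolution followed by the identification of costalks
    with the groups of \<open>F\<close>; at the empty simplex it is the only map to the trivial
    group.\<close>
  define \<eta> where "\<eta> \<sigma> = (if \<sigma> = {} then \<lambda>_. undefined else costalk_value \<sigma> \<circ> \<epsilon> (star K \<sigma>))" for \<sigma>
  have \<eta>_nat: "natural_map C (M 0) ?F \<eta>"
    unfolding natural_map_def
  proof (intro conjI ballI impI)
    fix \<sigma> assume \<sigma>: "\<sigma> \<in> C"
    show "\<eta> \<sigma> \<in> hom (grp (M 0) \<sigma>) (grp ?F \<sigma>)"
    proof (cases "\<sigma> = {}")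
      case True
      then show ?thesis by (simp add: \<eta>_def augment_def hom_def singleton_group_def)
    next
      case False
      then show ?thesis
        using hom_compose[OF precosheaf_homD(1)[OF \<epsilon> openin_star] costalk_value_hom[of \<sigma>]] \<sigma>
        by (simp add: \<eta>_def augment_def grpM)
    qed
    fix \<tau> x assume \<tau>: "\<tau> \<in> C" "\<tau> \<subseteq> \<sigma>" and x: "x \<in> carrier (grp (M 0) \<sigma>)"
    show "\<eta> \<tau> (arr (M 0) \<sigma> \<tau> x) = arr ?F \<sigma> \<tau> (\<eta> \<sigma> x)"
    proof (cases "\<tau> = {}")
      case False
      then have "\<sigma> \<noteq> {}" using \<tau> by auto
      with False \<sigma> \<tau> have K: "\<sigma> \<in> K" "\<tau> \<in> K" by auto
      have x: "x \<in> carrier (grp (P 0) (star K \<sigma>))" using x by (simp add: grpM)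
      have "\<epsilon> (star K \<tau>) (arr (P 0) (star K \<sigma>) (star K \<tau>) x) = arr FF (star K \<sigma>) (star K \<tau>) (\<epsilon> (star K \<sigma>) x)"
        by (rule precosheaf_homD(2)[OF \<epsilon> openin_star openin_star star_antimono[OF \<tau>(2)] x])
      then show ?thesis
        using costalk_value_natural[OF K \<tau>(2) precosheaf_homD(3)[OF \<epsilon> openin_star x]] False \<open>\<sigma> \<noteq> {}\<close>
        by (simp add: \<eta>_def arrM augment_def)
    qed (simp add: \<eta>_def augment_def)
  qed
  have mn: "min_nhd ?X \<sigma> = star K \<sigma>" if "\<sigma> \<in> K" for \<sigma> using that by (rule min_nhd_face_space)
  have \<eta>_surj: "\<eta> \<sigma> ` carrier (grp (M 0) \<sigma>) = carrier (grp ?F \<sigma>)" if "\<sigma> \<in> C" "\<sigma> \<noteq> {}" for \<sigma>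
  proof -
    have \<sigma>: "\<sigma> \<in> K" using that by auto
    have "\<epsilon> (star K \<sigma>) ` carrier (grp (P 0) (star K \<sigma>)) = carrier (grp FF (star K \<sigma>))"
      using \<epsilon>_surj \<sigma> by (auto simp: cosheaf_surj_def costalk_def mn)
    then have "costalk_value \<sigma> ` \<epsilon> (star K \<sigma>) ` carrier (grp (P 0) (star K \<sigma>)) = carrier (grp F \<sigma>)"
      using costalk_value_surj[OF \<sigma>] by simp
    then show ?thesis using that(2) by (simp add: \<eta>_def grpM augment_def image_comp)
  qed
  have \<eta>_ker: "\<delta> 0 \<sigma> ` carrier (grp (M 1) \<sigma>) = kernel (grp (M 0) \<sigma>) (grp ?F \<sigma>) (\<eta> \<sigma>)" if \<sigma>: "\<sigma> \<in> K" for \<sigma>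
  proof -
    have "\<delta> 0 \<sigma> ` carrier (grp (M 1) \<sigma>) = kernel (grp (P 0) (star K \<sigma>)) (grp FF (star K \<sigma>)) (\<epsilon> (star K \<sigma>))"
      using ex0 \<sigma> by (simp add: cosheaf_exact_def costalk_def mn \<delta>_def grpM)
    also have "\<dots> = kernel (grp (M 0) \<sigma>) (grp ?F \<sigma>) (\<eta> \<sigma>)"
      using costalk_value_eq_one[OF \<sigma> precosheaf_homD(3)[OF \<epsilon> openin_star]] ne[OF \<sigma>]
      by (auto simp: kernel_def grpM \<eta>_def augment_def)
    finally show ?thesis .
  qed
  have \<delta>_ker: "\<delta> (Suc q) \<sigma> ` carrier (grp (M (Suc (Suc q))) \<sigma>) = kernel (grp (M (Suc q)) \<sigma>) (grp (M q) \<sigma>) (\<delta> q \<sigma>)"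
    if \<sigma>: "\<sigma> \<in> K" for \<sigma> q
    using ex[of q] \<sigma> by (simp add: cosheaf_exact_def costalk_def mn \<delta>_def grpM)
  \<comment> \<open>The syzygies, defined at the empty simplex as well: there \<open>N q\<close> is
    the group of \<open>q\<close>-cycles of global cosections.\<close>
  define N where "N q = (case q of 0 \<Rightarrow> kernel_diagram (M 0) ?F \<eta>
    | Suc r \<Rightarrow> kernel_diagram (M (Suc r)) (M r) (\<delta> r))" for q
  have N: "cellular_chains C \<omega> (N q)" for q
    using chains_kernel_diagram(1)[OF M A \<eta>_nat] chains_kernel_diagram(1)[OF M M \<delta>]
    by (cases q) (auto simp: N_def)
  have N_mult: "monoid.mult (grp (N q) \<sigma>) = monoid.mult (grp (M q) \<sigma>)"
    and N_arr: "arr (N q) = arr (M q)" for q \<sigma>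
    by (cases q; simp add: N_def)+
  have \<delta>_surj: "\<delta> q \<sigma> ` carrier (grp (M (Suc q)) \<sigma>) = carrier (grp (N q) \<sigma>)" if "\<sigma> \<in> C" "\<sigma> \<noteq> {}" for q \<sigma>
    using that \<eta>_ker[of \<sigma>] \<delta>_ker[of \<sigma>] by (cases q) (auto simp: N_def carrier_kernel_diagram)
  \<comment> \<open>At nonempty simplices this is exactness. At the empty one it holds for
    \<open>q = 0\<close> because the target of \<open>\<eta>\<close> is trivial, and for larger
    \<open>q\<close> by \<open>natural_map_trivial_at_empty\<close>.\<close>
  have \<delta>_closed: "\<delta> q \<sigma> x \<in> carrier (grp (N q) \<sigma>)" if \<sigma>: "\<sigma> \<in> C" and x: "x \<in> carrier (grp (M (Suc q)) \<sigma>)" for q \<sigma> x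
  proof (cases "\<sigma> = {}")
    case False
    then show ?thesis using \<delta>_surj[OF \<sigma>] x by blast
  next
    case True
    have hom: "\<delta> q \<tau> \<in> hom (grp (M (Suc q)) \<tau>) (grp (M q) \<tau>)" if "\<tau> \<in> C" for q \<tau>
      using natural_mapD(1)[OF \<delta> that] .
    have mem: "\<delta> q \<sigma> x \<in> carrier (grp (M q) \<sigma>)" using hom_in_carrier[OF hom[OF \<sigma>] x] .
    show ?thesis
    proof (cases q)
      case 0
      then show ?thesis
        using mem True by (simp add: N_def carrier_kernel_diagram kernel_def \<eta>_def augment_def singleton_group_def)
    next
      case (Suc r)
      have "natural_map C (M (Suc q)) (M r) (\<lambda>\<sigma>. \<delta> r \<sigma> \<circ> \<delta> q \<sigma>)"
        using natural_map_compose[OF \<delta> \<delta>] unfolding Suc .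
      moreover have "(\<delta> r \<tau> \<circ> \<delta> q \<tau>) y = \<one>\<^bsub>grp (M r) \<tau>\<^esub>"
        if "\<tau> \<in> K" "\<tau> \<noteq> {}" "y \<in> carrier (grp (M (Suc q)) \<tau>)" for \<tau> y
        using \<delta>_ker[OF that(1), of r] that(3) Suc by (auto simp: kernel_def)
      ultimately have "(\<delta> r {} \<circ> \<delta> q {}) x = \<one>\<^bsub>grp (M r) {}\<^esub>"
        using natural_map_trivial_at_empty[OF M M _ acyclic] x True by blast
      then show ?thesis
        using mem True by (simp add: Suc N_def carrier_kernel_diagram kernel_def)
    qed
  qed
  have \<delta>N: "natural_map C (M (Suc q)) (N q) (\<delta> q)" for q
    unfolding natural_map_def
  proof (intro conjI ballI impI)
    show "\<delta> q \<sigma> \<in> hom (grp (M (Suc q)) \<sigma>) (grp (N q) \<sigma>)" if "\<sigma> \<in> C" for \<sigma>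
      using natural_mapD(1)[OF \<delta> that] \<delta>_closed[OF that] by (simp add: hom_def Pi_iff N_mult)
    show "\<delta> q \<tau> (arr (M (Suc q)) \<sigma> \<tau> x) = arr (N q) \<sigma> \<tau> (\<delta> q \<sigma> x)"
      if "\<sigma> \<in> C" "\<tau> \<in> C" "\<tau> \<subseteq> \<sigma>" "x \<in> carrier (grp (M (Suc q)) \<sigma>)" for \<sigma> \<tau> x
      unfolding N_arr by (rule natural_mapD(2)[OF \<delta> that])
  qed
  \<comment> \<open>A kernel depends on its target only through the unit, and \<open>N q\<close> has
    the same unit as \<open>M q\<close>.\<close>
  have N_Suc: "N (Suc q) = kernel_diagram (M (Suc q)) (N q) (\<delta> q)" for q
    by (simp add: N_def kernel_diagram_def kernel_def) (cases q; simp add: N_def kernel_diagram_def)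
  let ?H = "\<lambda>M. chain_homology (cell_chains C M) (bd C \<omega> M)"
  \<comment> \<open>Each shift lowers the degree and raises the syzygy by one, so \<open>q\<close>
    has to vary in the induction.\<close>
  have "?H (N q) m \<cong> ?H (N (q + m)) 0" for q m
  proof (induction m arbitrary: q)
    case 0
    show ?case by (simp add: iso_refl)
  next
    case (Suc m)
    have "?H (N q) (Suc m) \<cong> ?H (N (Suc q)) m"
      unfolding N_Suc by (rule dimension_shift[OF M N \<delta>N \<delta>_surj acyclic])
    with Suc[of "Suc q"] show ?case using iso_trans by fastforce
  qed
  from this[of 0 n] have "?H (N 0) n \<cong> ?H (N n) 0" by simp
  moreover have "?H ?F (Suc n) \<cong> ?H (N 0) n"
    unfolding N_def nat.case by (rule dimension_shift[OF M A \<eta>_nat \<eta>_surj acyclic])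
  ultimately have "?H ?F (Suc n) \<cong> ?H (N n) 0" using iso_trans by blast
  \<comment> \<open>The only cell of degree 0 is the empty simplex, so evaluation there turns chains
    into global cosections; the span has the identity as its other leg.\<close>
  also have "?H (N n) 0 \<cong> cosheaf_homology ?X P d n"
  proof -
    interpret NC: cellular_chains C \<omega> "N n" by (rule N)
    interpret MC: cellular_chains C \<omega> "M (Suc n)" by (rule M)
    interpret MCn: cellular_chains C \<omega> "M n" by (rule M)
    let ?Z = "carrier (grp (N n) {})"
    note \<delta>ch = natural_map_chains[OF M N \<delta>N]
    have empty: "{} \<in> C" "{} \<in> cells C 0" by (simp_all add: cells_0)
    have grpP: "grp (P q) K = grp (M q) {}" for q by (simp add: grpM star_empty)
    \<comment> \<open>For \<open>n = 0\<close> every global cosection is a cycle, in accordance with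
      the trivial target of \<open>\<eta>\<close> at the empty simplex.\<close>
    have cyc: "cycles (\<lambda>k. grp (P k) K) (\<lambda>k. d k K) n = ?Z"
      by (cases n) (auto simp: cycles_def N_def carrier_kernel_diagram kernel_def grpM star_empty \<delta>_def
          \<eta>_def augment_def singleton_group_def)
    have \<delta>_empty: "d n K = \<delta> n {}" by (simp add: \<delta>_def star_empty)
    have subZ: "subgroup ?Z (grp (P n) K)"
    proof -
      have "subgroup (kernel (grp (M n) {}) (grp L {}) (\<theta> {})) (grp (M n) {})"
        if "cellular_chains C \<omega> L" "natural_map C (M n) L \<theta>" for L :: "('v set, 'c) diagram" and \<theta>
      proof -
        interpret L: cellular_chains C \<omega> L by fact
        show ?thesis
          by (rule group_hom.subgroup_kernel[OF group_homI[OF MCn.group_grp[OF empty(1)]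
                L.group_grp[OF empty(1)] natural_mapD(1)[OF that(2) empty(1)]]])
      qed
      note kernel = this
      show ?thesis
        unfolding grpP
      proof (cases n)
        case 0
        then show "subgroup ?Z (grp (M n) {})"
          using kernel[OF A] \<eta>_nat by (simp add: N_def carrier_kernel_diagram)
      next
        case (Suc r)
        then show "subgroup ?Z (grp (M n) {})"
          using kernel[OF M, of r "\<delta> r"] \<delta> by (simp add: N_def carrier_kernel_diagram)
      qed
    qed
    have "subgroup_generated (cell_chains C (N n) 0) (carrier (cell_chains C (N n) 0)) Mod (bd C \<omega> (N n) 0 ` carrier (cell_chains C (N n) (Suc 0)))
        \<cong> subgroup_generated (grp (P n) K) ?Z Mod (d n K ` carrier (grp (P (Suc n)) K))"
    proof (rule subquotient_iso[where G = "cell_chains C (N n) 0" and S = "carrier (cell_chains C (N n) 0)" and f = id and g = "\<lambda>c. c {}"])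
      show "comm_group (grp (P n) K)" unfolding grpP by (rule MCn.comm_group_grp[OF empty(1)])
      show "subgroup (carrier (cell_chains C (N n) 0)) (cell_chains C (N n) 0)" "subgroup (carrier (cell_chains C (N n) 0)) (cell_chains C (N n) 0)"
        using group.subgroup_self[OF NC.group_chains] by auto
      show "(\<lambda>c. c {}) ` carrier (cell_chains C (N n) 0) = ?Z"
      proof (intro equalityI subsetI)
        fix x assume "x \<in> ?Z"
        then have "sum_inj (cells C 0) (grp (N n)) {} x \<in> carrier (cell_chains C (N n) 0)"
          by (rule NC.sum_inj_chains[OF empty(2)])
        moreover have "x = sum_inj (cells C 0) (grp (N n)) {} x {}" by (simp add: sum_inj_def cells_0)
        ultimately show "x \<in> (\<lambda>c. c {}) ` carrier (cell_chains C (N n) 0)" by blast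
      qed (use NC.chains_closed[OF _ empty(2)] in auto)
      show "(x \<otimes>\<^bsub>cell_chains C (N n) 0\<^esub> y) {} = x {} \<otimes>\<^bsub>grp (P n) K\<^esub> y {}" for x y
        using empty(2) by (simp add: cell_chains_def sum_group_mult_at N_mult grpP)
      show "subgroup (d n K ` carrier (grp (P (Suc n)) K)) (grp (P n) K)"
      proof (rule group_hom.img_is_subgroup[OF group_homI])
        show "group (grp (P (Suc n)) K)" "group (grp (P n) K)"
          unfolding grpP using MC.group_grp MCn.group_grp empty(1) by auto
        show "d n K \<in> hom (grp (P (Suc n)) K) (grp (P n) K)"
          using \<delta>[of n] empty(1) unfolding \<delta>_empty grpP natural_map_def by blast
      qed
      show "d n K ` carrier (grp (P (Suc n)) K) \<subseteq> ?Z"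
        unfolding \<delta>_empty grpP using \<delta>_closed[OF empty(1)] by blast
      fix c assume c: "c \<in> carrier (cell_chains C (N n) 0)"
      show "id c \<in> bd C \<omega> (N n) 0 ` carrier (cell_chains C (N n) (Suc 0)) \<longleftrightarrow> c {} \<in> d n K ` carrier (grp (P (Suc n)) K)"
      proof
        assume "id c \<in> bd C \<omega> (N n) 0 ` carrier (cell_chains C (N n) (Suc 0))"
        then obtain y where y: "y \<in> carrier (cell_chains C (N n) (Suc 0))" "c = bd C \<omega> (N n) 0 y" by auto
        \<comment> \<open>A vertex chain of \<open>N n\<close> lifts to \<open>P (Suc n)\<close>
          because the differential is onto on costalks; its image at the empty simplex is the
          required global cosection.\<close>
        obtain z where z: "z \<in> carrier (cell_chains C (M (Suc n)) (Suc 0))" "sum_map (cells C (Suc 0)) (\<delta> n) z = y"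
          using chains_lift[OF M N \<delta>N \<delta>_surj y(1)] by blast
        have "c {} = \<delta> n {} (bd C \<omega> (M (Suc n)) 0 z {})"
          using \<delta>ch(2)[OF z(1)] z(2) y(2) empty(2) by (simp add: sum_map_def)
        moreover have "bd C \<omega> (M (Suc n)) 0 z {} \<in> carrier (grp (M (Suc n)) {})"
          by (rule MC.chains_closed[OF MC.bd_closed[OF z(1)] empty(2)])
        ultimately show "c {} \<in> d n K ` carrier (grp (P (Suc n)) K)"
          unfolding \<delta>_empty grpP by blast
      next
        assume "c {} \<in> d n K ` carrier (grp (P (Suc n)) K)"
        then obtain x where x: "x \<in> carrier (grp (M (Suc n)) {})" "c {} = \<delta> n {} x"
          unfolding \<delta>_empty grpP by blast
        \<comment> \<open>Conversely, acyclicity in degree 0 writes the global cosection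
          \<open>x\<close> as the boundary of a vertex chain of \<open>P (Suc n)\<close>.\<close>
        obtain z where z: "z \<in> carrier (cell_chains C (M (Suc n)) (Suc 0))"
          "bd C \<omega> (M (Suc n)) 0 z = sum_inj (cells C 0) (grp (M (Suc n))) {} x"
          using acyclic[of "Suc n"] MC.sum_inj_chains[OF empty(2) x(1)] unfolding acyclic_chains_def by blast
        let ?y = "sum_map (cells C (Suc 0)) (\<delta> n) z"
        have y: "?y \<in> carrier (cell_chains C (N n) (Suc 0))" by (rule hom_in_carrier[OF \<delta>ch(1) z(1)])
        have "bd C \<omega> (N n) 0 ?y \<sigma> = c \<sigma>" for \<sigma>
          using \<delta>ch(2)[OF z(1)] z(2) x(2) NC.chains_extensional[OF c]
          by (simp add: sum_map_def sum_inj_def cells_0 extensional_def)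
        then have "c = bd C \<omega> (N n) 0 ?y" by auto
        with y show "id c \<in> bd C \<omega> (N n) 0 ` carrier (cell_chains C (N n) (Suc 0))" by auto
      qed
    qed (use NC.comm_group_chains NC.subgroup_boundaries NC.bd_closed subZ in auto)
    then show ?thesis
      unfolding cosheaf_homology_def chain_homology_def topspace_face_space cyc
      by (simp add: cycles_def)
  qed
  finally show ?thesis .
qed

text \<open>Cosheaf homology is read off from a resolution, so the isomorphism is asserted for every
  projective resolution valued in any type \<open>'p\<close>. The first conjunct names a type in
  which a resolution exists, so that the assertion is not empty there.\<close>

theorem theorem1p3:
  fixes K :: "'v set set"
    and \<omega> :: "'v set \<Rightarrow> 'v list"
    and F :: "('v set, 'a) diagram"
    and n :: nat
  assumes "abstract_simplicial_complex K"
    and "orientation K \<omega>"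
    and "cellular_cosheaf K F"
  shows "(\<exists>(P :: nat \<Rightarrow> ('v set, ('v set, ('v set \<Rightarrow> 'a) set) free_type) precosheaf) d \<epsilon>.
            projective_resolution (face_space K) (associated_cosheaf F) P d \<epsilon>) \<and>
         (\<forall>(P :: nat \<Rightarrow> ('v set, 'p) precosheaf) d \<epsilon>.
            projective_resolution (face_space K) (associated_cosheaf F) P d \<epsilon> \<longrightarrow>
            borel_moore_homology K \<omega> F n \<cong> cosheaf_homology (face_space K) P d n)"
proof (intro conjI allI impI)
  interpret cellular K F by unfold_locales fact
  show "\<exists>(P :: nat \<Rightarrow> ('v set, ('v set, ('v set \<Rightarrow> 'a) set) free_type) precosheaf) d \<epsilon>.
      projective_resolution (face_space K) (associated_cosheaf F) P d \<epsilon>"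
    by (rule face_space.projective_resolution_exists[OF cosheaf_FF])
  fix P :: "nat \<Rightarrow> ('v set, 'p) precosheaf" and d \<epsilon>
  assume res: "projective_resolution (face_space K) (associated_cosheaf F) P d \<epsilon>"
  \<comment> \<open>The only ordering of the empty simplex is added; the orderings of the simplices
    of \<open>K\<close> stay as given.\<close>
  let ?\<omega> = "\<omega>({} := [])"
  have ne: "{} \<notin> K" using assms(1) by (auto simp: abstract_simplicial_complex_def)
  have K: "oriented_simplicial_complex K ?\<omega>"
    using assms(1,2) ne by unfold_locales (auto simp: orientation_def)
  have "\<omega> \<sigma> = ?\<omega> \<sigma>" if "\<sigma> \<in> K" for \<sigma> using that ne by auto
  then show "borel_moore_homology K \<omega> F n \<cong> cosheaf_homology (face_space K) P d n"
    by (subst oriented_simplicial_complex.borel_moore_homology_eq[OF K F.is_functor])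
      (auto intro: cosheaf_homology_of_projective_resolution[OF assms(3) K res])
qed

end
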